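(* Define \[ \vartheta_5(a_0,a_1,a_2,a_3):=\frac{1}{5J_5^2}\Big[a_0J_{10,25}^3+a_1qJ_{5,25}J_{10,25}^2+a_2q^2J_{5,25}^2J_{10,25}+a_3q^3J_{5,25}^3\Big], \] \[ G_5(b_0,b_3):=b_0\,q^5g(q^5;q^{25})+b_3\,q^8g(q^{10};q^{25}). \] Then \begin{align*} D(0,5)&=2\vartheta_5(2,2,-1,1)+2G_5(-1,0),\\ D(1,5)=D(4,5)&=\vartheta_5(-1,-1,3,-3)+G_5(1,-1),\\ D(2,5)=D(3,5)&=\vartheta_5(-1,-1,-2,2)+G_5(0,1), \end{align*} and \begin{align*} D_C(0,5)&=2\vartheta_5(2,-3,-1,1),\\ D_C(1,5)=D_C(4,5)&=\vartheta_5(-1,4,-2,-3),\\ D_C(2,5)=D_C(3,5)&=\vartheta_5(-1,-1,3,2). \end{align*}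
   Context: Throughout, $q$ is a complex number with $0<|q|<1$. Write $(x)_n=(x;q)_n=\prod_{i=0}^{n-1}(1-q^ix)$ and $(x)_\infty=(x;q)_\infty=\prod_{i\ge0}(1-q^ix)$. Let $j(x;q)=(x)_\infty(q/x)_\infty(q)_\infty=\sum_{n\in\mathbb Z}(-1)^nq^{\binom n2}x^n$. For integers $a$ and $m\ge1$: $J_{a,m}=j(q^a;q^m)$ and $J_m=J_{m,3m}=\prod_{i\ge1}(1-q^{mi})$. The universal mock theta function is $g(x;q)=x^{-1}\big(-1+\sum_{n\ge0}\frac{q^{n^2}}{(x)_{n+1}(q/x)_n}\big)$. Ranks: define integers $N(m,n)$ by $\sum_{n\ge0}\sum_{m\in\mathbb Z}N(m,n)z^mq^n=\sum_{n\ge0}\frac{q^{n^2}}{(zq)_n(z^{-1}q)_n}$ (for $n\ge1$, the number of partitions of $n$ with rank $=$ largest part minus number of parts equal to $m$; $N(m,0)=\delta_{m,0}$). Cranks: define integers $C(m,n)$ by $\sum_{n\ge0}\sum_{m\in\mathbb Z}C(m,n)z^mq^n=\prod_{n\ge1}\frac{1-q^n}{(1-zq^n)(1-z^{-1}q^n)}$ (for $n\ge2$, the number of partitions of $n$ with Andrews–Garvan crank $m$: largest part if there are no ones, otherwise (number of parts larger than the number of ones) minus (number of ones); for $n\le1$: $C(0,0)=1$, $C(\pm1,1)=1$, $C(0,1)=-1$, others $0$). For $M\ge1$ and integer $a$, $N(a,M;n)=\sum_{m\equiv a \pmod M}N(m,n)$, $C(a,M;n)=\sum_{m\equiv a\pmod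 M}C(m,n)$; $p(n)$ is the number of partitions of $n$ ($p(0)=1$). Deviations: $D(a,M)=\sum_{n\ge0}(N(a,M;n)-p(n)/M)q^n$ and $D_C(a,M)=\sum_{n\ge0}(C(a,M;n)-p(n)/M)q^n$. *)

theory Defs
  imports "HOL-Analysis.Analysis" "HOL-Library.Multiset"
begin

definition qpoch :: "complex \<Rightarrow> complex \<Rightarrow> nat \<Rightarrow> complex" where
  "qpoch x q n = (\<Prod>i<n. 1 - q ^ i * x)"

definition qpoch_inf :: "complex \<Rightarrow> complex \<Rightarrow> complex" where
  "qpoch_inf x q = prodinf (\<lambda>i. 1 - q ^ i * x)"

definition jfun :: "complex \<Rightarrow> complex \<Rightarrow> complex" where
  "jfun x q = qpoch_inf x q * qpoch_inf (q / x) q * qpoch_inf q q"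

definition Jam :: "complex \<Rightarrow> nat \<Rightarrow> nat \<Rightarrow> complex" where
  "Jam q a m = jfun (q ^ a) (q ^ m)"

definition Jm :: "complex \<Rightarrow> nat \<Rightarrow> complex" where
  "Jm q m = Jam q m (3 * m)"

definition gmock :: "complex \<Rightarrow> complex \<Rightarrow> complex" where
  "gmock x q = inverse x *
     (-1 + (\<Sum>n. q ^ (n ^ 2) / (qpoch x q (n + 1) * qpoch (q / x) q n)))"

definition partitions :: "nat \<Rightarrow> nat multiset set" where
  "partitions n = {p. (\<forall>x\<in>#p. 0 < x) \<and> sum_mset p = n}"

definition npart :: "nat \<Rightarrow> nat" where
  "npart n = card (partitions n)"

definition rank :: "nat multiset \<Rightarrow> int" where
  "rank p = int (Max (set_mset p)) - int (size p)"

definition crank :: "nat multiset \<Rightarrow> int" where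
  "crank p = (if count p 1 = 0 then int (Max (set_mset p))
              else int (size (filter_mset (\<lambda>x. count p 1 < x) p)) - int (count p 1))"

definition Nrank :: "int \<Rightarrow> nat \<Rightarrow> int" where
  "Nrank m n = (if n = 0 then (if m = 0 then 1 else 0)
                else int (card {p \<in> partitions n. rank p = m}))"

definition Ccrank :: "int \<Rightarrow> nat \<Rightarrow> int" where
  "Ccrank m n = (if n = 0 then (if m = 0 then 1 else 0)
                 else if n = 1 then (if m = 1 \<or> m = -1 then 1 else if m = 0 then -1 else 0)
                 else int (card {p \<in> partitions n. crank p = m}))"

(* N(a,M;n) = sum over m = a (mod M) of N(m,n)  (finitely many nonzero terms) *)
definition Nmod :: "int \<Rightarrow> int \<Rightarrow> nat \<Rightarrow> int" where
  "Nmod a M n = (\<Sum>m | m mod M = a mod M \<and> Nrank m n \<noteq> 0. Nrank m n)"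

definition Cmod :: "int \<Rightarrow> int \<Rightarrow> nat \<Rightarrow> int" where
  "Cmod a M n = (\<Sum>m | m mod M = a mod M \<and> Ccrank m n \<noteq> 0. Ccrank m n)"

definition Dev :: "int \<Rightarrow> int \<Rightarrow> complex \<Rightarrow> complex" where
  "Dev a M q = (\<Sum>n. (of_int (Nmod a M n) - of_nat (npart n) / of_int M) * q ^ n)"

definition DevC :: "int \<Rightarrow> int \<Rightarrow> complex \<Rightarrow> complex" where
  "DevC a M q = (\<Sum>n. (of_int (Cmod a M n) - of_nat (npart n) / of_int M) * q ^ n)"

definition theta5 :: "complex \<Rightarrow> complex \<Rightarrow> complex \<Rightarrow> complex \<Rightarrow> complex \<Rightarrow> complex" where
  "theta5 q a0 a1 a2 a3 = 1 / (5 * (Jm q 5)^2) *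
     (a0 * (Jam q 10 25)^3 + a1 * q * Jam q 5 25 * (Jam q 10 25)^2
      + a2 * q^2 * (Jam q 5 25)^2 * Jam q 10 25 + a3 * q^3 * (Jam q 5 25)^3)"

definition G5 :: "complex \<Rightarrow> complex \<Rightarrow> complex \<Rightarrow> complex" where
  "G5 q b0 b3 = b0 * q^5 * gmock (q^5) (q^25) + b3 * q^8 * gmock (q^10) (q^25)"

end

theory Submission
  imports Defs "HOL-Complex_Analysis.Complex_Analysis" "HOL-Real_Asymp.Real_Asymp"
begin

text \<open>The numbers in the residue classes modulo 5 are read off the rank and crank generating functions
  at the fifth roots of unity \<open>z \<noteq> 1\<close>. There the crank generating function is a quotient of theta
  functions, which a 5-dissection of the triple product evaluates. The rank generating function is, up to
  simple factors, the Lerch sum of \<open>(-1)\<^sup>n q\<^bsup>n(3n+1)/2\<^esup> / (1 - z q\<^sup>n)\<close> over all integers \<open>n\<close>. Multiplying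
  numerators and denominators so as to replace \<open>1 - z q\<^sup>n\<close> by \<open>1 - q\<^bsup>5n\<^esup>\<close> leads to two sums over
  \<open>n \<noteq> 0\<close>. These are limits, as \<open>u \<rightarrow> 1\<close>, of values of a single Lerch sum with denominators \<open>1 - u q\<^bsup>5n\<^esup>\<close>,
  which is itself a Lerch sum of base \<open>q\<^bsup>25\<^esup>\<close>, hence a value of \<open>g\<close>, plus a quotient of theta functions.
  The identities between functions of \<open>u\<close> hold because a function holomorphic on the punctured plane with
  \<open>f(p u) = C u\<^sup>d f(u)\<close>, \<open>|p| < 1\<close> and \<open>d > 0\<close>, vanishes.\<close>

section \<open>The q-Pochhammer symbol\<close>

text \<open>As 1 - q^(5n) vanishes at n = 0, that term must be split off. It leaves sums
  \<open>reg e\<close>, 2 \<le> e \<le> 6, which n -> -n ties in pairs e, 8 - e: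
  \<open>reg 4\<close> is 0, and \<open>reg 3\<close> and \<open>reg 6\<close> give the rest. One
  Lerch sum yields both, because u -> q^5 u lowers e by 3 and partial fractions raise it by 5: from
  e = 4 one shift leads to 1 and then 6, two shifts to -2 and then 3. At u = 1 the Lerch sum and the
  theta quotient both have a pole, so the limit leaves derivatives of theta functions. Their
  logarithmic derivatives \<open>lam1\<close> and \<open>lam2\<close> are found from two linear
  relations, as rational numbers plus theta quotients; the rational numbers finally cancel against
  the term n = 0. The quintic forms in A, B over X^3 obtained in this way become the cubic forms
  over X^2 of the theorem because A^2 - A B - B^2 = (q)_inf X divides them. For the crank, the
  prescribed values at n = 1 are not those of the partition 1; the sum over genuine partitions
  exceeds the product by q - z q, and this must be put right.\<close>

lemma qpoch_0 [simp]: "qpoch x q 0 = 1"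
  by (simp add: qpoch_def)

lemma qpoch_Suc: "qpoch x q (Suc n) = qpoch x q n * (1 - q ^ n * x)"
  by (simp add: qpoch_def)

lemma qpoch_rec: "qpoch x q (Suc n) = (1 - x) * qpoch (q * x) q n"
  unfolding qpoch_def prod.lessThan_Suc_shift by (simp add: mult_ac)

lemma qpoch_eq_0_iff: "qpoch x q n = 0 \<longleftrightarrow> (\<exists>i<n. q ^ i * x = 1)"
  by (auto simp: qpoch_def eq_commute[of 1])

lemma qpoch_holomorphic [holomorphic_intros]:
  "f holomorphic_on S \<Longrightarrow> (\<lambda>x. qpoch (f x) q n) holomorphic_on S"
  unfolding qpoch_def by (intro holomorphic_intros)

lemma summable_norm_qpow:
  fixes q x :: complex
  assumes "norm q < 1"
  shows "summable (\<lambda>i. norm (q ^ i * x))"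
  using assms by (auto simp: norm_mult norm_power intro!: summable_mult2 summable_geometric)

lemma convergent_qpoch_inf:
  fixes q x :: complex
  assumes "norm q < 1"
  shows "convergent_prod (\<lambda>i. 1 - q ^ i * x)"
proof -
  have "summable (\<lambda>i. norm ((1 - q ^ i * x) - 1))"
    using summable_norm_qpow[OF assms, of x] by simp
  thus ?thesis
    by (intro abs_convergent_prod_imp_convergent_prod summable_imp_abs_convergent_prod)
qed

lemma qpoch_LIMSEQ:
  assumes "norm q < 1"
  shows "(\<lambda>n. qpoch x q n) \<longlonglongrightarrow> qpoch_inf x q"
proof -
  have "(\<lambda>n. \<Prod>i\<le>n. 1 - q ^ i * x) \<longlonglongrightarrow> qpoch_inf x q"
    unfolding qpoch_inf_def by (rule convergent_prod_LIMSEQ[OF convergent_qpoch_inf[OF assms]])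
  hence "(\<lambda>n. qpoch x q (Suc n)) \<longlonglongrightarrow> qpoch_inf x q"
    by (simp add: qpoch_def lessThan_Suc_atMost)
  thus ?thesis by (simp add: filterlim_sequentially_Suc)
qed

lemma qpoch_inf_rec:
  assumes "norm q < 1"
  shows "qpoch_inf x q = (1 - x) * qpoch_inf (q * x) q"
proof -
  have "(\<lambda>n. qpoch x q (Suc n)) \<longlonglongrightarrow> qpoch_inf x q"
    using qpoch_LIMSEQ[OF assms] by (simp add: filterlim_sequentially_Suc)
  moreover have "(\<lambda>n. qpoch x q (Suc n)) \<longlonglongrightarrow> (1 - x) * qpoch_inf (q * x) q"
    unfolding qpoch_rec by (intro tendsto_intros qpoch_LIMSEQ assms)
  ultimately show ?thesis by (rule LIMSEQ_unique)
qed

lemma qpoch_inf_split: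
  assumes "norm q < 1"
  shows "qpoch_inf x q = qpoch x q n * qpoch_inf (q ^ n * x) q"
proof (induction n)
  case (Suc n)
  have "qpoch_inf (q ^ n * x) q = (1 - q ^ n * x) * qpoch_inf (q ^ Suc n * x) q"
    using qpoch_inf_rec[OF assms, of "q ^ n * x"] by (simp add: mult_ac)
  thus ?case using Suc by (simp add: qpoch_Suc mult_ac)
qed simp

lemma qpoch_inf_eq_0_iff:
  assumes "norm q < 1"
  shows "qpoch_inf x q = 0 \<longleftrightarrow> (\<exists>i. q ^ i * x = 1)"
proof
  assume "qpoch_inf x q = 0"
  hence "(\<lambda>i. 1 - q ^ i * x) has_prod 0"
    using convergent_qpoch_inf[OF assms] by (metis convergent_prod_has_prod qpoch_inf_def)
  thus "\<exists>i. q ^ i * x = 1" by (auto simp: has_prod_0_iff)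
next
  assume "\<exists>i. q ^ i * x = 1"
  then obtain i where i: "q ^ i * x = 1" by blast
  hence "qpoch x q (Suc i) = 0" by (auto simp: qpoch_eq_0_iff)
  thus "qpoch_inf x q = 0" using qpoch_inf_split[OF assms, of x "Suc i"] by simp
qed

text \<open>On a disc of radius 1 the partial products converge uniformly, as the factor of index n
  differs from 1 by at most \<open>norm q ^ n * (norm x + 1)\<close>; the limit inherits
  holomorphy.\<close>

lemma qpoch_inf_holomorphic:
  assumes "norm q < 1"
  shows "(\<lambda>x. qpoch_inf x q) holomorphic_on UNIV"
proof (rule holomorphic_uniform_sequence[where f = "\<lambda>n x. qpoch x q n"])
  fix x :: complex
  let ?K = "cball x 1"
  have "uniformly_convergent_on ?K (\<lambda>N y. \<Sum>n<N. norm (- (q ^ n * y)))"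
  proof (rule Weierstrass_m_test'[where M = "\<lambda>n. norm q ^ n * (norm x + 1)"])
    fix n y assume "y \<in> ?K"
    hence "norm y \<le> norm x + 1"
      using norm_triangle_ineq3[of x y] by (simp add: dist_norm abs_le_iff)
    thus "norm (norm (- (q ^ n * y))) \<le> norm q ^ n * (norm x + 1)"
      by (simp add: norm_mult norm_power mult_left_mono)
  next
    show "summable (\<lambda>n. norm q ^ n * (norm x + 1))"
      using assms by (intro summable_mult2 summable_geometric) simp
  qed
  hence "uniformly_convergent_on ?K (\<lambda>N y. \<Prod>n<N. 1 + (- (q ^ n * y)))"
    by (intro uniformly_convergent_on_prod[where f = "\<lambda>n y. - (q ^ n * y)"] continuous_intros) simp_all
  hence "uniformly_convergent_on ?K (\<lambda>n y. qpoch y q n)"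
    by (simp add: qpoch_def)
  then obtain l where l: "uniform_limit ?K (\<lambda>n y. qpoch y q n) l sequentially"
    by (auto simp: uniformly_convergent_on_def)
  have "l y = qpoch_inf y q" if "y \<in> ?K" for y
    using tendsto_uniform_limitI[OF l that] qpoch_LIMSEQ[OF assms, of y] LIMSEQ_unique by blast
  hence "uniform_limit ?K (\<lambda>n x. qpoch x q n) (\<lambda>x. qpoch_inf x q) sequentially"
    using l by (subst uniform_limit_cong'[where g = "\<lambda>n x. qpoch x q n" and i = l]) auto
  thus "\<exists>d>0. cball x d \<subseteq> UNIV \<and>
          uniform_limit (cball x d) (\<lambda>n x. qpoch x q n) (\<lambda>x. qpoch_inf x q) sequentially"
    by (intro exI[of _ 1]) simp
next
  show "(\<lambda>x. qpoch x q n) holomorphic_on UNIV" for n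
    by (intro holomorphic_intros)
qed simp

lemma qpoch_inf_holomorphic' [holomorphic_intros]:
  assumes "norm q < 1" "f holomorphic_on S"
  shows "(\<lambda>x. qpoch_inf (f x) q) holomorphic_on S"
  using holomorphic_on_compose[OF assms(2), of "\<lambda>x. qpoch_inf x q"]
    holomorphic_on_subset[OF qpoch_inf_holomorphic[OF assms(1)]] by (auto simp: o_def)

lemma qpoch_multisection:
  assumes "0 < m"
  shows "qpoch x q (m * n) = (\<Prod>i<m. qpoch (q ^ i * x) (q ^ m) n)"
proof (induction n)
  case (Suc n)
  have "qpoch x q (m * n + k) = qpoch x q (m * n) * (\<Prod>i<k. 1 - (q ^ m) ^ n * (q ^ i * x))" for k
    by (induction k) (simp_all add: qpoch_Suc power_add power_mult mult_ac)
  from this[of m] show ?case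
    using Suc by (simp add: qpoch_Suc prod.distrib add.commute mult_ac)
qed simp

lemma qpoch_inf_multisection:
  assumes "norm q < 1" "0 < m"
  shows "qpoch_inf x q = (\<Prod>i<m. qpoch_inf (q ^ i * x) (q ^ m))"
proof -
  have qm: "norm (q ^ m) < 1"
    using assms by (simp add: norm_power power_less_one_iff)
  have "filterlim (\<lambda>n. m * n) at_top sequentially"
    using assms(2) by (simp add: mult_nat_left_at_top)
  hence "(\<lambda>n. qpoch x q (m * n)) \<longlonglongrightarrow> qpoch_inf x q"
    using qpoch_LIMSEQ[OF assms(1), of x] by (rule filterlim_compose[rotated])
  moreover have "(\<lambda>n. qpoch x q (m * n)) \<longlonglongrightarrow> (\<Prod>i<m. qpoch_inf (q ^ i * x) (q ^ m))"
    unfolding qpoch_multisection[OF assms(2)] by (intro tendsto_intros qpoch_LIMSEQ qm)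
  ultimately show ?thesis by (rule LIMSEQ_unique)
qed

lemma powi_neq_1:
  fixes q :: complex
  assumes "norm q < 1" "q \<noteq> 0" "n \<noteq> 0"
  shows "q powi n \<noteq> 1"
proof -
  have "q ^ k \<noteq> 1" if "0 < k" for k
    using assms that by (metis norm_one norm_power power_less_one_iff less_irrefl norm_ge_zero)
  hence "q ^ nat \<bar>n\<bar> \<noteq> 1" using assms by simp
  thus ?thesis using assms by (auto simp: power_int_def field_simps split: if_splits)
qed

lemma qpoch_self_nonzero:
  assumes "norm q < 1"
  shows "qpoch q q n \<noteq> 0" "qpoch_inf q q \<noteq> 0"
proof -
  have *: "q ^ i * q \<noteq> 1" for i
    using assms by (metis norm_one norm_power power_Suc2 power_less_one_iff less_irrefl norm_ge_zero
        zero_less_Suc)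
  show "qpoch q q n \<noteq> 0" using * by (auto simp: qpoch_eq_0_iff)
  show "qpoch_inf q q \<noteq> 0" using * assms by (auto simp: qpoch_inf_eq_0_iff)
qed

section \<open>Theta functions\<close>

lemma jfun_holomorphic [holomorphic_intros]:
  assumes "norm q < 1" "f holomorphic_on S" "\<And>z. z \<in> S \<Longrightarrow> f z \<noteq> 0"
  shows "(\<lambda>x. jfun (f x) q) holomorphic_on S"
  unfolding jfun_def using assms by (intro holomorphic_intros) auto

lemma jfun_reflect: "q \<noteq> 0 \<Longrightarrow> jfun (q / x) q = jfun x q"
  by (simp add: jfun_def mult_ac)

lemma jfun_rec:
  assumes "norm q < 1" "q \<noteq> 0" "x \<noteq> 0"
  shows "jfun (q * x) q = - jfun x q / x"
proof -
  have 1: "jfun x q = (1 - x) * qpoch_inf (q * x) q * qpoch_inf (q / x) q * qpoch_inf q q"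
    unfolding jfun_def by (subst qpoch_inf_rec[OF assms(1), of x]) simp
  have "qpoch_inf (1 / x) q = (1 - 1 / x) * qpoch_inf (q / x) q"
    by (subst qpoch_inf_rec[OF assms(1)]) simp
  hence 2: "jfun (q * x) q = qpoch_inf (q * x) q * ((1 - 1 / x) * qpoch_inf (q / x) q) * qpoch_inf q q"
    using assms by (simp add: jfun_def)
  show ?thesis unfolding 1 2 using assms(3) by (simp add: field_simps)
qed

lemma jfun_inverse:
  assumes "norm q < 1" "q \<noteq> 0" "x \<noteq> 0"
  shows "jfun (1 / x) q = - jfun x q / x"
  using jfun_reflect[of q "1 / x"] jfun_rec[of q x] assms by simp

lemma jfun_1 [simp]: "norm q < 1 \<Longrightarrow> jfun 1 q = 0"
  using qpoch_inf_rec[of q 1] by (simp add: jfun_def)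

lemma jfun_eq_0_iff:
  assumes "norm q < 1" "q \<noteq> 0" "x \<noteq> 0"
  shows "jfun x q = 0 \<longleftrightarrow> (\<exists>n. x = q powi n)"
proof -
  have "(\<exists>i. q ^ i * x = 1) \<or> (\<exists>i. q ^ i * (q / x) = 1) \<longleftrightarrow> (\<exists>n. x = q powi n)" (is "?L = ?R")
  proof
    assume ?L
    then consider i where "q ^ i * x = 1" | i where "q ^ i * (q / x) = 1" by blast
    thus ?R
    proof cases
      case 1
      hence "x = q powi (- int i)" using assms by (simp add: power_int_minus field_simps)
      thus ?thesis by blast
    next
      case 2
      hence "x = q powi int (Suc i)" using assms by (simp add: field_simps del: of_nat_Suc)
      thus ?thesis by blast
    qed
  next
    assume ?R
    then obtain n where n: "x = q powi n" by blast
    show ?L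
    proof (cases "n \<le> 0")
      case True
      then obtain k where "n = - int k" by (metis nonpos_int_cases)
      hence "q ^ k * x = 1" using n assms by (simp add: power_int_minus)
      thus ?thesis by blast
    next
      case False
      then obtain k where "n = int (Suc k)" by (metis not_le pos_int_cases gr0_implies_Suc)
      hence "q ^ k * (q / x) = 1" using n assms by (simp del: of_nat_Suc)
      thus ?thesis by blast
    qed
  qed
  thus ?thesis
    using assms qpoch_self_nonzero(2)[OF assms(1)] by (simp add: jfun_def qpoch_inf_eq_0_iff)
qed

lemma jfun_nonzero_powi:
  assumes "norm q < 1" "q \<noteq> 0" "\<not> int m dvd k" "m > 0"
  shows "jfun (q powi k) (q ^ m) \<noteq> 0"
proof
  assume "jfun (q powi k) (q ^ m) = 0"
  moreover have "norm (q ^ m) < 1"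
    using assms by (simp add: norm_power power_less_one_iff)
  ultimately obtain n where "q powi k = (q ^ m) powi n"
    using assms jfun_eq_0_iff[of "q ^ m" "q powi k"] by auto
  also have "\<dots> = q powi (int m * n)" by (simp add: power_int_mult)
  finally have "q powi (k - int m * n) = 1" using assms by (simp add: power_int_diff)
  hence "k - int m * n = 0" using powi_neq_1 assms by blast
  thus False using assms by simp
qed

text \<open>The function \<open>jfun x q / (1 - x)\<close> with its singularity at \<open>1\<close> removed.\<close>

definition jred :: "complex \<Rightarrow> complex \<Rightarrow> complex" where
  "jred x q = qpoch_inf (q * x) q * qpoch_inf (q / x) q * qpoch_inf q q"

lemma jfun_conv_jred: "norm q < 1 \<Longrightarrow> jfun x q = (1 - x) * jred x q"
  unfolding jfun_def jred_def by (subst qpoch_inf_rec[of q x]) auto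

lemma jred_holomorphic [holomorphic_intros]:
  assumes "norm q < 1" "f holomorphic_on S" "\<And>z. z \<in> S \<Longrightarrow> f z \<noteq> 0"
  shows "(\<lambda>x. jred (f x) q) holomorphic_on S"
  unfolding jred_def using assms by (intro holomorphic_intros) auto

lemma jred_1: "jred 1 q = qpoch_inf q q ^ 3"
  by (simp add: jred_def power3_eq_cube)

lemma jred_inverse: "jred (1 / x) q = jred x q"
  by (simp add: jred_def mult_ac)

text \<open>The map x -> 1/x leaves \<open>jred\<close> invariant, fixes 1 and has derivative -1
  there, so the derivative equals its own negative.\<close>

lemma deriv_jred_1:
  assumes "norm q < 1"
  shows "((\<lambda>x. jred x q) has_field_derivative 0) (at 1)"
proof -
  have "(\<lambda>x. jred x q) holomorphic_on - {0}"
    using assms by (intro holomorphic_intros) auto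
  then obtain D where D: "((\<lambda>x. jred x q) has_field_derivative D) (at 1)"
    using holomorphic_derivI[of "\<lambda>x. jred x q" "- {0}" 1] by (auto simp: open_Compl)
  have "((\<lambda>x. jred (1 / x) q) has_field_derivative D * (- 1)) (at 1)"
  proof (rule DERIV_chain2[of "\<lambda>x. jred x q" D "\<lambda>x. 1 / x"])
    show "((\<lambda>x::complex. 1 / x) has_field_derivative - 1) (at 1)"
      by (auto intro!: derivative_eq_intros)
  qed (use D in auto)
  hence "D * (- 1) = D" using D unfolding jred_inverse by (rule DERIV_unique)
  hence "D = 0" by simp
  thus ?thesis using D by simp
qed

lemma deriv_jfun_1:
  assumes "norm q < 1"
  shows "((\<lambda>x. jfun x q) has_field_derivative - (qpoch_inf q q ^ 3)) (at 1)"
proof -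
  have "((\<lambda>x. (1 - x) * jred x q) has_field_derivative - (qpoch_inf q q ^ 3)) (at 1)"
    using deriv_jred_1[OF assms] by (auto intro!: derivative_eq_intros simp: jred_1)
  thus ?thesis by (simp add: jfun_conv_jred[OF assms])
qed

section \<open>The Jacobi triple product\<close>

definition theta_term :: "complex \<Rightarrow> complex \<Rightarrow> int \<Rightarrow> complex" where
  "theta_term x q n = (-1) powi n * q powi (n * (n - 1) div 2) * x powi n"

lemma triangle_Suc: "(n + 1) * n div 2 = n * (n - 1) div 2 + (n :: int)"
proof -
  have "(n + 1) * n = n * (n - 1) + n * 2" by (simp add: algebra_simps)
  thus ?thesis by simp
qed

lemma theta_term_0 [simp]: "theta_term x q 0 = 1"
  by (simp add: theta_term_def)

lemma theta_term_Suc: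
  assumes "q \<noteq> 0" "x \<noteq> 0"
  shows "theta_term x q (n + 1) = - x * q powi n * theta_term x q n"
  using assms triangle_Suc[of n] by (simp add: theta_term_def power_int_add mult_ac)

lemma theta_term_diff_1:
  assumes "q \<noteq> 0" "x \<noteq> 0"
  shows "theta_term x q (n - 1) = - (q / x) * theta_term (x / q) q n"
  using theta_term_Suc[OF assms, of "n - 1"] assms
  by (simp add: theta_term_def power_int_diff power_int_divide_distrib field_simps)

lemma theta_term_mult: "theta_term (x * y) q n = theta_term x q n * y powi n"
  by (simp add: theta_term_def power_int_mult_distrib mult_ac)

lemma theta_term_uminus:
  assumes "q \<noteq> 0" "x \<noteq> 0"
  shows "theta_term x q (- n) = theta_term (q / x) q n"
proof -
  have "- n * (- n - 1) div 2 = n * (n - 1) div 2 + n"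
    using triangle_Suc[of n] by (simp add: algebra_simps)
  moreover have "(-1 :: complex) powi (- n) = (-1) powi n"
    by (metis inverse_minus_eq inverse_1 power_int_inverse power_int_minus)
  ultimately show ?thesis
    using assms by (simp add: theta_term_def power_int_add power_int_minus power_int_divide_distrib field_simps)
qed

lemma theta_term_of_nat: "theta_term x q (int n) = (-1) ^ n * q ^ (n * (n - 1) div 2) * x ^ n"
proof -
  have "int n * (int n - 1) div 2 = int (n * (n - 1) div 2)"
    by (cases n) (simp_all add: zdiv_int algebra_simps)
  thus ?thesis by (simp add: theta_term_def)
qed

lemma has_sum_int:
  fixes f :: "int \<Rightarrow> 'a :: topological_comm_monoid_add"
  assumes "((\<lambda>n. f (int n)) has_sum a) UNIV" "((\<lambda>n. f (- int (Suc n))) has_sum b) UNIV"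
  shows "(f has_sum (a + b)) UNIV"
proof -
  have "(f has_sum a) (range int)"
    using assms(1) by (subst has_sum_reindex) (auto simp: o_def)
  moreover have "(f has_sum b) (range (\<lambda>n. - int (Suc n)))"
    using assms(2) by (subst has_sum_reindex) (auto simp: o_def inj_on_def)
  moreover have "range int \<union> range (\<lambda>n. - int (Suc n)) = UNIV"
  proof (intro set_eqI iffI UNIV_I)
    fix n :: int
    show "n \<in> range int \<union> range (\<lambda>n. - int (Suc n))"
      by (cases n rule: int_cases) auto
  qed
  moreover have "range int \<inter> range (\<lambda>n. - int (Suc n)) = {}" by auto
  ultimately show ?thesis
    using has_sum_Un_disjoint by metis
qed

text \<open>Consecutive terms have quotient \<open>q ^ n * r\<close>, which is eventually below 1/2
  however large r is.\<close>

lemma summable_gauss: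
  fixes q r :: real
  assumes "0 \<le> q" "q < 1" "0 \<le> r"
  shows "summable (\<lambda>n. q ^ (n * (n - 1) div 2) * r ^ n)"
proof -
  have "(\<lambda>n. q ^ n * r) \<longlonglongrightarrow> 0 * r"
    using assms by (intro tendsto_intros LIMSEQ_power_zero) simp
  hence "eventually (\<lambda>n. q ^ n * r < 1 / 2) sequentially"
    by (rule order_tendstoD) simp
  then obtain N where N: "q ^ n * r < 1 / 2" if "n \<ge> N" for n
    by (auto simp: eventually_sequentially)
  show ?thesis
  proof (rule summable_ratio_test[of "1 / 2" N])
    fix n assume n: "n \<ge> N"
    have e: "Suc n * n div 2 = n * (n - 1) div 2 + n"
      by (cases n) (simp_all add: algebra_simps)
    have "q ^ (Suc n * (Suc n - 1) div 2) * r ^ Suc n = (q ^ n * r) * (q ^ (n * (n - 1) div 2) * r ^ n)"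
      by (simp add: e power_add del: mult_Suc)
    also have "\<dots> \<le> 1 / 2 * (q ^ (n * (n - 1) div 2) * r ^ n)"
      using N[OF n] assms by (intro mult_right_mono) auto
    finally show "norm (q ^ (Suc n * (Suc n - 1) div 2) * r ^ Suc n) \<le> 1 / 2 * norm (q ^ (n * (n - 1) div 2) * r ^ n)"
      using assms by simp
  qed simp
qed

lemma summable_norm_theta_term:
  assumes "norm q < 1"
  shows "summable (\<lambda>n. norm (theta_term x q (int n)))"
  using summable_gauss[of "norm q" "norm x"] assms
  by (simp add: theta_term_of_nat norm_mult norm_power)

lemma theta_term_abs_summable:
  assumes "norm q < 1" "q \<noteq> 0" "x \<noteq> 0"
  shows "(\<lambda>n. norm (theta_term x q n)) summable_on UNIV"
proof -
  have 1: "(\<lambda>n. norm (theta_term x q (int n))) summable_on UNIV"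
    using summable_norm_theta_term[OF assms(1)]
    by (intro norm_summable_imp_summable_on) simp
  have "summable (\<lambda>n. norm (theta_term (q / x) q (int (Suc n))))"
    using summable_norm_theta_term[OF assms(1)] by (subst summable_Suc_iff)
  hence 2: "(\<lambda>n. norm (theta_term x q (- int (Suc n)))) summable_on UNIV"
    using assms by (intro norm_summable_imp_summable_on) (simp add: theta_term_uminus del: of_nat_Suc)
  show ?thesis
    using has_sum_int[OF has_sum_infsum[OF 1] has_sum_infsum[OF 2]] has_sum_imp_summable by blast
qed

section \<open>Gaussian binomial coefficients and the finite form of the triple product\<close>

fun qbinom :: "complex \<Rightarrow> nat \<Rightarrow> nat \<Rightarrow> complex" where
  "qbinom q n 0 = 1"
| "qbinom q 0 (Suc k) = 0"
| "qbinom q (Suc n) (Suc k) = qbinom q n (Suc k) + q ^ (n - k) * qbinom q n k"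

lemma qbinom_eq_0: "n < k \<Longrightarrow> qbinom q n k = 0"
  by (induction q n k rule: qbinom.induct) auto

lemma qbinom_self [simp]: "qbinom q n n = 1"
  by (induction n) (auto simp: qbinom_eq_0)

lemma qbinom_qpoch: "k \<le> n \<Longrightarrow> qbinom q n k * (qpoch q q k * qpoch q q (n - k)) = qpoch q q n"
proof (induction q n k rule: qbinom.induct)
  case (3 q n k)
  show ?case
  proof (cases "k = n")
    case False
    with 3 have k: "Suc k \<le> n" by simp
    define m where "m = n - Suc k"
    have n: "n - k = Suc m" "n - Suc k = m" using k by (auto simp: m_def)
    have nn: "q ^ n = q ^ (n - k) * q ^ k" using k by (simp flip: power_add)
    have "qbinom q (Suc n) (Suc k) * (qpoch q q (Suc k) * qpoch q q (Suc n - Suc k)) =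
        (1 - q ^ (n - k)) * (qbinom q n (Suc k) * (qpoch q q (Suc k) * qpoch q q (n - Suc k)))
        + q ^ (n - k) * (1 - q ^ Suc k) * (qbinom q n k * (qpoch q q k * qpoch q q (n - k)))"
      by (simp add: n qpoch_Suc algebra_simps)
    also have "\<dots> = (1 - q ^ (n - k)) * qpoch q q n + q ^ (n - k) * (1 - q ^ Suc k) * qpoch q q n"
      using 3 k by simp
    also have "\<dots> = qpoch q q (Suc n)"
      by (simp add: qpoch_Suc nn algebra_simps)
    finally show ?thesis .
  qed simp
qed auto

text \<open>The finite q-binomial theorem. Adjoining the factor \<open>1 - q ^ n * x\<close> acts on
  the coefficients as the recursion that defines \<open>qbinom\<close>.\<close>

lemma qpoch_binomial: "qpoch x q n = (\<Sum>k\<le>n. (-1) ^ k * q ^ (k * (k - 1) div 2) * qbinom q n k * x ^ k)"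
proof (induction n)
  case (Suc n)
  define T where "T = (\<lambda>k::nat. q ^ (k * (k - 1) div 2))"
  define f where "f = (\<lambda>n k. (-1) ^ k * T k * qbinom q n k * x ^ k)"
  have e: "Suc k * (Suc k - 1) div 2 = k * (k - 1) div 2 + k" for k :: nat
    by (cases k) (simp_all add: algebra_simps)
  have T: "T (Suc k) = T k * q ^ k" for k
    unfolding T_def e power_add ..
  have "(\<Sum>k\<le>Suc n. f (Suc n) k) = f (Suc n) 0 + (\<Sum>k\<le>n. f (Suc n) (Suc k))"
    by (rule sum.atMost_Suc_shift)
  also have "(\<Sum>k\<le>n. f (Suc n) (Suc k)) = (\<Sum>k\<le>n. f n (Suc k) - q ^ n * x * f n k)"
  proof (rule sum.cong)
    fix k assume "k \<in> {..n}"
    hence "q ^ n = q ^ (n - k) * q ^ k" by (simp flip: power_add)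
    thus "f (Suc n) (Suc k) = f n (Suc k) - q ^ n * x * f n k"
      unfolding f_def by (simp add: T algebra_simps)
  qed simp
  also have "\<dots> = (\<Sum>k\<le>n. f n (Suc k)) - q ^ n * x * (\<Sum>k\<le>n. f n k)"
    by (simp add: sum_subtractf sum_distrib_left)
  also have "f (Suc n) 0 = f n 0" by (simp add: f_def)
  also have "f n 0 + ((\<Sum>k\<le>n. f n (Suc k)) - q ^ n * x * (\<Sum>k\<le>n. f n k))
      = (\<Sum>k\<le>Suc n. f n k) - q ^ n * x * (\<Sum>k\<le>n. f n k)"
    by (subst sum.atMost_Suc_shift) simp
  also have "(\<Sum>k\<le>Suc n. f n k) = (\<Sum>k\<le>n. f n k)"
    by (simp add: f_def qbinom_eq_0)
  finally show ?case using Suc by (simp add: qpoch_Suc f_def T_def algebra_simps)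
qed simp

text \<open>The triangular exponent of k + m exceeds the sum of those of k and m by k m, and this
  excess turns the argument x / q^m of the powers with exponent k back into x.\<close>

lemma theta_term_shift:
  assumes "q \<noteq> 0" "x \<noteq> 0"
  shows "theta_term (x / q powi m) q (k + m) = theta_term (x / q powi m) q m * theta_term x q k"
proof -
  have "(k + m) * (k + m - 1) = k * (k - 1) + m * (m - 1) + k * m * 2"
    by (simp add: algebra_simps)
  hence "(k + m) * (k + m - 1) div 2 = (k * (k - 1) + m * (m - 1)) div 2 + k * m"
    by simp
  also have "(k * (k - 1) + m * (m - 1)) div 2 = k * (k - 1) div 2 + m * (m - 1) div 2"
    by (rule div_plus_div_distrib_dvd_left) simp
  finally have e: "(k + m) * (k + m - 1) div 2 = k * (k - 1) div 2 + m * (m - 1) div 2 + k * m" .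
  have "q powi (k * m) * (x / q powi m) powi k = x powi k"
    using assms by (simp add: power_int_divide_distrib flip: power_int_mult) (simp add: mult.commute)
  hence "q powi (k * m) * (x / q powi m) powi (k + m) = x powi k * (x / q powi m) powi m"
    using assms by (simp add: power_int_add)
  thus ?thesis
    using assms by (simp add: theta_term_def e power_int_add)
qed

text \<open>Each factor is reversed by 1 - x/q^(n+1) = -(x/q^(n+1)) (1 - q^n (q/x)); the monomials
  collected on the way make up one theta term.\<close>

lemma qpoch_shift_down:
  assumes "q \<noteq> 0" "x \<noteq> 0"
  shows "qpoch (x / q ^ n) q n = theta_term (x / q ^ n) q (int n) * qpoch (q / x) q n"
proof (induction n)
  case (Suc n)
  have e: "n * Suc n div 2 = n * (n - 1) div 2 + n"
    by (cases n) (simp_all add: algebra_simps)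
  have "Suc n * Suc n = n * n + n + Suc n" by simp
  hence "q ^ (Suc n * Suc n) = q ^ (n * n) * q ^ n * q ^ Suc n"
    by (simp only: power_add)
  hence "theta_term (x / q ^ Suc n) q (int (Suc n)) = - (x / q ^ Suc n) * theta_term (x / q ^ n) q (int n)"
    unfolding theta_term_of_nat using assms
    by (simp add: e power_add power_divide field_simps flip: power_mult del: mult_Suc mult_Suc_right)
  moreover have "qpoch (x / q ^ Suc n) q (Suc n) = (1 - x / q ^ Suc n) * qpoch (x / q ^ n) q n"
    using assms by (simp add: qpoch_rec)
  moreover have "1 - x / q ^ Suc n = - (x / q ^ Suc n) * (1 - q ^ n * (q / x))"
    using assms by (simp add: field_simps)
  ultimately show ?case
    unfolding qpoch_Suc[of "q / x"] by (simp only: Suc mult_ac)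
qed simp

text \<open>The finite binomial theorem for 2n factors, applied at y = x/q^n: the last n factors are
  those of x, the first n reverse into those of q/x. Recentring the summation at k = n produces the
  same monomial c on the other side, and it cancels.\<close>

lemma finite_jacobi_triple:
  assumes "q \<noteq> 0" "x \<noteq> 0"
  shows "qpoch x q n * qpoch (q / x) q n =
    (\<Sum>k\<le>n. theta_term x q (int k) * qbinom q (2 * n) (n + k)) +
    (\<Sum>k<n. theta_term x q (- int (Suc k)) * qbinom q (2 * n) (n - Suc k))"
proof -
  define y where "y = x / q ^ n"
  define c where "c = theta_term y q (int n)"
  have c0: "c \<noteq> 0" using assms by (simp add: c_def y_def theta_term_def)
  have shift: "theta_term y q (k + int n) = c * theta_term x q k" for k
    using theta_term_shift[OF assms, of "int n" k] by (simp add: c_def y_def)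
  define g where "g = (\<lambda>k. theta_term y q (int k) * qbinom q (2 * n) k)"
  have "qpoch y q (n + n) = qpoch y q n * qpoch x q n"
  proof -
    have "qpoch y q (n + m) = qpoch y q n * qpoch x q m" for m
      using assms by (induction m) (auto simp: qpoch_Suc y_def power_add)
    thus ?thesis .
  qed
  also have "qpoch y q n = c * qpoch (q / x) q n"
    using qpoch_shift_down[OF assms] by (simp add: y_def c_def)
  finally have "c * (qpoch x q n * qpoch (q / x) q n) = qpoch y q (2 * n)"
    unfolding mult_2 by (simp add: mult_ac)
  also have "\<dots> = (\<Sum>k\<le>2*n. g k)"
    unfolding qpoch_binomial g_def theta_term_of_nat by (simp add: mult_ac)
  also have "{..2*n} = {..<n} \<union> {n..2*n}" by auto
  also have "sum g \<dots> = sum g {..<n} + sum g {n..2*n}"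
    by (rule sum.union_disjoint) auto
  also have "sum g {n..2*n} = (\<Sum>k\<le>n. g (n + k))"
    by (rule sum.reindex_bij_witness[of _ "\<lambda>k. n + k" "\<lambda>k. k - n"]) auto
  also have "sum g {..<n} = (\<Sum>k<n. g (n - Suc k))"
    by (rule sum.nat_diff_reindex[symmetric])
  also have "(\<Sum>k<n. g (n - Suc k)) = c * (\<Sum>k<n. theta_term x q (- int (Suc k)) * qbinom q (2 * n) (n - Suc k))"
    unfolding sum_distrib_left
  proof (rule sum.cong)
    fix k assume "k \<in> {..<n}"
    hence "int (n - Suc k) = - int (Suc k) + int n" by simp
    thus "g (n - Suc k) = c * (theta_term x q (- int (Suc k)) * qbinom q (2 * n) (n - Suc k))"
      unfolding g_def by (simp only: shift mult.assoc)
  qed simp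
  also have "(\<Sum>k\<le>n. g (n + k)) = c * (\<Sum>k\<le>n. theta_term x q (int k) * qbinom q (2 * n) (n + k))"
    unfolding sum_distrib_left
  proof (rule sum.cong)
    fix k
    have "int (n + k) = int k + int n" by simp
    thus "g (n + k) = c * (theta_term x q (int k) * qbinom q (2 * n) (n + k))"
      unfolding g_def by (simp only: shift mult.assoc)
  qed simp
  finally show ?thesis using c0 unfolding distrib_left[symmetric] by (simp only: mult_cancel_left add.commute) simp
qed

text \<open>The sequence and its reciprocals both converge, hence are bounded. This gives bounds for
  Gaussian binomials that are uniform in both indices.\<close>

lemma qpoch_self_bounds:
  assumes "norm q < 1"
  obtains a b where "0 < a" "0 < b" "\<And>n. a \<le> norm (qpoch q q n)" "\<And>n. norm (qpoch q q n) \<le> b"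
proof -
  have lim: "(\<lambda>n. qpoch q q n) \<longlonglongrightarrow> qpoch_inf q q" by (rule qpoch_LIMSEQ[OF assms])
  hence "Bseq (\<lambda>n. qpoch q q n)" by (metis Bseq_def convergentI convergent_imp_Bseq)
  then obtain b where b: "0 < b" "\<And>n. norm (qpoch q q n) \<le> b" by (auto simp: Bseq_def)
  have "(\<lambda>n. inverse (qpoch q q n)) \<longlonglongrightarrow> inverse (qpoch_inf q q)"
    using lim qpoch_self_nonzero[OF assms] by (intro tendsto_intros)
  hence "Bseq (\<lambda>n. inverse (qpoch q q n))" by (metis convergentI convergent_imp_Bseq)
  then obtain a where a: "0 < a" "\<And>n. norm (inverse (qpoch q q n)) \<le> a" by (auto simp: Bseq_def)
  have "inverse a \<le> norm (qpoch q q n)" for n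
    using a(2)[of n] a(1) qpoch_self_nonzero(1)[OF assms, of n] by (simp add: norm_divide field_simps)
  with a b that[of "inverse a" b] show ?thesis by auto
qed

text \<open>The limit of the finite identity, by Tannery's theorem.\<close>

theorem jacobi_triple_product:
  assumes "norm q < 1" "q \<noteq> 0" "x \<noteq> 0"
  shows "(theta_term x q has_sum jfun x q) UNIV"
proof -
  obtain a b where ab: "0 < a" "0 < b" "\<And>n. a \<le> norm (qpoch q q n)" "\<And>n. norm (qpoch q q n) \<le> b"
    using qpoch_self_bounds[OF assms(1)] by blast
  have nz: "qpoch q q n \<noteq> 0" "qpoch_inf q q \<noteq> 0" for n
    using qpoch_self_nonzero[OF assms(1)] by auto
  have binom: "qbinom q n k = qpoch q q n / (qpoch q q k * qpoch q q (n - k))" if "k \<le> n" for n k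
    using qbinom_qpoch[OF that, of q] nz by (simp add: field_simps)
  \<comment> \<open>Independent of n and k: with this constant the theta terms themselves dominate
    the sums.\<close>
  have bound: "norm (qbinom q n k) \<le> b / (a * a)" for n k
  proof (cases "k \<le> n")
    case True
    thus ?thesis unfolding binom[OF True] norm_divide norm_mult
      using ab by (intro frac_le mult_mono) auto
  qed (use ab in \<open>auto simp: qbinom_eq_0\<close>)
  have top: "filterlim (\<lambda>n. n - k) at_top sequentially" "filterlim (\<lambda>n. n + k) at_top sequentially" for k
    by real_asymp+
  have lim: "(\<lambda>n. qbinom q (2 * n) (n + k)) \<longlonglongrightarrow> 1 / qpoch_inf q q"
            "(\<lambda>n. qbinom q (2 * n) (n - k)) \<longlonglongrightarrow> 1 / qpoch_inf q q" for k
  proof -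
    have L: "(\<lambda>n. qpoch q q (f n)) \<longlonglongrightarrow> qpoch_inf q q" if "filterlim f at_top sequentially" for f
      by (rule filterlim_compose[OF qpoch_LIMSEQ[OF assms(1)] that])
    have "(\<lambda>n. qpoch q q (2 * n) / (qpoch q q (n + k) * qpoch q q (n - k))) \<longlonglongrightarrow>
        qpoch_inf q q / (qpoch_inf q q * qpoch_inf q q)"
      using nz by (intro tendsto_intros L top) (auto intro!: mult_nat_left_at_top)
    hence *: "(\<lambda>n. qpoch q q (2 * n) / (qpoch q q (n + k) * qpoch q q (n - k))) \<longlonglongrightarrow> 1 / qpoch_inf q q"
      using nz by simp
    have ev: "eventually (\<lambda>n. k \<le> n) sequentially" by (rule eventually_ge_at_top)
    show "(\<lambda>n. qbinom q (2 * n) (n + k)) \<longlonglongrightarrow> 1 / qpoch_inf q q"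
      by (rule Lim_transform_eventually[OF *]) (use ev in eventually_elim, auto simp: binom mult_2)
    show "(\<lambda>n. qbinom q (2 * n) (n - k)) \<longlonglongrightarrow> 1 / qpoch_inf q q"
      by (rule Lim_transform_eventually[OF *]) (use ev in eventually_elim, auto simp: binom mult_2 mult_ac)
  qed
  have tannery: "(\<lambda>n. \<Sum>k. if k \<in> A n then t k * qbinom q (2 * n) (f n k) else 0) \<longlonglongrightarrow> (\<Sum>k. t k * (1 / qpoch_inf q q))"
    if t: "summable (\<lambda>k. norm (t k))" and A: "\<And>k. eventually (\<lambda>n. k \<in> A n) sequentially"
      and f: "\<And>k. (\<lambda>n. qbinom q (2 * n) (f n k)) \<longlonglongrightarrow> 1 / qpoch_inf q q" for t A f
  proof -
    let ?a = "\<lambda>k n. if k \<in> A n then t k * qbinom q (2 * n) (f n k) else 0"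
    have 1: "(\<lambda>n. ?a k n) \<longlonglongrightarrow> t k * (1 / qpoch_inf q q)" for k
      by (rule Lim_transform_eventually[OF tendsto_mult[OF tendsto_const f]])
        (use A[of k] in eventually_elim, auto)
    have 2: "eventually (\<lambda>(k,n). norm (?a k n) \<le> norm (t k) * (b / (a * a))) (at_top \<times>\<^sub>F sequentially)"
      using ab mult_left_mono[OF bound norm_ge_zero] by (intro always_eventually) (auto simp: norm_mult)
    have 3: "summable (\<lambda>k. norm (t k) * (b / (a * a)))"
      using t by (rule summable_mult2)
    show ?thesis using tannerys_theorem[OF 1 2 3] by simp
  qed
  have s1: "summable (\<lambda>k. norm (theta_term x q (int k)))"
    by (rule summable_norm_theta_term[OF assms(1)])
  have s2: "summable (\<lambda>k. norm (theta_term x q (- int (Suc k))))"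
    using summable_norm_theta_term[OF assms(1), of "q / x"] assms
    by (subst (asm) summable_Suc_iff[symmetric]) (simp add: theta_term_uminus del: of_nat_Suc)
  let ?T1 = "\<Sum>k. theta_term x q (int k)" and ?T2 = "\<Sum>k. theta_term x q (- int (Suc k))"
  have fin: "(\<Sum>k. if k \<in> A then g k else 0) = (\<Sum>k\<in>A. g k)" if "finite A" for A and g :: "nat \<Rightarrow> complex"
    using suminf_finite[OF that, of "\<lambda>k. if k \<in> A then g k else 0"] by simp
  have "(\<lambda>n. (\<Sum>k. if k \<in> {..n} then theta_term x q (int k) * qbinom q (2 * n) (n + k) else 0) +
            (\<Sum>k. if k \<in> {..<n} then theta_term x q (- int (Suc k)) * qbinom q (2 * n) (n - Suc k) else 0))
        \<longlonglongrightarrow> (\<Sum>k. theta_term x q (int k) * (1 / qpoch_inf q q)) +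
            (\<Sum>k. theta_term x q (- int (Suc k)) * (1 / qpoch_inf q q))"
    by (intro tendsto_add tannery s1 s2 lim)
       (auto intro: eventually_ge_at_top eventually_gt_at_top)
  moreover have "(\<Sum>k. theta_term x q (int k) * (1 / qpoch_inf q q)) = ?T1 * (1 / qpoch_inf q q)"
    by (rule suminf_mult2[symmetric, OF summable_norm_cancel[OF s1]])
  moreover have "(\<Sum>k. theta_term x q (- int (Suc k)) * (1 / qpoch_inf q q)) = ?T2 * (1 / qpoch_inf q q)"
    by (rule suminf_mult2[symmetric, OF summable_norm_cancel[OF s2]])
  ultimately have "(\<lambda>n. qpoch x q n * qpoch (q / x) q n) \<longlonglongrightarrow> ?T1 * (1 / qpoch_inf q q) + ?T2 * (1 / qpoch_inf q q)"
    by (simp only: fin[OF finite_atMost] fin[OF finite_lessThan] finite_jacobi_triple[OF assms(2,3)])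
  moreover have "(\<lambda>n. qpoch x q n * qpoch (q / x) q n) \<longlonglongrightarrow> qpoch_inf x q * qpoch_inf (q / x) q"
    by (intro tendsto_mult qpoch_LIMSEQ assms)
  ultimately have "qpoch_inf x q * qpoch_inf (q / x) q = ?T1 * (1 / qpoch_inf q q) + ?T2 * (1 / qpoch_inf q q)"
    using LIMSEQ_unique by blast
  hence "jfun x q = ?T1 + ?T2"
    using nz by (simp add: jfun_def field_simps)
  moreover have "((\<lambda>k. theta_term x q (int k)) has_sum ?T1) UNIV"
    by (rule norm_summable_imp_has_sum[OF s1 summable_sums[OF summable_norm_cancel[OF s1]]])
  moreover have "((\<lambda>k. theta_term x q (- int (Suc k))) has_sum ?T2) UNIV"
    by (rule norm_summable_imp_has_sum[OF s2 summable_sums[OF summable_norm_cancel[OF s2]]])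
  ultimately show ?thesis using has_sum_int[of "theta_term x q"] by simp
qed

section \<open>Quasi-periodic functions of negative degree vanish\<close>

text \<open>The common domain for everything with poles or zeros at the integral powers of t: theta
  reciprocals, Lerch sums and the rank function.\<close>

definition off_powers :: "complex \<Rightarrow> complex set" where
  "off_powers t = {z. z \<noteq> 0 \<and> (\<forall>n. z \<noteq> t powi n)}"

lemma off_powers_conv_jfun:
  "norm t < 1 \<Longrightarrow> t \<noteq> 0 \<Longrightarrow> off_powers t = {z \<in> - {0}. jfun z t \<in> - {0}}"
  by (auto simp: off_powers_def jfun_eq_0_iff)

lemma open_off_powers:
  assumes "norm t < 1" "t \<noteq> 0"
  shows "open (off_powers t)"
proof -
  have "(\<lambda>z. jfun z t) holomorphic_on - {0}"
    using assms by (intro holomorphic_intros) auto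
  hence "open (- {0} \<inter> (\<lambda>z. jfun z t) -` (- {0}))"
    by (intro continuous_open_preimage holomorphic_on_imp_continuous_on) auto
  also have "- {0} \<inter> (\<lambda>z. jfun z t) -` (- {0}) = off_powers t"
    unfolding off_powers_conv_jfun[OF assms] by auto
  finally show ?thesis .
qed

text \<open>The powers of t are isolated in the punctured plane: the annulus with radii
  \<open>norm t powi (k + 1)\<close> and \<open>norm t powi (k - 1)\<close> contains only
  \<open>t powi k\<close> among them.\<close>

lemma eventually_off_powers:
  assumes t: "norm t < 1" "t \<noteq> 0" and a: "a \<noteq> 0"
  shows "eventually (\<lambda>z. z \<in> off_powers t) (at a)"
proof (cases "a \<in> off_powers t")
  case True
  thus ?thesis using open_off_powers[OF t] eventually_at_in_open' by blast
next
  case False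
  then obtain k where k: "a = t powi k" using a by (auto simp: off_powers_def)
  have mono: "norm t powi n \<le> norm t powi l" if "l \<le> n" for l n
    using that t power_int_decreasing[of l n "norm t"] by simp
  let ?S = "{z. norm t powi (k + 1) < norm z} \<inter> {z. norm z < norm t powi (k - 1)}"
  have "open ?S" by (intro open_Int open_Collect_less continuous_intros)
  moreover have "a \<in> ?S"
    using t by (simp add: k norm_power_int power_int_add power_int_diff field_simps)
  ultimately have "eventually (\<lambda>z. z \<in> ?S - {a}) (at a)"
    by (rule eventually_at_in_open)
  thus ?thesis
  proof eventually_elim
    case (elim z)
    have "0 < norm t powi (k + 1)" using t by simp
    hence "z \<noteq> 0" using elim by auto
    moreover have "z \<noteq> t powi n" for n
    proof
      assume "z = t powi n"
      hence "norm t powi (k + 1) < norm t powi n" "norm t powi n < norm t powi (k - 1)" "n \<noteq> k"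
        using elim by (auto simp: k norm_power_int)
      thus False using mono[of n "k - 1"] mono[of "k + 1" n] by (cases "n < k") auto
    qed
    ultimately show ?case by (simp add: off_powers_def)
  qed
qed

lemma off_powers_mult_iff:
  assumes "t \<noteq> 0"
  shows "t powi m * z \<in> off_powers t \<longleftrightarrow> z \<in> off_powers t"
proof -
  have *: "t powi m * z = t powi n \<longleftrightarrow> z = t powi (n - m)" for n
    using assms by (auto simp: power_int_diff field_simps)
  have "(\<forall>n. z \<noteq> t powi (n - m)) \<longleftrightarrow> (\<forall>n. z \<noteq> t powi n)"
    by (metis add_diff_cancel_right')
  thus ?thesis using assms by (auto simp: off_powers_def *)
qed

text \<open>Near 0 the multiplier C z^d is at most 1 in norm, so the value at z is bounded by the
  one at z/p; near infinity it is at least 1, so the value at z is bounded by the one at p z. Moving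
  into compact annuli bounds g globally. Then 0 is removable, Liouville makes g constant, and the
  functional equation excludes a nonzero constant.\<close>

lemma quasiperiodic_eq_0:
  fixes g :: "complex \<Rightarrow> complex"
  assumes p: "norm p < 1" "p \<noteq> 0" and holo: "g holomorphic_on - {0}"
    and per: "\<And>z. z \<noteq> 0 \<Longrightarrow> g (p * z) = C * z ^ d * g z" and C: "C \<noteq> 0" "0 < d" and z: "z \<noteq> 0"
  shows "g z = 0"
proof -
  define r where "r = norm p"
  have r: "0 < r" "r < 1" using p by (auto simp: r_def)
  define c where "c = norm C"
  have c: "0 < c" using C by (simp add: c_def)
  have nper: "norm (g (p * z)) = c * norm z ^ d * norm (g z)" if "z \<noteq> 0" for z
    using per[OF that] by (simp add: norm_mult norm_power c_def)
  have annulus: "\<exists>M. \<forall>z. a \<le> norm z \<and> norm z \<le> b \<longrightarrow> norm (g z) \<le> M" if "0 < a" for a b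
  proof -
    have "compact ({z. a \<le> norm z} \<inter> cball (0::complex) b)"
      by (intro closed_Int_compact closed_Collect_le continuous_intros) auto
    moreover have "continuous_on ({z. a \<le> norm z} \<inter> cball 0 b) g"
      by (rule holomorphic_on_imp_continuous_on[OF holomorphic_on_subset[OF holo]]) (use that in auto)
    ultimately have "bounded (g ` ({z. a \<le> norm z} \<inter> cball 0 b))"
      by (intro compact_imp_bounded compact_continuous_image)
    thus ?thesis by (fastforce simp: bounded_iff)
  qed
  \<comment> \<open>For x \<le> 1 the power x^d is at most x, so below this radius the multiplier
    has norm at most 1; R below is the mirror image for large x.\<close>
  define \<rho> where "\<rho> = min 1 (1 / c)"
  have \<rho>: "0 < \<rho>" using c by (simp add: \<rho>_def)
  have small: "c * x ^ d \<le> 1" if "0 \<le> x" "x \<le> \<rho>" for x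
  proof -
    have "x ^ d \<le> x ^ 1" using that C by (intro power_decreasing) (auto simp: \<rho>_def)
    hence "c * x ^ d \<le> c * (1 / c)" using that c by (intro mult_left_mono) (auto simp: \<rho>_def)
    thus ?thesis using c by simp
  qed
  define R where "R = max 1 (1 / c)"
  have R: "1 \<le> R" by (simp add: R_def)
  have large: "1 \<le> c * x ^ d" if "R \<le> x" for x
  proof -
    have "x ^ 1 \<le> x ^ d" using that R C by (intro power_increasing) auto
    hence "c * (1 / c) \<le> c * x ^ d" using that c by (intro mult_left_mono) (auto simp: R_def)
    thus ?thesis using c by simp
  qed
  obtain M1 where M1: "norm (g z) \<le> M1" if "\<rho> * r \<le> norm z" "norm z \<le> \<rho>" for z
    using annulus[of "\<rho> * r" \<rho>] \<rho> r by auto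
  obtain M2 where M2: "norm (g z) \<le> M2" if "R \<le> norm z" "norm z \<le> R / r" for z
    using annulus[of R "R / r"] R by auto
  obtain M3 where M3: "norm (g z) \<le> M3" if "\<rho> \<le> norm z" "norm z \<le> R" for z
    using annulus[of \<rho> R] \<rho> by auto
  have near0: "norm (g z) \<le> M1" if "\<rho> * r ^ n \<le> norm z" "norm z \<le> \<rho>" for n z
    using that
  proof (induction n arbitrary: z)
    case 0
    thus ?case using M1[of z] \<rho> r mult_left_le[of r \<rho>] by simp
  next
    case (Suc n)
    show ?case
    proof (cases "\<rho> * r \<le> norm z")
      case False
      have "0 < \<rho> * r ^ Suc n" using \<rho> r by simp
      hence z0: "z \<noteq> 0" using Suc by auto
      have nz: "norm (z / p) = norm z / r" by (simp add: norm_divide r_def)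
      have "norm (z / p) \<le> \<rho>" "\<rho> * r ^ n \<le> norm (z / p)"
        using False Suc.prems r unfolding nz by (auto simp: field_simps)
      moreover from this have "norm (g z) \<le> norm (g (z / p))"
        using nper[of "z / p"] z0 p mult_right_mono[OF small[of "norm (z / p)"], of "norm (g (z / p))"] by simp
      ultimately show ?thesis using Suc.IH[of "z / p"] by linarith
    qed (use M1 Suc in auto)
  qed
  have nearinf: "norm (g z) \<le> M2" if "norm z * r ^ n \<le> R" "R \<le> norm z" for n z
    using that
  proof (induction n arbitrary: z)
    case 0
    have "R \<le> R / r" using R r by (simp add: field_simps)
    thus ?case using M2[of z] 0 by simp
  next
    case (Suc n)
    show ?case
    proof (cases "norm z \<le> R / r")
      case False
      have z0: "z \<noteq> 0" using Suc R by auto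
      have nz: "norm (p * z) = norm z * r" by (simp add: norm_mult r_def)
      have "R \<le> norm (p * z)" "norm (p * z) * r ^ n \<le> R"
        using False Suc.prems r unfolding nz by (auto simp: field_simps)
      moreover have "norm (g z) \<le> norm (g (p * z))"
        using nper[of z] z0 Suc.prems mult_right_mono[OF large[of "norm z"], of "norm (g z)"] by simp
      ultimately show ?thesis using Suc.IH[of "p * z"] by linarith
    qed (use M2 Suc in auto)
  qed
  have bdd: "norm (g z) \<le> max M1 (max M2 M3)" if "z \<noteq> 0" for z
  proof -
    consider "norm z \<le> \<rho>" | "R \<le> norm z" | "\<rho> \<le> norm z" "norm z \<le> R" by linarith
    thus ?thesis
    proof cases
      case 1
      have "(\<lambda>n. \<rho> * r ^ n) \<longlonglongrightarrow> \<rho> * 0"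
        using r by (intro tendsto_intros LIMSEQ_power_zero) simp
      hence "eventually (\<lambda>n. \<rho> * r ^ n < norm z) sequentially"
        using that by (intro order_tendstoD) auto
      then obtain n where "\<rho> * r ^ n < norm z" by (auto simp: eventually_sequentially)
      thus ?thesis using near0[of n z] 1 by linarith
    next
      case 2
      have "(\<lambda>n. norm z * r ^ n) \<longlonglongrightarrow> norm z * 0"
        using r by (intro tendsto_intros LIMSEQ_power_zero) simp
      hence "eventually (\<lambda>n. norm z * r ^ n < R) sequentially"
        using R by (intro order_tendstoD) auto
      then obtain n where "norm z * r ^ n < R" by (auto simp: eventually_sequentially)
      thus ?thesis using nearinf[of z n] 2 by linarith
    next
      case 3
      thus ?thesis using M3[of z] by linarith
    qed
  qed
  have "\<exists>G. G holomorphic_on UNIV \<and> (\<forall>z\<in>UNIV - {0}. G z = g z)"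
    using bdd holo
    by (subst holomorphic_on_extend_bounded)
       (auto simp: Compl_eq_Diff_UNIV eventually_at_filter intro!: exI[of _ "max M1 (max M2 M3)"] always_eventually)
  then obtain G where G: "G holomorphic_on UNIV" "\<And>z. z \<noteq> 0 \<Longrightarrow> G z = g z" by auto
  have "norm (G z) \<le> max (norm (G 0)) (max M1 (max M2 M3))" for z
    using bdd[of z] G(2)[of z] by (cases "z = 0") auto
  hence "bounded (range G)" by (auto simp: bounded_iff)
  with G(1) have "G constant_on UNIV" by (rule Liouville_theorem)
  then obtain k where k: "\<And>z. z \<noteq> 0 \<Longrightarrow> g z = k" using G(2) by (metis UNIV_I constant_on_def)
  \<comment> \<open>The functional equation at 1 and at 2. A nonzero constant would force C = 1 and
    2^d = 1.\<close>
  have "k = C * k" "k = C * 2 ^ d * k"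
    using per[of 1] per[of 2] p by (simp_all add: k)
  hence "k * (2 ^ d - 1) = 0" by (metis (no_types, lifting) cancel_comm_monoid_add_class.diff_cancel mult.assoc mult.commute right_diff_distrib mult_1)
  moreover have "(2 ^ d :: complex) \<noteq> 1"
    using C(2) by (metis norm_numeral norm_one norm_power one_less_numeral_iff one_less_power less_irrefl semiring_norm(76))
  ultimately show ?thesis using k z by simp
qed

text \<open>The condition that (w - a) f(w) tends to 0 is Riemann's criterion for a removable
  singularity. Multiplication by t^m permutes the possible singularities and respects the criterion,
  so it has to be checked only for m consecutive exponents.\<close>

lemma quasiperiodic_remove_sings_eq_0:
  fixes f :: "complex \<Rightarrow> complex"
  assumes t: "norm t < 1" "t \<noteq> 0" "0 < m" and holo: "f holomorphic_on off_powers t"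
    and per: "\<And>z. z \<in> off_powers t \<Longrightarrow> f (t ^ m * z) = C * z ^ d * f z" and C: "C \<noteq> 0" "0 < d"
    and sing: "\<And>k. l \<le> k \<Longrightarrow> k < l + int m \<Longrightarrow> ((\<lambda>w. (w - t powi k) * f w) \<longlongrightarrow> 0) (at (t powi k))"
    and z: "z \<in> off_powers t"
  shows "f z = 0"
proof -
  define p where "p = t ^ m"
  have p: "norm p < 1" "p \<noteq> 0"
    using t by (auto simp: p_def norm_power power_less_one_iff)
  have p_powi: "p = t powi int m" by (simp add: p_def)
  have off_p: "p * z \<in> off_powers t \<longleftrightarrow> z \<in> off_powers t" for z
    unfolding p_powi by (rule off_powers_mult_iff) fact
  have filt: "filtermap (\<lambda>v. p * v) (at a) = at (p * a)" for a
  proof -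
    have bij: "bij ((*) p)"
      using p by (intro bij_betw_byWitness[where f' = "\<lambda>z. z / p"]) auto
    have "filtermap ((*) p) (at a) = at (p * a) within range ((*) p)"
      using p by (intro filtermap_linear_at_within[OF bij]) (auto intro: open_times_image)
    thus ?thesis using bij by (simp add: bij_def)
  qed
  \<comment> \<open>The functional equation multiplies the product by p C v^d, which has a nonzero
    limit at a; the criterion therefore passes in both directions.\<close>
  have up: "((\<lambda>w. (w - p * a) * f w) \<longlongrightarrow> 0) (at (p * a)) \<longleftrightarrow> ((\<lambda>w. (w - a) * f w) \<longlongrightarrow> 0) (at a)"
    if a: "a \<noteq> 0" for a
  proof -
    have "((\<lambda>w. (w - p * a) * f w) \<longlongrightarrow> 0) (at (p * a)) \<longleftrightarrow>
        ((\<lambda>v. (p * v - p * a) * f (p * v)) \<longlongrightarrow> 0) (at a)"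
      unfolding filt[symmetric] by (simp add: filterlim_filtermap)
    also have "\<dots> \<longleftrightarrow> ((\<lambda>v. (p * C * v ^ d) * ((v - a) * f v)) \<longlongrightarrow> 0) (at a)"
    proof (rule tendsto_cong)
      show "eventually (\<lambda>v. (p * v - p * a) * f (p * v) = (p * C * v ^ d) * ((v - a) * f v)) (at a)"
        using eventually_off_powers[OF t(1,2) a]
      proof eventually_elim
        case (elim v)
        show ?case unfolding per[folded p_def, OF elim] by (simp add: algebra_simps)
      qed
    qed
    also have "\<dots> \<longleftrightarrow> ((\<lambda>v. (v - a) * f v) \<longlongrightarrow> 0) (at a)"
    proof
      assume "((\<lambda>v. (p * C * v ^ d) * ((v - a) * f v)) \<longlongrightarrow> 0) (at a)"
      hence "((\<lambda>v. inverse (p * C * v ^ d) * ((p * C * v ^ d) * ((v - a) * f v))) \<longlongrightarrow> inverse (p * C * a ^ d) * 0) (at a)"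
        using p C a by (intro tendsto_intros) auto
      moreover have "eventually (\<lambda>v. inverse (p * C * v ^ d) * ((p * C * v ^ d) * ((v - a) * f v)) = (v - a) * f v) (at a)"
        using eventually_off_powers[OF t(1,2) a]
        by eventually_elim (use p C in \<open>simp add: off_powers_def field_simps\<close>)
      ultimately show "((\<lambda>v. (v - a) * f v) \<longlongrightarrow> 0) (at a)"
        using Lim_transform_eventually by fastforce
    next
      assume "((\<lambda>v. (v - a) * f v) \<longlongrightarrow> 0) (at a)"
      hence "((\<lambda>v. (p * C * v ^ d) * ((v - a) * f v)) \<longlongrightarrow> (p * C * a ^ d) * 0) (at a)"
        by (intro tendsto_intros)
      thus "((\<lambda>v. (p * C * v ^ d) * ((v - a) * f v)) \<longlongrightarrow> 0) (at a)" by simp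
    qed
    finally show ?thesis .
  qed
  define P where "P = (\<lambda>k. ((\<lambda>w. (w - t powi k) * f w) \<longlongrightarrow> 0) (at (t powi k)))"
  have step: "P (k + int m) \<longleftrightarrow> P k" for k
    using up[of "t powi k"] t by (simp add: P_def p_powi power_int_add mult.commute)
  have steps: "P (k + int m * int n) \<longleftrightarrow> P k" for k n
  proof (induction n)
    case (Suc n)
    have "k + int m * int (Suc n) = (k + int m * int n) + int m" by (simp add: algebra_simps)
    thus ?case using Suc step by metis
  qed simp
  have P: "P k" for k
  proof -
    \<comment> \<open>The representative of k modulo m within the window of exponents where the
      criterion is assumed.\<close>
    define k' where "k' = l + (k - l) mod int m"
    have "P k'" using sing[of k'] t(3) by (simp add: P_def k'_def)
    have k: "k = k' + int m * ((k - l) div int m)" by (simp add: k'_def)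
    show ?thesis
    proof (cases "(k - l) div int m \<ge> 0")
      case True
      thus ?thesis using steps[of k' "nat ((k - l) div int m)"] \<open>P k'\<close> k by simp
    next
      case False
      hence "k' = k + int m * int (nat (- ((k - l) div int m)))" using k by (simp add: algebra_simps)
      thus ?thesis using steps[of k] \<open>P k'\<close> by metis
    qed
  qed
  define g where "g = remove_sings f"
  have iso: "isolated_singularity_at f a" if "a \<noteq> 0" for a
  proof -
    have "\<exists>r>0. \<forall>x. x \<noteq> a \<and> dist x a < r \<longrightarrow> x \<in> off_powers t"
      using eventually_off_powers[OF t(1,2) that] by (auto simp: eventually_at)
    then obtain r where r: "r > 0" "\<And>x. x \<noteq> a \<Longrightarrow> dist x a < r \<Longrightarrow> x \<in> off_powers t" by blast
    have "f holomorphic_on ball a r - {a}"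
      by (rule holomorphic_on_subset[OF holo]) (auto simp: dist_commute[of a] intro!: r(2))
    hence "f analytic_on ball a r - {a}" by (subst analytic_on_open) auto
    thus ?thesis using r(1) by (auto simp: isolated_singularity_at_def)
  qed
  have off_ana: "f analytic_on {a}" if "a \<in> off_powers t" for a
    using holo open_off_powers[OF t(1,2)] that analytic_at by blast
  have tends: "\<exists>c. f \<midarrow>a\<rightarrow> c" if "a \<noteq> 0" for a
  proof (cases "a \<in> off_powers t")
    case True
    thus ?thesis using off_ana[OF True] analytic_at_imp_isCont isCont_def by blast
  next
    case False
    with that have "\<exists>k. a = t powi k" by (auto simp: off_powers_def)
    then obtain k where k: "a = t powi k" ..
    have "isolated_singularity_at f a" using iso[OF that] .
    then obtain r where r: "r > 0" "f analytic_on ball a r - {a}"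
      by (auto simp: isolated_singularity_at_def)
    have "\<exists>h. h holomorphic_on ball a r \<and> (\<forall>z\<in>ball a r - {a}. h z = f z)"
      using P[of k] r by (subst holomorphic_on_extend_lim) (auto simp: P_def k analytic_imp_holomorphic)
    then obtain h where h: "h holomorphic_on ball a r" "\<forall>z\<in>ball a r - {a}. h z = f z" by blast
    have "h \<midarrow>a\<rightarrow> h a"
      using h(1) r(1) by (metis centre_in_ball continuous_on_eq_continuous_at holomorphic_on_imp_continuous_on isCont_def open_ball)
    moreover have "eventually (\<lambda>z. h z = f z) (at a)"
      using h(2) r(1) eventually_at_in_open[of "ball a r" a] by (auto elim!: eventually_mono)
    ultimately show ?thesis by (blast intro: Lim_transform_eventually)
  qed
  have g_ana: "g analytic_on {a}" if "a \<noteq> 0" for a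
    using tends[OF that] iso[OF that] remove_sings_analytic_at unfolding g_def by blast
  have "g holomorphic_on - {0}"
    using g_ana analytic_on_analytic_at[of g "- {0}"] analytic_imp_holomorphic by auto
  moreover have g_eq: "g a = f a" if "a \<in> off_powers t" for a
    unfolding g_def using off_ana[OF that] by (rule remove_sings_at_analytic)
  have "g (p * a) = C * a ^ d * g a" if a: "a \<noteq> 0" for a
  proof -
    have ga: "g \<midarrow>b\<rightarrow> g b" if "b \<noteq> 0" for b
      using g_ana[OF that] analytic_at_imp_isCont isCont_def by blast
    have "((\<lambda>v. g (p * v)) \<longlongrightarrow> g (p * a)) (at a)"
      using ga[of "p * a"] p a unfolding filt[symmetric] by (simp add: filterlim_filtermap)
    moreover have "((\<lambda>v. C * v ^ d * g v) \<longlongrightarrow> C * a ^ d * g a) (at a)"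
      using ga[OF a] by (intro tendsto_intros)
    moreover have "eventually (\<lambda>v. g (p * v) = C * v ^ d * g v) (at a)"
      using eventually_off_powers[OF t(1,2) a]
      by eventually_elim (simp add: g_eq off_p per[folded p_def])
    ultimately show ?thesis
      using tendsto_cong[of "\<lambda>v. g (p * v)" "\<lambda>v. C * v ^ d * g v" "at a"] tendsto_unique[of "at a"]
      by (metis (no_types, lifting) trivial_limit_at)
  qed
  ultimately have "g z = 0"
    using quasiperiodic_eq_0[of p g C d z] p C z by (auto simp: off_powers_def)
  thus ?thesis using g_eq[OF z] by simp
qed

section \<open>Lerch sums\<close>

lemma powi_bounds:
  fixes t :: complex
  assumes "norm t < 1" "t \<noteq> 0"
  shows "int N \<le> n \<Longrightarrow> norm (t powi n) \<le> norm t ^ N"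
    and "n \<le> - int N \<Longrightarrow> inverse (norm t ^ N) \<le> norm (t powi n)"
proof -
  assume "int N \<le> n"
  thus "norm (t powi n) \<le> norm t ^ N"
    using power_int_decreasing[of "int N" n "norm t"] assms by (simp add: norm_power_int)
next
  assume "n \<le> - int N"
  thus "inverse (norm t ^ N) \<le> norm (t powi n)"
    using power_int_decreasing[of n "- int N" "norm t"] assms by (simp add: norm_power_int power_int_minus)
qed

text \<open>For large n the product u t^n is small, for very negative n it is large, and the
  finitely many n between are handled by continuity. The index set A makes room for dropping one
  index, so that u0 may be a pole of the dropped term.\<close>

lemma partial_fractions_bound:
  fixes t u0 :: complex
  assumes t: "norm t < 1" "t \<noteq> 0" and u0: "u0 \<noteq> 0" "\<And>n. n \<in> A \<Longrightarrow> u0 * t powi n \<noteq> 1"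
  obtains r B where "0 < r" "0 < B" "r < norm u0"
    "\<And>u n. u \<in> cball u0 r \<Longrightarrow> n \<in> A \<Longrightarrow> 1 / B \<le> norm (1 - u * t powi n)"
proof -
  have "(\<lambda>n. norm t ^ n) \<longlonglongrightarrow> 0" using t by (intro LIMSEQ_power_zero) simp
  \<comment> \<open>For u with norm between half and twice that of u0, these two bounds give norm at
    most 1/2 for u t^n when n \<ge> N, and at least 2 when n \<le> -N.\<close>
  hence "eventually (\<lambda>n. norm t ^ n < min (1 / (4 * norm u0)) (norm u0 / 4)) sequentially"
    using u0 by (intro order_tendstoD) auto
  then obtain N where N: "norm t ^ N < 1 / (4 * norm u0)" "norm t ^ N < norm u0 / 4"
    by (auto simp: eventually_sequentially)
  define F where "F = {- int N..int N} \<inter> A"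
  define D where "D = (\<Sum>n\<in>F. 2 / norm (1 - u0 * t powi n))"
  have "eventually (\<lambda>u. \<forall>n\<in>F. norm (1 - u0 * t powi n) / 2 < norm (1 - u * t powi n)) (nhds u0)"
  proof (intro eventually_ball_finite ballI)
    fix n assume "n \<in> F"
    hence "norm (1 - u0 * t powi n) > 0" using u0 by (auto simp: F_def)
    moreover have "((\<lambda>u. norm (1 - u * t powi n)) \<longlongrightarrow> norm (1 - u0 * t powi n)) (nhds u0)"
      by (intro tendsto_intros filterlim_ident)
    ultimately show "eventually (\<lambda>u. norm (1 - u0 * t powi n) / 2 < norm (1 - u * t powi n)) (nhds u0)"
      by (intro order_tendstoD) auto
  qed (simp add: F_def)
  then obtain e where e: "e > 0"
    "\<And>u n. dist u u0 < e \<Longrightarrow> n \<in> F \<Longrightarrow> norm (1 - u0 * t powi n) / 2 < norm (1 - u * t powi n)"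
    by (auto simp: eventually_nhds_metric)
  define r where "r = min (e / 2) (norm u0 / 2)"
  have r: "0 < r" "r < e" "r \<le> norm u0 / 2" using e u0 by (auto simp: r_def)
  define B where "B = 2 + D"
  have D: "0 \<le> D" by (auto simp: D_def intro!: sum_nonneg)
  have bound: "1 / B \<le> norm (1 - u * t powi n)" if u: "u \<in> cball u0 r" and n: "n \<in> A" for u n
  proof (cases "n \<in> F")
    case True
    have "2 / norm (1 - u0 * t powi n) \<le> D"
      unfolding D_def by (rule member_le_sum[OF True]) (auto simp: F_def)
    hence "2 / norm (1 - u0 * t powi n) \<le> B" using D by (simp add: B_def)
    moreover have p: "norm (1 - u0 * t powi n) > 0" using u0 n by auto
    ultimately have "1 / B \<le> norm (1 - u0 * t powi n) / 2"
      using D by (simp add: B_def field_simps)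
    thus ?thesis using e(2)[of u n] True u r by (simp add: dist_commute)
  next
    case False
    have nu: "norm u0 / 2 \<le> norm u" "norm u \<le> 2 * norm u0"
      using u r norm_triangle_ineq3[of u0 u] u0 by (auto simp: dist_norm abs_le_iff)
    have "1 / 2 \<le> norm (1 - u * t powi n)"
    proof -
      consider "int N \<le> n" | "n \<le> - int N" using False n by (auto simp: F_def)
      thus ?thesis
      proof cases
        case 1
        have "norm (u * t powi n) \<le> (2 * norm u0) * (1 / (4 * norm u0))"
          unfolding norm_mult using powi_bounds(1)[OF t 1] N nu by (intro mult_mono) auto
        also have "\<dots> = 1 / 2" using u0 by simp
        finally show ?thesis using norm_triangle_ineq2[of 1 "u * t powi n"] by simp
      next
        case 2
        have tN: "0 < norm t ^ N" using t by simp
        have "2 = norm u0 / 2 * (4 / norm u0)" using u0 by simp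
        also have "\<dots> \<le> norm u0 / 2 * inverse (norm t ^ N)"
          using N(2) tN u0 by (intro mult_left_mono) (auto simp: field_simps)
        also have "\<dots> \<le> norm (u * t powi n)"
          unfolding norm_mult using powi_bounds(2)[OF t 2] tN nu by (intro mult_mono) auto
        finally show ?thesis using norm_triangle_ineq3[of 1 "u * t powi n"] by simp
      qed
    qed
    moreover have "1 / B \<le> 1 / 2" using D by (simp add: B_def field_simps)
    ultimately show ?thesis by linarith
  qed
  show thesis
    by (rule that[OF r(1), of B]) (use D r u0 bound in \<open>auto simp: B_def\<close>)
qed

lemma partial_fractions_summable:
  fixes c :: "int \<Rightarrow> complex"
  assumes t: "norm t < 1" "t \<noteq> 0" and c: "(\<lambda>n. norm (c n)) summable_on A"
    and u: "u \<noteq> 0" "\<And>n. n \<in> A \<Longrightarrow> u * t powi n \<noteq> 1"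
  shows "(\<lambda>n. c n / (1 - u * t powi n)) summable_on A"
proof -
  obtain r B where B: "0 < r" "0 < B" "\<And>v n. v \<in> cball u r \<Longrightarrow> n \<in> A \<Longrightarrow> 1 / B \<le> norm (1 - v * t powi n)"
    using partial_fractions_bound[of t u A] t u by metis
  have "(\<lambda>n. norm (c n) * B) summable_on A" by (intro summable_on_cmult_left c)
  hence "(\<lambda>n. norm (c n / (1 - u * t powi n))) summable_on A"
  proof (rule summable_on_comparison_test)
    fix n assume n: "n \<in> A"
    have "1 \<le> norm (1 - u * t powi n) * B" "0 < norm (1 - u * t powi n)"
      using B(3)[of u n] B(1,2) n u by (auto simp: field_simps)
    thus "norm (c n / (1 - u * t powi n)) \<le> norm (c n) * B"
      using mult_left_mono[of 1 "norm (1 - u * t powi n) * B" "norm (c n)"] by (simp add: norm_divide field_simps)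
  qed simp
  thus ?thesis by (rule abs_summable_summable)
qed

lemma partial_fractions_holomorphic:
  fixes c :: "int \<Rightarrow> complex"
  assumes t: "norm t < 1" "t \<noteq> 0" and c: "(\<lambda>n. norm (c n)) summable_on A"
  shows "(\<lambda>u. \<Sum>\<^sub>\<infinity>n\<in>A. c n / (1 - u * t powi n)) holomorphic_on {u. u \<noteq> 0 \<and> (\<forall>n\<in>A. u * t powi n \<noteq> 1)}"
  unfolding holomorphic_on_def
proof safe
  fix u0 :: complex assume u0: "u0 \<noteq> 0" "\<forall>n\<in>A. u0 * t powi n \<noteq> 1"
  obtain r B where B: "0 < r" "0 < B" "r < norm u0"
    "\<And>v n. v \<in> cball u0 r \<Longrightarrow> n \<in> A \<Longrightarrow> 1 / B \<le> norm (1 - v * t powi n)"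
    using partial_fractions_bound[of t u0 A] t u0 by metis
  let ?g = "\<lambda>u. \<Sum>\<^sub>\<infinity>n\<in>A. c n / (1 - u * t powi n)"
  have nz: "1 - v * t powi n \<noteq> 0" if "v \<in> cball u0 r" "n \<in> A" for v n
    using B(4)[OF that] B(2) by auto
  have "uniform_limit (cball u0 r) (\<lambda>X u. \<Sum>n\<in>X. c n / (1 - u * t powi n)) ?g (finite_subsets_at_top A)"
  proof (rule Weierstrass_m_test_general)
    fix n u assume n: "n \<in> A" and u: "u \<in> cball u0 r"
    have "1 \<le> norm (1 - u * t powi n) * B" "0 < norm (1 - u * t powi n)"
      using B(4)[OF u n] B(2) nz[OF u n] by (auto simp: field_simps)
    thus "norm (c n / (1 - u * t powi n)) \<le> norm (c n) * B"
      using mult_left_mono[of 1 "norm (1 - u * t powi n) * B" "norm (c n)"] by (simp add: norm_divide field_simps)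
  next
    show "(\<lambda>n. norm (c n) * B) summable_on A" by (intro summable_on_cmult_left c)
  qed
  moreover have "eventually (\<lambda>X. continuous_on (cball u0 r) (\<lambda>u. \<Sum>n\<in>X. c n / (1 - u * t powi n)) \<and>
      (\<lambda>u. \<Sum>n\<in>X. c n / (1 - u * t powi n)) holomorphic_on ball u0 r) (finite_subsets_at_top A)"
  proof (rule eventually_finite_subsets_at_top_weakI)
    fix X assume X: "finite X" "X \<subseteq> A"
    hence "(\<lambda>u. \<Sum>n\<in>X. c n / (1 - u * t powi n)) holomorphic_on cball u0 r"
      using nz by (intro holomorphic_intros) auto
    thus "continuous_on (cball u0 r) (\<lambda>u. \<Sum>n\<in>X. c n / (1 - u * t powi n)) \<and>
      (\<lambda>u. \<Sum>n\<in>X. c n / (1 - u * t powi n)) holomorphic_on ball u0 r"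
      using holomorphic_on_imp_continuous_on holomorphic_on_subset ball_subset_cball by blast
  qed
  ultimately have "?g holomorphic_on ball u0 r"
    using holomorphic_uniform_limit[of u0 r _ "finite_subsets_at_top A" ?g] by fastforce
  hence "?g field_differentiable at u0"
    using B(1) holomorphic_on_imp_differentiable_at[of ?g "ball u0 r" u0] by simp
  thus "?g field_differentiable at u0 within {u. u \<noteq> 0 \<and> (\<forall>n\<in>A. u * t powi n \<noteq> 1)}"
    by (rule field_differentiable_at_within)
qed

text \<open>An Appell-Lerch sum without normalising theta factor. The base Q of the numerators and
  the base t of the denominators are independent: the rank function uses Q = q^3 with t = q, the
  dissection the same Q with t = q^5.\<close>

definition lerch :: "complex \<Rightarrow> complex \<Rightarrow> complex \<Rightarrow> complex \<Rightarrow> complex" where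
  "lerch Q y t u = (\<Sum>\<^sub>\<infinity>n. theta_term y Q n / (1 - u * t powi n))"

definition lerch_reg :: "complex \<Rightarrow> complex \<Rightarrow> complex \<Rightarrow> int \<Rightarrow> complex \<Rightarrow> complex" where
  "lerch_reg Q y t m u = (\<Sum>\<^sub>\<infinity>n\<in>-{m}. theta_term y Q n / (1 - u * t powi n))"

lemma off_powersD:
  assumes "t \<noteq> 0" "u \<in> off_powers t"
  shows "u \<noteq> 0" "u * t powi n \<noteq> 1"
proof -
  show "u \<noteq> 0" using assms by (simp add: off_powers_def)
  have "u \<noteq> t powi (- n)" using assms by (simp add: off_powers_def)
  thus "u * t powi n \<noteq> 1" using assms(1) by (auto simp: power_int_minus field_simps)
qed

lemma off_powers_alt: "t \<noteq> 0 \<Longrightarrow> off_powers t = {u. u \<noteq> 0 \<and> (\<forall>n. u * t powi n \<noteq> 1)}"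
proof (intro set_eqI iffI)
  fix u assume t: "t \<noteq> 0" and u: "u \<in> {u. u \<noteq> 0 \<and> (\<forall>n. u * t powi n \<noteq> 1)}"
  have "u \<noteq> t powi n" for n
  proof
    assume "u = t powi n"
    hence "u * t powi (- n) = 1" using t by (simp add: power_int_minus)
    thus False using u by blast
  qed
  thus "u \<in> off_powers t" using u by (simp add: off_powers_def)
qed (use off_powersD in auto)

context
  fixes Q y t :: complex
  assumes Q: "norm Q < 1" "Q \<noteq> 0" and y: "y \<noteq> 0" and t: "norm t < 1" "t \<noteq> 0"
begin

lemma lerch_summable:
  assumes "u \<in> off_powers t"
  shows "(\<lambda>n. theta_term y Q n / (1 - u * t powi n)) summable_on UNIV"
  by (rule partial_fractions_summable[OF t theta_term_abs_summable[OF Q y]])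
     (use off_powersD[OF t(2) assms] in auto)

lemma lerch_holomorphic: "lerch Q y t holomorphic_on off_powers t"
  using partial_fractions_holomorphic[OF t theta_term_abs_summable[OF Q y]] t
  by (simp add: off_powers_alt lerch_def[abs_def])

lemma lerch_reg_holomorphic:
  "lerch_reg Q y t m holomorphic_on insert (t powi (-m)) (off_powers t)"
  unfolding lerch_reg_def[abs_def]
proof (rule holomorphic_on_subset[OF partial_fractions_holomorphic[OF t]])
  show "(\<lambda>n. norm (theta_term y Q n)) summable_on -{m}"
    using theta_term_abs_summable[OF Q y] summable_on_subset by blast
  have "t powi (-m) * t powi n \<noteq> 1" if "n \<noteq> m" for n
    using powi_neq_1[OF t, of "n - m"] that t by (simp flip: power_int_add)
  thus "insert (t powi (-m)) (off_powers t) \<subseteq> {u. u \<noteq> 0 \<and> (\<forall>n\<in>-{m}. u * t powi n \<noteq> 1)}"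
    using off_powersD[OF t(2)] t by auto
qed

lemma lerch_conv_reg:
  assumes "u \<in> off_powers t"
  shows "lerch Q y t u = theta_term y Q m / (1 - u * t powi m) + lerch_reg Q y t m u"
proof -
  have "(\<lambda>n. theta_term y Q n / (1 - u * t powi n)) summable_on - {m}"
    using lerch_summable[OF assms] summable_on_subset by blast
  hence "(\<Sum>\<^sub>\<infinity>n\<in>insert m (-{m}). theta_term y Q n / (1 - u * t powi n)) =
      theta_term y Q m / (1 - u * t powi m) + lerch_reg Q y t m u"
    unfolding lerch_reg_def by (subst infsum_insert) auto
  moreover have "insert m (-{m}) = UNIV" by auto
  ultimately show ?thesis by (simp add: lerch_def)
qed

lemma lerch_reg_isCont: "isCont (lerch_reg Q y t m) (t powi (-m))"
proof -
  let ?a = "t powi (-m)"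
  have "lerch_reg Q y t m field_differentiable at ?a within insert ?a (off_powers t)"
    using lerch_reg_holomorphic by (auto simp: holomorphic_on_def)
  moreover have "eventually (\<lambda>z. z \<in> off_powers t) (at ?a)"
    by (rule eventually_off_powers[OF t]) (use t in simp)
  then obtain r where r: "r > 0" "\<And>z. z \<noteq> ?a \<Longrightarrow> dist z ?a < r \<Longrightarrow> z \<in> off_powers t"
    by (auto simp: eventually_at)
  have "at ?a within insert ?a (off_powers t) = at ?a"
  proof (rule at_within_nhd[of ?a "ball ?a r"])
    show "?a \<in> ball ?a r" using r by simp
    show "insert ?a (off_powers t) \<inter> ball ?a r - {?a} = UNIV \<inter> ball ?a r - {?a}"
      using r by (auto simp: dist_commute)
  qed auto
  ultimately show ?thesis by (simp add: field_differentiable_imp_continuous_at)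
qed

text \<open>Only the term of index m is singular at a = \<open>t powi (-m)\<close>, and 1 - u t^m =
  (a - u)/a.\<close>

lemma lerch_residue:
  "((\<lambda>u. (u - t powi (-m)) * lerch Q y t u) \<longlongrightarrow> - (t powi (-m)) * theta_term y Q m) (at (t powi (-m)))"
proof -
  let ?a = "t powi (-m)"
  have a: "?a \<noteq> 0" using t by simp
  have "((\<lambda>u. - ?a * theta_term y Q m + (u - ?a) * lerch_reg Q y t m u) \<longlongrightarrow>
      - ?a * theta_term y Q m + (?a - ?a) * lerch_reg Q y t m ?a) (at ?a)"
    using lerch_reg_isCont by (intro tendsto_intros) (auto simp: isCont_def)
  moreover have "eventually (\<lambda>u. - ?a * theta_term y Q m + (u - ?a) * lerch_reg Q y t m u = (u - ?a) * lerch Q y t u) (at ?a)"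
    using eventually_off_powers[OF t a] eventually_neq_at_within[of ?a ?a UNIV]
  proof eventually_elim
    case (elim u)
    have aux: "(u - a) * (c / ((a - u) / a)) = - a * c" if "a \<noteq> u" "a \<noteq> 0" for a u c :: complex
      using that by (simp add: divide_simps) (simp add: algebra_simps)
    have "1 - u * t powi m = (?a - u) / ?a" using t by (simp add: power_int_minus field_simps)
    hence "(u - ?a) * (theta_term y Q m / (1 - u * t powi m)) = - ?a * theta_term y Q m"
      using aux[of ?a u "theta_term y Q m"] a elim by metis
    thus ?case unfolding lerch_conv_reg[OF elim(1), of m] by (simp add: distrib_left)
  qed
  ultimately show ?thesis by (auto intro: Lim_transform_eventually)
qed

text \<open>The factor t in t u is absorbed by the index shift n -> n - 1, which divides the theta
  argument by Q.\<close>

lemma lerch_rec: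
  assumes "u \<in> off_powers t"
  shows "lerch Q y t (t * u) = - (Q / y) * lerch Q (y / Q) t u"
proof -
  have "lerch Q y t (t * u) = (\<Sum>\<^sub>\<infinity>n. theta_term y Q (n - 1) / (1 - (t * u) * t powi (n - 1)))"
    unfolding lerch_def
    by (rule infsum_reindex_bij_betw[symmetric]) (rule bij_betw_byWitness[where f' = "\<lambda>n. n + 1"], auto)
  also have "\<dots> = (\<Sum>\<^sub>\<infinity>n. - (Q / y) * (theta_term (y / Q) Q n / (1 - u * t powi n)))"
    using t by (intro infsum_cong) (simp add: theta_term_diff_1[OF Q(2) y] power_int_diff field_simps)
  also have "\<dots> = - (Q / y) * lerch Q (y / Q) t u"
    unfolding lerch_def by (rule infsum_cmult_right')
  finally show ?thesis .
qed

end

text \<open>Termwise c/(1 - u t^n) = c + u t^n c/(1 - u t^n): the first summands add up to a theta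
  function, and the factor t^n moves into the theta argument.\<close>

lemma lerch_diff:
  assumes Q: "norm Q < 1" "Q \<noteq> 0" and y: "y \<noteq> 0" and t: "norm t < 1" "t \<noteq> 0" and u: "u \<in> off_powers t"
  shows "lerch Q y t u = u * lerch Q (y * t) t u + jfun y Q"
proof -
  have yt: "y * t \<noteq> 0" using y t by simp
  have "((\<lambda>n. u * (theta_term (y * t) Q n / (1 - u * t powi n)) + theta_term y Q n) has_sum
      (u * lerch Q (y * t) t u + jfun y Q)) UNIV"
    unfolding lerch_def
    by (intro has_sum_add has_sum_cmult_right has_sum_infsum lerch_summable Q yt t u jacobi_triple_product y)
  also have "(\<lambda>n. u * (theta_term (y * t) Q n / (1 - u * t powi n)) + theta_term y Q n) =
      (\<lambda>n. theta_term y Q n / (1 - u * t powi n))"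
    using off_powersD[OF t(2) u] by (intro ext) (simp add: theta_term_mult[of y t] divide_simps, simp add: algebra_simps)
  finally show ?thesis by (simp add: lerch_def infsumI)
qed

section \<open>The rank function\<close>

text \<open>As (x)_(n+1) = (1 - x)(xq)_n, the rank generating function is (1 - x) times this series;
  it is also the series inside g.\<close>

definition rank_fun :: "complex \<Rightarrow> complex \<Rightarrow> complex" where
  "rank_fun x q = (\<Sum>n. q ^ (n ^ 2) / (qpoch x q (n + 1) * qpoch (q / x) q n))"

text \<open>The rank series multiplied by (x)_inf (q/x)_inf. All denominators have been cancelled,
  so it is holomorphic even at the powers of q, where the poles of the rank series lie.\<close>

definition rank_num :: "complex \<Rightarrow> complex \<Rightarrow> complex" where
  "rank_num x q = (\<Sum>n. q ^ (n ^ 2) * (qpoch_inf (q ^ (n + 1) * x) q * qpoch_inf (q ^ n * (q / x)) q))"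

lemma gmock_conv_rank_fun: "gmock x q = (rank_fun x q - 1) / x"
  by (simp add: gmock_def rank_fun_def field_simps)

lemma qpoch_inf_off_powers:
  assumes "norm q < 1" "q \<noteq> 0" "x \<in> off_powers q"
  shows "qpoch_inf x q \<noteq> 0" "qpoch_inf (q / x) q \<noteq> 0"
proof -
  have "jfun x q \<noteq> 0" using assms by (simp add: off_powers_conv_jfun)
  thus "qpoch_inf x q \<noteq> 0" "qpoch_inf (q / x) q \<noteq> 0" by (auto simp: jfun_def)
qed

lemma qpoch_off_powers:
  assumes "norm q < 1" "q \<noteq> 0" "x \<in> off_powers q"
  shows "qpoch x q n \<noteq> 0" "qpoch (q / x) q n \<noteq> 0"
  using qpoch_inf_off_powers[OF assms] qpoch_inf_split[OF assms(1), of x n]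
    qpoch_inf_split[OF assms(1), of "q / x" n] by auto

lemma rank_term_conv:
  assumes "norm q < 1" "q \<noteq> 0" "x \<in> off_powers q"
  shows "q ^ (n ^ 2) / (qpoch x q (n + 1) * qpoch (q / x) q n) =
    q ^ (n ^ 2) * (qpoch_inf (q ^ (n + 1) * x) q * qpoch_inf (q ^ n * (q / x)) q) / (qpoch_inf x q * qpoch_inf (q / x) q)"
proof -
  have nz: "qpoch_inf (q ^ (n + 1) * x) q \<noteq> 0" "qpoch_inf (q ^ n * (q / x)) q \<noteq> 0"
    using qpoch_inf_off_powers[OF assms] qpoch_inf_split[OF assms(1), of x "n + 1"]
      qpoch_inf_split[OF assms(1), of "q / x" n] by auto
  show ?thesis
    unfolding qpoch_inf_split[OF assms(1), of x "n + 1"] qpoch_inf_split[OF assms(1), of "q / x" n]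
    using nz qpoch_off_powers[OF assms] by (simp add: divide_simps)
qed

lemma qpoch_inf_bounded:
  assumes "norm q < 1"
  obtains M where "0 \<le> M" "\<And>y. norm y \<le> b \<Longrightarrow> norm (qpoch_inf y q) \<le> M"
proof -
  have "compact ((\<lambda>y. qpoch_inf y q) ` cball 0 b)"
    by (intro compact_continuous_image holomorphic_on_imp_continuous_on holomorphic_on_subset[OF qpoch_inf_holomorphic[OF assms]]) auto
  hence "bounded ((\<lambda>y. qpoch_inf y q) ` cball 0 b)" by (rule compact_imp_bounded)
  then obtain M where "\<forall>y\<in>cball 0 b. norm (qpoch_inf y q) \<le> M" by (auto simp: bounded_iff)
  thus ?thesis by (intro that[of "max 0 M"]) (auto simp: le_max_iff_disj)
qed

lemma summable_qpow_square:
  fixes q :: real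
  assumes "0 \<le> q" "q < 1"
  shows "summable (\<lambda>n. q ^ (n ^ 2))"
proof (rule summable_comparison_test')
  show "summable (\<lambda>n. q ^ n)" using assms by (intro summable_geometric) simp
  show "norm (q ^ (n ^ 2)) \<le> q ^ n" for n
    using assms by (auto simp: power2_eq_square intro!: power_decreasing)
qed

lemma rank_num_term_bound:
  assumes "norm q < 1"
  obtains M where "0 \<le> M" "\<And>x n. norm x \<le> a \<Longrightarrow> norm (1 / x) \<le> b \<Longrightarrow>
    norm (q ^ (n ^ 2) * (qpoch_inf (q ^ (n + 1) * x) q * qpoch_inf (q ^ n * (q / x)) q)) \<le> norm q ^ (n ^ 2) * M"
proof -
  obtain A where A: "0 \<le> A" "\<And>y. norm y \<le> a \<Longrightarrow> norm (qpoch_inf y q) \<le> A" using qpoch_inf_bounded[OF assms, of a] by metis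
  obtain B where B: "0 \<le> B" "\<And>y. norm y \<le> b \<Longrightarrow> norm (qpoch_inf y q) \<le> B" using qpoch_inf_bounded[OF assms, of b] by metis
  have qn: "norm (q ^ k * x) \<le> norm x" for k and x :: complex
    using assms by (auto simp: norm_mult norm_power intro!: mult_left_le_one_le power_le_one)
  show ?thesis
  proof (rule that[of "A * B"])
    fix x :: complex and n assume x: "norm x \<le> a" "norm (1 / x) \<le> b"
    have e: "q ^ n * (q / x) = q ^ (n + 1) * (1 / x)" by simp
    have "norm (qpoch_inf (q ^ n * (q / x)) q) \<le> B"
      unfolding e by (intro B(2) order_trans[OF qn] x)
    moreover have "norm (qpoch_inf (q ^ (n + 1) * x) q) \<le> A" using qn[of "n + 1" x] x A(2) by simp
    ultimately show "norm (q ^ (n ^ 2) * (qpoch_inf (q ^ (n + 1) * x) q * qpoch_inf (q ^ n * (q / x)) q)) \<le> norm q ^ (n ^ 2) * (A * B)"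
      unfolding norm_mult norm_power using A(1) by (intro mult_left_mono mult_mono) auto
  qed (use A B in auto)
qed

lemma rank_num_summable:
  assumes "norm q < 1"
  shows "summable (\<lambda>n. norm (q ^ (n ^ 2) * (qpoch_inf (q ^ (n + 1) * x) q * qpoch_inf (q ^ n * (q / x)) q)))"
proof -
  obtain M where M: "\<And>n. norm (q ^ (n ^ 2) * (qpoch_inf (q ^ (n + 1) * x) q * qpoch_inf (q ^ n * (q / x)) q)) \<le> norm q ^ (n ^ 2) * M"
    using rank_num_term_bound[OF assms, of "norm x" "norm (1 / x)"] by (metis order_refl)
  show ?thesis
  proof (rule summable_comparison_test')
    show "summable (\<lambda>n. norm q ^ (n ^ 2) * M)"
      using assms by (intro summable_mult2 summable_qpow_square) auto
  qed (use M in simp)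
qed

lemma rank_num_holomorphic:
  assumes "norm q < 1"
  shows "(\<lambda>x. rank_num x q) holomorphic_on - {0}"
proof (rule holomorphic_uniform_sequence)
  let ?f = "\<lambda>n x. q ^ (n ^ 2) * (qpoch_inf (q ^ (n + 1) * x) q * qpoch_inf (q ^ n * (q / x)) q)"
  show "(\<lambda>x. \<Sum>i<n. ?f i x) holomorphic_on - {0}" for n
    using assms by (intro holomorphic_intros) auto
  fix x :: complex assume "x \<in> - {0}"
  define r where "r = norm x / 2"
  have r: "0 < r" using \<open>x \<in> - {0}\<close> by (simp add: r_def)
  have ball: "norm y \<le> 2 * norm x \<and> r \<le> norm y" if "y \<in> cball x r" for y
    using that norm_triangle_ineq3[of x y] by (simp add: dist_norm abs_le_iff r_def)
  obtain M where M: "\<And>y n. norm y \<le> 2 * norm x \<Longrightarrow> norm (1 / y) \<le> 1 / r \<Longrightarrow> norm (?f n y) \<le> norm q ^ (n ^ 2) * M"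
    using rank_num_term_bound[OF assms, of "2 * norm x" "1 / r"] by metis
  have "uniform_limit (cball x r) (\<lambda>n y. \<Sum>i<n. ?f i y) (\<lambda>y. rank_num y q) sequentially"
    unfolding rank_num_def
  proof (rule Weierstrass_m_test)
    fix n y assume "y \<in> cball x r"
    thus "norm (?f n y) \<le> norm q ^ (n ^ 2) * M"
      using ball[of y] r by (intro M) (auto simp: norm_divide frac_le)
  next
    show "summable (\<lambda>n. norm q ^ (n ^ 2) * M)"
      using assms by (intro summable_mult2 summable_qpow_square) auto
  qed
  moreover have "cball x r \<subseteq> - {0}" using \<open>x \<in> - {0}\<close> by (auto simp: r_def dist_norm)
  ultimately show "\<exists>d>0. cball x d \<subseteq> - {0} \<and> uniform_limit (cball x d) (\<lambda>n y. \<Sum>i<n. ?f i y) (\<lambda>y. rank_num y q) sequentially"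
    using r by blast
qed auto

lemma rank_fun_conv_num:
  assumes "norm q < 1" "q \<noteq> 0" "x \<in> off_powers q"
  shows "rank_fun x q = rank_num x q / (qpoch_inf x q * qpoch_inf (q / x) q)"
  unfolding rank_fun_def rank_num_def rank_term_conv[OF assms]
  by (rule suminf_divide) (rule summable_norm_cancel[OF rank_num_summable[OF assms(1)]])

lemma rank_fun_summable:
  assumes "norm q < 1" "q \<noteq> 0" "x \<in> off_powers q"
  shows "summable (\<lambda>n. q ^ (n ^ 2) / (qpoch x q (n + 1) * qpoch (q / x) q n))"
  unfolding rank_term_conv[OF assms]
  by (intro summable_divide summable_norm_cancel[OF rank_num_summable[OF assms(1)]])

lemma rank_fun_holomorphic:
  assumes "norm q < 1" "q \<noteq> 0"
  shows "(\<lambda>x. rank_fun x q) holomorphic_on off_powers q"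
proof (rule holomorphic_transform)
  show "(\<lambda>x. rank_num x q / (qpoch_inf x q * qpoch_inf (q / x) q)) holomorphic_on off_powers q"
    using qpoch_inf_off_powers[OF assms] assms
    by (intro holomorphic_intros holomorphic_on_subset[OF rank_num_holomorphic]) (auto simp: off_powers_def)
qed (simp add: rank_fun_conv_num assms)

text \<open>Telescoping with \<open>E n = q\<^bsup>n\<^sup>2\<^esup> / ((x)\<^sub>n (q/x)\<^sub>n)\<close> exhibits the symmetry \<open>x \<mapsto> q/x\<close> of \<open>(rank_fun x q - 1) / x\<close>.\<close>

lemma rank_fun_symmetric_series:
  assumes "norm q < 1" "q \<noteq> 0" "x \<in> off_powers q"
  shows "rank_fun x q - 1 = x * (\<Sum>n. q ^ (n * (n + 1)) / (qpoch x q (n + 1) * qpoch (q / x) q (n + 1)))"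
proof -
  define f where "f = (\<lambda>n. q ^ (n ^ 2) / (qpoch x q (n + 1) * qpoch (q / x) q n))"
  define h where "h = (\<lambda>n. q ^ (n * (n + 1)) / (qpoch x q (n + 1) * qpoch (q / x) q (n + 1)))"
  define E where "E = (\<lambda>n. q ^ (n ^ 2) / (qpoch x q n * qpoch (q / x) q n))"
  have x: "x \<noteq> 0" using assms by (simp add: off_powers_def)
  have nz: "qpoch x q n \<noteq> 0" "qpoch (q / x) q n \<noteq> 0" for n
    using qpoch_off_powers[OF assms] by auto
  have f: "summable f" unfolding f_def by (rule rank_fun_summable[OF assms])
  have Ef: "E n = (1 - q ^ n * x) * f n" for n
  proof -
    have "1 - q ^ n * x \<noteq> 0" using nz(1)[of "Suc n"] by (simp add: qpoch_Suc)
    thus ?thesis by (simp add: E_def f_def qpoch_Suc)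
  qed
  have "(\<lambda>n. (1 - q ^ n * x) * f n) \<longlonglongrightarrow> (1 - 0 * x) * 0"
    using summable_LIMSEQ_zero[OF f] assms by (intro tendsto_intros LIMSEQ_power_zero)
  hence "E \<longlonglongrightarrow> 0" by (simp add: Ef[abs_def])
  hence "(\<lambda>n. E n - E (Suc n)) sums (E 0 - 0)" by (rule telescope_sums')
  moreover have "E n - E (Suc n) = f n - x * h n" for n
  proof -
    define a where "a = 1 - q ^ n * x"
    define b where "b = 1 - q ^ n * (q / x)"
    define P where "P = qpoch x q (n + 1) * qpoch (q / x) q (n + 1)"
    have S: "qpoch x q (n + 1) = qpoch x q n * a" "qpoch (q / x) q (n + 1) = qpoch (q / x) q n * b"
      by (simp_all add: qpoch_Suc a_def b_def)
    have ab: "a \<noteq> 0" "b \<noteq> 0"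
      using nz[of "n + 1"] unfolding S by auto
    have e: "(Suc n)\<^sup>2 = n\<^sup>2 + n + n + 1" "n * (n + 1) = n\<^sup>2 + n" by (simp_all add: power2_eq_square)
    have "E n = q ^ (n\<^sup>2) * a * b / P"
      using nz ab by (simp add: E_def P_def S del: One_nat_def add_Suc_right)
    moreover have "E (Suc n) = q ^ ((Suc n)\<^sup>2) / P" by (simp add: E_def P_def)
    moreover have "f n = q ^ (n\<^sup>2) * b / P"
      using nz ab by (simp add: f_def P_def S del: One_nat_def add_Suc_right)
    moreover have "h n = q ^ (n * (n + 1)) / P" by (simp add: h_def P_def)
    moreover have "q ^ (n\<^sup>2) * a * b - q ^ ((Suc n)\<^sup>2) = q ^ (n\<^sup>2) * b - x * q ^ (n * (n + 1))"
      unfolding e power_add a_def b_def using x by (simp add: field_simps)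
    ultimately show ?thesis by (simp flip: diff_divide_distrib)
  qed
  ultimately have 1: "(\<lambda>n. f n - x * h n) sums 1" by (simp add: E_def)
  have "(\<lambda>n. f n - (f n - x * h n)) sums (rank_fun x q - 1)"
    using sums_diff[OF summable_sums[OF f] 1] by (simp add: rank_fun_def f_def)
  hence "(\<lambda>n. x * h n) sums (rank_fun x q - 1)" by simp
  hence "h sums ((rank_fun x q - 1) / x)"
    using sums_mult[of "\<lambda>n. x * h n" _ "1 / x"] x by simp
  hence "suminf h = (rank_fun x q - 1) / x" by (simp add: sums_iff)
  thus ?thesis using x by (simp add: h_def[abs_def])
qed

lemma off_powers_inverse:
  assumes "q \<noteq> 0" "x \<in> off_powers q"
  shows "1 / x \<in> off_powers q"
proof -
  have "1 / x \<noteq> q powi n" for n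
  proof
    assume "1 / x = q powi n"
    hence "x * q powi n = 1" using off_powersD[OF assms] by (simp add: field_simps)
    thus False using off_powersD[OF assms] by blast
  qed
  thus ?thesis using off_powersD[OF assms] by (simp add: off_powers_def)
qed

text \<open>Termwise: (1/x)_(n+1) (qx)_n = (1 - 1/x) (q/x)_n (qx)_n, and 1 - 1/x = -(1 -
  x)/x.\<close>

lemma rank_fun_inverse:
  assumes "norm q < 1" "q \<noteq> 0" "x \<in> off_powers q"
  shows "rank_fun (1 / x) q = - x * rank_fun x q"
proof -
  have x: "x \<noteq> 0" "x \<noteq> 1" using off_powersD(1)[OF assms(2,3)] off_powersD(2)[OF assms(2,3), of 0] by auto
  have t: "q ^ (n ^ 2) / (qpoch (1 / x) q (n + 1) * qpoch (q / (1 / x)) q n) =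
      - x * (q ^ (n ^ 2) / (qpoch x q (n + 1) * qpoch (q / x) q n))" for n
  proof -
    have 1: "qpoch (1 / x) q (n + 1) = (1 - 1 / x) * qpoch (q / x) q n"
      using qpoch_rec[of "1 / x" q n] by simp
    have 2: "qpoch x q (n + 1) = (1 - x) * qpoch (q * x) q n"
      using qpoch_rec[of x q n] by simp
    have "qpoch (q * x) q n \<noteq> 0"
      using qpoch_off_powers(1)[OF assms, of "n + 1"] qpoch_rec[of x q n] by auto
    thus ?thesis unfolding 1 2
      using x qpoch_off_powers(2)[OF assms, of n] by (simp add: divide_simps) (simp add: algebra_simps)
  qed
  show ?thesis
    unfolding rank_fun_def t by (rule suminf_mult[OF rank_fun_summable[OF assms]])
qed

text \<open>The shift x -> q x is the composition of the reflections x -> 1/x and x -> q/x; the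
  second one swaps the two Pochhammer factors of the symmetric series.\<close>

lemma rank_fun_rec:
  assumes "norm q < 1" "q \<noteq> 0" "x \<in> off_powers q"
  shows "rank_fun (q * x) q = 1 - q * x ^ 2 - q * x ^ 3 * rank_fun x q"
proof -
  have x: "x \<noteq> 0" using off_powersD[OF assms(2,3)] by auto
  define G where "G = (\<lambda>x. \<Sum>n. q ^ (n * (n + 1)) / (qpoch x q (n + 1) * qpoch (q / x) q (n + 1)))"
  have ix: "1 / x \<in> off_powers q" by (rule off_powers_inverse[OF assms(2,3)])
  have qx: "q * x \<in> off_powers q" using off_powers_mult_iff[OF assms(2), of 1] assms(3) by simp
  have "G (q * x) = G (1 / x)"
    using assms(2) by (simp add: G_def mult.commute[of "qpoch (q * x) q _"])
  moreover have "rank_fun (q * x) q - 1 = q * x * G (q * x)" "rank_fun (1 / x) q - 1 = 1 / x * G (1 / x)"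
    using rank_fun_symmetric_series[OF assms(1,2) qx] rank_fun_symmetric_series[OF assms(1,2) ix] by (simp_all add: G_def)
  ultimately have "rank_fun (q * x) q - 1 = q * x * (x * (rank_fun (1 / x) q - 1))"
    using x by simp
  thus ?thesis unfolding rank_fun_inverse[OF assms] by (simp add: algebra_simps power2_eq_square power3_eq_cube)
qed

text \<open>Splitting the product by exponents modulo 3. This also identifies \<open>Jm\<close> with
  the plain Euler product.\<close>

lemma jfun_pentagonal:
  assumes "norm q < 1" "q \<noteq> 0"
  shows "jfun q (q ^ 3) = qpoch_inf q q"
proof -
  have "qpoch_inf q q = (\<Prod>i<3. qpoch_inf (q ^ i * q) (q ^ 3))"
    by (rule qpoch_inf_multisection) (use assms in auto)
  also have "{..<3::nat} = {0, 1, 2}" by auto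
  also have "(\<Prod>i\<in>{0, 1, 2}. qpoch_inf (q ^ i * q) (q ^ 3)) = jfun q (q ^ 3)"
    using assms by (simp add: jfun_def power2_eq_square power3_eq_cube mult_ac)
  finally show ?thesis ..
qed

text \<open>The index shift takes the theta argument q^2 to 1/q, and three partial fraction steps
  climb back through 1 and q to q^2. Their remainders are the theta values at 1/q, 1 and q, the
  middle one being 0.\<close>

lemma rank_lerch_rec:
  assumes "norm q < 1" "q \<noteq> 0" "z \<in> off_powers q"
  shows "lerch (q ^ 3) (q ^ 2) q (q * z) =
    qpoch_inf q q * (1 - q * z ^ 2) - q * z ^ 3 * lerch (q ^ 3) (q ^ 2) q z"
proof -
  have Q: "norm (q ^ 3) < 1" "q ^ 3 \<noteq> 0" using assms by (auto simp: norm_power power_less_one_iff)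
  note d = lerch_diff[OF Q _ assms(1,2,3)]
  have "lerch (q ^ 3) (q ^ 2) q (q * z) = - (q ^ 3 / q ^ 2) * lerch (q ^ 3) (q ^ 2 / q ^ 3) q z"
    by (rule lerch_rec) (use Q assms in auto)
  also have "q ^ 3 / q ^ 2 = q" using assms by (simp add: eval_nat_numeral)
  also have "q ^ 2 / q ^ 3 = 1 / q" using assms by (simp add: eval_nat_numeral)
  also have "lerch (q ^ 3) (1 / q) q z = z * lerch (q ^ 3) 1 q z + jfun (1 / q) (q ^ 3)"
    using d[of "1 / q"] assms by simp
  also have "lerch (q ^ 3) 1 q z = z * lerch (q ^ 3) q q z"
    using d[of 1] Q by simp
  also have "lerch (q ^ 3) q q z = z * lerch (q ^ 3) (q ^ 2) q z + jfun q (q ^ 3)"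
    using d[of q] assms by (simp add: power2_eq_square)
  also have "jfun (1 / q) (q ^ 3) = - jfun q (q ^ 3) / q"
    by (rule jfun_inverse) (use Q assms in auto)
  finally show ?thesis
    unfolding jfun_pentagonal[OF assms(1,2)] using assms(2) by (simp add: algebra_simps power2_eq_square power3_eq_cube)
qed

text \<open>Both sides satisfy the same functional equation. Multiplied by \<open>jfun z q\<close>, their difference has
  only removable singularities and negative degree.\<close>

theorem rank_fun_lerch:
  assumes "norm q < 1" "q \<noteq> 0" "z \<in> off_powers q"
  shows "qpoch_inf q q * rank_fun z q = lerch (q ^ 3) (q ^ 2) q z"
proof -
  have Q: "norm (q ^ 3) < 1" "q ^ 3 \<noteq> 0" "q ^ 2 \<noteq> 0" using assms by (auto simp: norm_power power_less_one_iff)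
  define d where "d = (\<lambda>z. (qpoch_inf q q * rank_fun z q - lerch (q ^ 3) (q ^ 2) q z) * jfun z q)"
  have "d z = 0"
  proof (rule quasiperiodic_remove_sings_eq_0[where f = d and t = q and z = z and m = 1 and l = 0 and C = q and d = 2])
    show "d holomorphic_on off_powers q"
      unfolding d_def using assms(1,2) Q
      by (intro holomorphic_intros rank_fun_holomorphic lerch_holomorphic) (auto simp: off_powers_def)
  next
    fix z assume z: "z \<in> off_powers q"
    have z0: "z \<noteq> 0" using off_powersD[OF assms(2) z] by auto
    \<comment> \<open>The inhomogeneous terms cancel in the difference; its multiplier -q z^3 and
      the multiplier -1/z of the theta function give q z^2.\<close>
    show "d (q ^ 1 * z) = q * z ^ 2 * d z"
      using z0 assms(1,2)
      by (simp add: d_def rank_fun_rec[OF assms(1,2) z] rank_lerch_rec[OF assms(1,2) z] jfun_rec)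
         (simp add: field_simps power2_eq_square power3_eq_cube)
  next
    fix k :: int assume "0 \<le> k" "k < 0 + int 1"
    hence k: "k = 0" by simp
    have hol: "(\<lambda>z. rank_num z q) holomorphic_on - {0}" "(\<lambda>z. jfun z q) holomorphic_on - {0}"
      using assms by (auto intro!: holomorphic_intros rank_num_holomorphic)
    have cont: "isCont (\<lambda>z. rank_num z q) 1" "isCont (\<lambda>z. jfun z q) 1"
      using hol[THEN holomorphic_on_imp_continuous_on] by (auto simp: continuous_on_eq_continuous_at open_Compl)
    \<comment> \<open>The rank part is a multiple of \<open>rank_num\<close>, hence regular at 1;
      the simple pole of the Lerch sum meets the zero \<open>jfun 1 q = 0\<close>.\<close>
    have "((\<lambda>w. (w - 1) * (qpoch_inf q q ^ 2 * rank_num w q) - ((w - 1) * lerch (q ^ 3) (q ^ 2) q w) * jfun w q) \<longlongrightarrow>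
        (1 - 1) * (qpoch_inf q q ^ 2 * rank_num 1 q) - (- 1) * jfun 1 q) (at 1)"
      using cont Q assms lerch_residue[of "q ^ 3" "q ^ 2" q 0]
      by (intro tendsto_intros) (auto simp: isCont_def)
    moreover have "eventually (\<lambda>w. (w - 1) * (qpoch_inf q q ^ 2 * rank_num w q) - ((w - 1) * lerch (q ^ 3) (q ^ 2) q w) * jfun w q
        = (w - 1) * d w) (at 1)"
      using eventually_off_powers[OF assms(1,2) one_neq_zero]
    proof eventually_elim
      case (elim w)
      have "rank_fun w q * jfun w q = rank_num w q * qpoch_inf q q"
        using qpoch_inf_off_powers[OF assms(1,2) elim]
        by (simp add: rank_fun_conv_num[OF assms(1,2) elim] jfun_def)
      have "(w - 1) * d w = (w - 1) * (qpoch_inf q q * (rank_fun w q * jfun w q)) - ((w - 1) * lerch (q ^ 3) (q ^ 2) q w) * jfun w q"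
        by (simp add: d_def algebra_simps)
      also have "rank_fun w q * jfun w q = rank_num w q * qpoch_inf q q" by fact
      finally show ?case by (simp add: power2_eq_square mult_ac)
    qed
    ultimately show "((\<lambda>w. (w - q powi k) * d w) \<longlongrightarrow> 0) (at (q powi k))"
      using assms by (auto simp: k intro: Lim_transform_eventually)
  qed (use assms in auto)
  thus ?thesis using assms by (simp add: d_def off_powers_conv_jfun)
qed

section \<open>Theta functions of quintuple period\<close>

text \<open>A shift of the summation index in Jacobi's series; unlike iteration of
  \<open>jfun_rec\<close> it treats both signs of m at once.\<close>

lemma jfun_shift:
  assumes "norm q < 1" "q \<noteq> 0" "x \<noteq> 0"
  shows "jfun x q = theta_term x q m * jfun (q powi m * x) q"
proof -
  have x: "q powi m * x \<noteq> 0" using assms by simp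
  have "((\<lambda>k. theta_term x q m * theta_term (q powi m * x) q k) has_sum theta_term x q m * jfun (q powi m * x) q) UNIV"
    by (intro has_sum_cmult_right jacobi_triple_product assms x)
  also have "(\<lambda>k. theta_term x q m * theta_term (q powi m * x) q k) = (\<lambda>k. theta_term x q (k + m))"
    using theta_term_shift[OF assms(2) x, of m] assms by (simp add: fun_eq_iff)
  also have "(\<dots> has_sum S) UNIV \<longleftrightarrow> (theta_term x q has_sum S) UNIV" for S
    by (rule has_sum_reindex_bij_betw) (rule bij_betw_byWitness[where f' = "\<lambda>k. k - m"], auto)
  finally show ?thesis
    using jacobi_triple_product[OF assms] has_sum_unique by blast
qed

text \<open>The index shift moves the zero \<open>t powi k\<close> to 1, where \<open>jred\<close>
  with its value \<open>qpoch_inf t t ^ 3\<close> describes the theta function.\<close>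

lemma jfun_zero_limit:
  assumes "norm t < 1" "t \<noteq> 0"
  shows "((\<lambda>w. (w - t powi k) / jfun w t) \<longlongrightarrow> - (t powi k) * theta_term 1 t k / qpoch_inf t t ^ 3) (at (t powi k))"
proof -
  let ?a = "t powi k"
  have a: "?a \<noteq> 0" using assms by simp
  have hol: "(\<lambda>w. theta_term (w / ?a) t k) holomorphic_on - {0}" "(\<lambda>w. jred (w / ?a) t) holomorphic_on - {0}"
    unfolding theta_term_def using assms by (auto intro!: holomorphic_intros)
  have cont: "isCont (\<lambda>w. theta_term (w / ?a) t k) ?a" "isCont (\<lambda>w. jred (w / ?a) t) ?a"
    using hol[THEN holomorphic_on_imp_continuous_on] a by (auto simp: continuous_on_eq_continuous_at open_Compl)
  have nz: "jred 1 t \<noteq> 0" using qpoch_self_nonzero[OF assms(1)] by (simp add: jred_1)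
  have "((\<lambda>w. - ?a * theta_term (w / ?a) t k / jred (w / ?a) t) \<longlongrightarrow> - ?a * theta_term (?a / ?a) t k / jred (?a / ?a) t) (at ?a)"
    using cont nz a by (intro tendsto_intros) (auto simp: isCont_def)
  moreover have "eventually (\<lambda>w. - ?a * theta_term (w / ?a) t k / jred (w / ?a) t = (w - ?a) / jfun w t) (at ?a)"
    using eventually_off_powers[OF assms a] eventually_neq_at_within[of ?a ?a UNIV]
  proof eventually_elim
    case (elim w)
    have w: "w \<noteq> 0" using elim by (simp add: off_powers_def)
    have v: "w / ?a \<noteq> 0" "w / ?a \<noteq> 1" using w a elim by auto
    have "jfun (w / ?a) t = theta_term (w / ?a) t k * jfun w t"
      using jfun_shift[OF assms v(1), of k] assms(2) by simp
    hence 1: "(1 - w / ?a) * jred (w / ?a) t = theta_term (w / ?a) t k * jfun w t"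
      using jfun_conv_jred[OF assms(1)] by simp
    have th: "theta_term (w / ?a) t k \<noteq> 0" using v assms by (simp add: theta_term_def)
    have j: "jfun w t \<noteq> 0" using elim assms by (simp add: off_powers_conv_jfun)
    have jr: "jred (w / ?a) t \<noteq> 0" using 1 th j by auto
    have "(w - a) * r = - a * ((1 - w / a) * r)" if "a \<noteq> 0" for a r :: complex
      using that by (simp add: field_simps)
    hence "(w - ?a) * jred (w / ?a) t = - ?a * ((1 - w / ?a) * jred (w / ?a) t)" using a by blast
    also note 1
    finally have "(w - ?a) * jred (w / ?a) t = - ?a * (theta_term (w / ?a) t k * jfun w t)" .
    moreover have "- a * h / r = (w - a) / j" if "(w - a) * r = - a * (h * j)" "j \<noteq> 0" "r \<noteq> 0" for a h r j :: complex
      using that by (simp add: divide_simps)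
    ultimately show ?case using j jr by blast
  qed
  ultimately show ?thesis using a by (auto intro: Lim_transform_eventually simp: jred_1)
qed

lemma rank_fun_mult_jfun:
  assumes "norm q < 1" "q \<noteq> 0" "x \<in> off_powers q"
  shows "rank_fun x q * jfun x q = rank_num x q * qpoch_inf q q"
  using qpoch_inf_off_powers[OF assms] by (simp add: rank_fun_conv_num[OF assms] jfun_def)

lemma int_between_2: "(k :: int) \<ge> -2 \<Longrightarrow> k < -2 + int 5 \<Longrightarrow> k \<in> {-2, -1, 0, 1, 2}"
  by auto

lemma deriv_eqI:
  fixes f g :: "complex \<Rightarrow> complex"
  assumes "\<And>v. v \<noteq> 0 \<Longrightarrow> f v = g v" "(f has_field_derivative a) (at 1)" "(g has_field_derivative b) (at 1)"
  shows "a = b"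
proof -
  have "(g has_field_derivative a) (at 1)"
    by (rule has_field_derivative_transform_within_open[OF assms(2), of "- {0}"]) (use assms(1) in \<open>auto simp: open_Compl\<close>)
  thus ?thesis using assms(3) DERIV_unique by blast
qed

context
  fixes t :: complex
  assumes t: "norm t < 1" "t \<noteq> 0"
begin

abbreviation (input) "j5 x \<equiv> jfun x (t ^ 5)"
abbreviation (input) "j1 \<equiv> jfun t (t ^ 5)"
abbreviation (input) "j2 \<equiv> jfun (t ^ 2) (t ^ 5)"
abbreviation (input) "J5 \<equiv> qpoch_inf (t ^ 5) (t ^ 5)"

lemma t5: "norm (t ^ 5) < 1" "t ^ 5 \<noteq> 0"
  using t by (auto simp: norm_power power_less_one_iff)

lemma off_powers_5: "u \<in> off_powers t \<Longrightarrow> u \<in> off_powers (t ^ 5)"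
proof -
  have "(t ^ 5) powi n = t powi (5 * n)" for n
    using power_int_mult[of t 5] by simp
  thus "u \<in> off_powers t \<Longrightarrow> u \<in> off_powers (t ^ 5)" by (simp add: off_powers_def)
qed

lemma j5_values:
  "j5 (t ^ 3) = j2" "j5 (t ^ 4) = j1" "j5 (1 / t) = - j1 / t" "j5 (1 / t ^ 2) = - j2 / t ^ 2"
  "j5 (1 / t ^ 3) = - j2 / t ^ 3" "j5 (1 / t ^ 4) = - j1 / t ^ 4"
proof -
  have e: "t ^ 5 / t ^ 2 = t ^ 3" "t ^ 5 / t = t ^ 4" using t by (simp_all add: eval_nat_numeral)
  show 1: "j5 (t ^ 3) = j2" "j5 (t ^ 4) = j1"
    using jfun_reflect[OF t5(2), of "t ^ 2"] jfun_reflect[OF t5(2), of t] unfolding e by simp_all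
  show "j5 (1 / t) = - j1 / t" "j5 (1 / t ^ 2) = - j2 / t ^ 2"
    "j5 (1 / t ^ 3) = - j2 / t ^ 3" "j5 (1 / t ^ 4) = - j1 / t ^ 4"
    using jfun_inverse[OF t5, of t] jfun_inverse[OF t5, of "t ^ 2"] jfun_inverse[OF t5, of "t ^ 3"]
      jfun_inverse[OF t5, of "t ^ 4"] t by (simp_all add: 1)
qed

lemma j5_nonzero: "j1 \<noteq> 0" "j2 \<noteq> 0"
  using jfun_nonzero_powi[OF t, of 5 1] jfun_nonzero_powi[OF t, of 5 2] by simp_all

lemma j5_prod: "j1 * j2 = qpoch_inf t t * qpoch_inf (t ^ 5) (t ^ 5)"
proof -
  have e: "t ^ 5 / t ^ 2 = t ^ 3" "t ^ 5 / t = t ^ 4" using t by (simp_all add: eval_nat_numeral)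
  have "qpoch_inf t t = (\<Prod>i<5. qpoch_inf (t ^ i * t) (t ^ 5))"
    by (rule qpoch_inf_multisection) (use t in auto)
  also have "\<dots> = (\<Prod>i<5. qpoch_inf (t ^ Suc i) (t ^ 5))" by (simp add: mult.commute)
  also have "{..<5::nat} = {0, 1, 2, 3, 4}" by auto
  finally have "qpoch_inf t t = qpoch_inf t (t ^ 5) * qpoch_inf (t ^ 2) (t ^ 5) * qpoch_inf (t ^ 3) (t ^ 5) *
      qpoch_inf (t ^ 4) (t ^ 5) * qpoch_inf (t ^ 5) (t ^ 5)"
    by (simp del: power_Suc add: numeral_2_eq_2[symmetric])
  thus ?thesis unfolding jfun_def e by (simp add: mult_ac)
qed

text \<open>The factors t^k in the two arguments compensate, so the multiplier is independent of k
  and every linear combination of such products is quasi-periodic with it.\<close>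

lemma j5_period:
  assumes "u \<noteq> 0"
  shows "j5 (t ^ k * (t ^ 5 * u)) * j5 (t ^ 5 * u / t ^ k) = j5 (t ^ k * u) * j5 (u / t ^ k) / u ^ 2"
proof -
  have 1: "j5 (t ^ k * (t ^ 5 * u)) = - j5 (t ^ k * u) / (t ^ k * u)"
    using jfun_rec[OF t5, of "t ^ k * u"] assms t by (simp add: mult_ac)
  have 2: "j5 (t ^ 5 * u / t ^ k) = - j5 (u / t ^ k) / (u / t ^ k)"
    using jfun_rec[OF t5, of "u / t ^ k"] assms t by simp
  show ?thesis unfolding 1 2 using assms t by (simp add: power2_eq_square field_simps)
qed

text \<open>The products vanish where one argument is 1. These zeros make it possible to prescribe
  values at t, 1/t and at t^2, 1/t^2 separately.\<close>

lemma j5_product_values: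
  "j5 t * j5 (1 / t) = - (j1 ^ 2 / t)" "j5 (t ^ 2) * j5 (1 / t ^ 2) = - (j2 ^ 2 / t ^ 2)"
  "j5 (t * t) * j5 (t / t) = 0" "j5 (t ^ 2 * t) * j5 (t / t ^ 2) = - j1 * j2 / t"
  "j5 (t * (1 / t)) * j5 ((1 / t) / t) = 0" "j5 (t ^ 2 * (1 / t)) * j5 ((1 / t) / t ^ 2) = - j1 * j2 / t ^ 3"
  "j5 (t * t ^ 2) * j5 (t ^ 2 / t) = j1 * j2" "j5 (t ^ 2 * t ^ 2) * j5 (t ^ 2 / t ^ 2) = 0"
  "j5 (t * (1 / t ^ 2)) * j5 ((1 / t ^ 2) / t) = j1 * j2 / t ^ 4"
  "j5 (t ^ 2 * (1 / t ^ 2)) * j5 ((1 / t ^ 2) / t ^ 2) = 0"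
proof -
  have e: "t / t = 1" "t ^ 2 * t = t ^ 3" "t / t ^ 2 = 1 / t" "t * (1 / t) = 1" "t ^ 2 * (1 / t) = t"
    "(1 / t) / t ^ 2 = 1 / t ^ 3" "t * t ^ 2 = t ^ 3" "t ^ 2 / t = t" "t ^ 2 / t ^ 2 = 1"
    "t * (1 / t ^ 2) = 1 / t" "(1 / t ^ 2) / t = 1 / t ^ 3" "t ^ 2 * (1 / t ^ 2) = 1"
    using t by (simp_all add: eval_nat_numeral)
  show "j5 t * j5 (1 / t) = - (j1 ^ 2 / t)" "j5 (t ^ 2) * j5 (1 / t ^ 2) = - (j2 ^ 2 / t ^ 2)"
    "j5 (t * t) * j5 (t / t) = 0" "j5 (t ^ 2 * t) * j5 (t / t ^ 2) = - j1 * j2 / t"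
    "j5 (t * (1 / t)) * j5 ((1 / t) / t) = 0" "j5 (t ^ 2 * (1 / t)) * j5 ((1 / t) / t ^ 2) = - j1 * j2 / t ^ 3"
    "j5 (t * t ^ 2) * j5 (t ^ 2 / t) = j1 * j2" "j5 (t ^ 2 * t ^ 2) * j5 (t ^ 2 / t ^ 2) = 0"
    "j5 (t * (1 / t ^ 2)) * j5 ((1 / t ^ 2) / t) = j1 * j2 / t ^ 4"
    "j5 (t ^ 2 * (1 / t ^ 2)) * j5 ((1 / t ^ 2) / t ^ 2) = 0"
    unfolding e j5_values jfun_1[OF t5(1)] by (simp_all add: eval_nat_numeral)
qed

lemma jfun_period5:
  assumes "u \<noteq> 0"
  shows "jfun (t ^ 5 * u) t = - jfun u t / (t ^ 10 * u ^ 5)"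
proof -
  have "theta_term u t (int 5) = - (t ^ 10 * u ^ 5)" by (simp only: theta_term_of_nat) simp
  hence "jfun u t = - (t ^ 10 * u ^ 5) * jfun (t ^ 5 * u) t" using jfun_shift[OF t assms, of 5] by simp
  thus ?thesis using assms t by (simp add: field_simps)
qed

lemma theta_quotient_limit:
  assumes hol: "h holomorphic_on - {0}"
  shows "((\<lambda>w. (w - t powi k) * (h w / jfun w t)) \<longlongrightarrow>
     - (t powi k) * theta_term 1 t k / qpoch_inf t t ^ 3 * h (t powi k)) (at (t powi k))"
proof -
  have "isCont h (t powi k)"
    using holomorphic_on_imp_continuous_on[OF hol] t by (auto simp: continuous_on_eq_continuous_at open_Compl)
  hence "((\<lambda>w. ((w - t powi k) / jfun w t) * h w) \<longlongrightarrow>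
     (- (t powi k) * theta_term 1 t k / qpoch_inf t t ^ 3) * h (t powi k)) (at (t powi k))"
    by (intro tendsto_mult jfun_zero_limit t) (auto simp: isCont_def)
  thus ?thesis by simp
qed

text \<open>A case of Weierstrass' three-term relation: the quotient of the difference of the two sides by
  \<open>jfun u t\<close> is holomorphic and of negative degree.\<close>

lemma three_term:
  assumes u: "u \<in> off_powers t"
  shows "t * j1 ^ 2 * (j5 (t ^ 2 * u) * j5 (u / t ^ 2)) =
    j2 ^ 2 * (j5 (t * u) * j5 (u / t)) - j1 * j2 * j5 u ^ 2"
proof -
  define h where "h = (\<lambda>u. j2 ^ 2 * (j5 (t ^ 1 * u) * j5 (u / t ^ 1)) - j1 * j2 * (j5 (t ^ 0 * u) * j5 (u / t ^ 0))
      - t * j1 ^ 2 * (j5 (t ^ 2 * u) * j5 (u / t ^ 2)))"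
  have hol: "h holomorphic_on - {0}"
    unfolding h_def using t t5 by (intro holomorphic_intros) auto
  define f where "f = (\<lambda>u. h u / jfun u t)"
  have "f u = 0"
  \<comment> \<open>C and d come from dividing the multiplier u^(-2) of h by the multiplier -1/(t^10
    u^5) of \<open>jfun u t\<close>.\<close>
  proof (rule quasiperiodic_remove_sings_eq_0[where f = f and t = t and z = u and m = 5 and l = "-2" and C = "- (t ^ 10)" and d = 3])
    show "f holomorphic_on off_powers t"
      unfolding f_def using t hol
      by (intro holomorphic_intros) (auto simp: off_powers_def jfun_eq_0_iff intro: holomorphic_on_subset)
  next
    fix z assume "z \<in> off_powers t"
    hence z: "z \<noteq> 0" by (simp add: off_powers_def)
    have "h (t ^ 5 * z) = h z / z ^ 2"
      unfolding h_def j5_period[OF z] by (simp only: diff_divide_distrib times_divide_eq_right)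
    thus "f (t ^ 5 * z) = - (t ^ 10) * z ^ 3 * f z"
      using z t by (simp add: f_def jfun_period5) (simp add: eval_nat_numeral)
  next
    fix k :: int assume "- 2 \<le> k" "k < - 2 + int 5"
    hence k: "k \<in> {-2, -1, 0, 1, 2}" by (rule int_between_2)
    \<comment> \<open>Up to powers of t^5 these five points are all the zeros of the
      denominator.\<close>
    have "h 1 = 0" "h t = 0" "h (1 / t) = 0" "h (t ^ 2) = 0" "h (1 / t ^ 2) = 0"
      unfolding h_def power_one_right power_0 mult_1 mult_1_right div_by_1 j5_product_values
        j5_values jfun_1[OF t5(1)]
      using t by (simp_all add: eval_nat_numeral)
    hence "h (t powi k) = 0"
      using k by (elim insertE emptyE) (simp_all add: power_int_minus_divide)
    thus "((\<lambda>w. (w - t powi k) * f w) \<longlongrightarrow> 0) (at (t powi k))"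
      using theta_quotient_limit[OF hol, of k] by (simp add: f_def)
  qed (use t u in auto)
  hence "h u = 0" using u t by (simp add: f_def off_powers_conv_jfun)
  thus ?thesis by (simp add: h_def power2_eq_square)
qed

text \<open>Extension by continuity to the powers of t, which include the points t and t^2 where the
  relation will be differentiated.\<close>

lemma three_term':
  assumes u: "u \<noteq> 0"
  shows "t * j1 ^ 2 * (j5 (t ^ 2 * u) * j5 (u / t ^ 2)) =
    j2 ^ 2 * (j5 (t * u) * j5 (u / t)) - j1 * j2 * j5 u ^ 2"
proof -
  let ?h = "\<lambda>u. t * j1 ^ 2 * (j5 (t ^ 2 * u) * j5 (u / t ^ 2)) - (j2 ^ 2 * (j5 (t * u) * j5 (u / t)) - j1 * j2 * j5 u ^ 2)"
  have "?h holomorphic_on - {0}"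
    using t t5 by (intro holomorphic_intros) auto
  hence "isCont ?h u"
    using holomorphic_on_imp_continuous_on[of ?h "- {0}"] u by (auto simp: continuous_on_eq_continuous_at open_Compl)
  hence L1: "(?h \<longlongrightarrow> ?h u) (at u)" by (simp add: isCont_def)
  have "eventually (\<lambda>v. ?h v = 0) (at u)"
    using eventually_off_powers[OF t u] by eventually_elim (use three_term in simp)
  hence L2: "(?h \<longlongrightarrow> 0) (at u)" by (rule tendsto_eventually)
  have "?h u = 0" by (rule tendsto_unique[OF _ L1 L2]) simp
  thus ?thesis by simp
qed

lemma j5_reflections:
  assumes "v \<noteq> 0"
  shows "j5 (t ^ 3 * v) = j5 (t ^ 2 * (1 / v))" "j5 (t ^ 4 * v) = j5 (t * (1 / v))"
    "j5 (v / t) = - (v / t) * j5 (t * (1 / v))" "j5 (v / t ^ 2) = - (v / t ^ 2) * j5 (t ^ 2 * (1 / v))"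
proof -
  have "t ^ 5 / (t ^ 2 * (1 / v)) = t ^ 3 * v" "t ^ 5 / (t * (1 / v)) = t ^ 4 * v"
    using assms t by (simp_all add: eval_nat_numeral)
  thus "j5 (t ^ 3 * v) = j5 (t ^ 2 * (1 / v))" "j5 (t ^ 4 * v) = j5 (t * (1 / v))"
    using jfun_reflect[OF t5(2), of "t ^ 2 * (1 / v)"] jfun_reflect[OF t5(2), of "t * (1 / v)"] by simp_all
  show "j5 (v / t) = - (v / t) * j5 (t * (1 / v))" "j5 (v / t ^ 2) = - (v / t ^ 2) * j5 (t ^ 2 * (1 / v))"
    using jfun_inverse[OF t5, of "t / v"] jfun_inverse[OF t5, of "t ^ 2 / v"] assms t by simp_all
qed

text \<open>Logarithmic derivatives of j5 at t and t^2 with respect to u d/du; \<open>lam2\<close>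
  is the second one.\<close>

definition lam1 :: complex where "lam1 = deriv (\<lambda>u. j5 (t * u)) 1 / j1"
definition lam2 :: complex where "lam2 = deriv (\<lambda>u. j5 (t ^ 2 * u)) 1 / j2"

lemma j5_derivs:
  "((\<lambda>u. j5 (t * u)) has_field_derivative lam1 * j1) (at 1)"
  "((\<lambda>u. j5 (t ^ 2 * u)) has_field_derivative lam2 * j2) (at 1)"
  "(j5 has_field_derivative - (J5 ^ 3)) (at 1)"
  "((\<lambda>u. j5 (t * (1 / u))) has_field_derivative - (lam1 * j1)) (at 1)"
  "((\<lambda>u. j5 (t ^ 2 * (1 / u))) has_field_derivative - (lam2 * j2)) (at 1)"
proof -
  have "(\<lambda>u. j5 (t * u)) holomorphic_on - {0}" "(\<lambda>u. j5 (t ^ 2 * u)) holomorphic_on - {0}"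
    using t t5 by (auto intro!: holomorphic_intros)
  hence "((\<lambda>u. j5 (t * u)) has_field_derivative deriv (\<lambda>u. j5 (t * u)) 1) (at 1)"
    "((\<lambda>u. j5 (t ^ 2 * u)) has_field_derivative deriv (\<lambda>u. j5 (t ^ 2 * u)) 1) (at 1)"
    using holomorphic_derivI[of _ "- {0}" 1] by (auto simp: open_Compl)
  thus 1: "((\<lambda>u. j5 (t * u)) has_field_derivative lam1 * j1) (at 1)"
    "((\<lambda>u. j5 (t ^ 2 * u)) has_field_derivative lam2 * j2) (at 1)"
    using j5_nonzero by (simp_all add: lam1_def lam2_def)
  have d: "((\<lambda>x::complex. 1 / x) has_field_derivative - 1) (at 1)"
    by (auto intro!: derivative_eq_intros)
  show "((\<lambda>u. j5 (t * (1 / u))) has_field_derivative - (lam1 * j1)) (at 1)"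
    "((\<lambda>u. j5 (t ^ 2 * (1 / u))) has_field_derivative - (lam2 * j2)) (at 1)"
    using DERIV_chain2[of "\<lambda>u. j5 (t * u)" "lam1 * j1" "\<lambda>x. 1 / x" 1 "- 1" UNIV]
      DERIV_chain2[of "\<lambda>u. j5 (t ^ 2 * u)" "lam2 * j2" "\<lambda>x. 1 / x" 1 "- 1" UNIV] 1 d by simp_all
  show "(j5 has_field_derivative - (J5 ^ 3)) (at 1)"
    by (rule deriv_jfun_1[OF t5(1)])
qed

text \<open>Obtained from the three-term relation by differentiation at \<open>u = t\<close> and \<open>u = t\<^sup>2\<close>.\<close>

lemma lam_relations:
  "3 * lam1 + lam2 = 1 - j2 ^ 2 * J5 ^ 3 / j1 ^ 3"
  "3 * lam2 - lam1 = t * j1 ^ 2 * J5 ^ 3 / j2 ^ 3"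
proof -
  note nz = j5_nonzero
  have j51: "j5 1 = 0" by (rule jfun_1[OF t5(1)])
  \<comment> \<open>The relation at u = t v, differentiated at v = 1. Reflections reduce all
    arguments to t, t^2 and 1; since j5 v vanishes at 1, its term contributes only through the
    derivative -(J5^3).\<close>
  have "t * j1 ^ 2 * (- (1 / t) * (j2 * j1 - lam2 * j2 * j1 - lam1 * j1 * j2)) =
    j2 ^ 2 * (j2 * - (J5 ^ 3)) - j1 * j2 * (2 * j1 * (lam1 * j1))"
  proof (rule deriv_eqI)
    fix v :: complex assume v: "v \<noteq> 0"
    have e: "t ^ 2 * (t * v) = t ^ 3 * v" "t * v / t ^ 2 = v / t" "t * (t * v) = t ^ 2 * v" "t * v / t = v"
      using t by (simp_all add: eval_nat_numeral)
    show "t * j1 ^ 2 * (- (1 / t) * (v * (j5 (t ^ 2 * (1 / v)) * j5 (t * (1 / v))))) =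
        j2 ^ 2 * (j5 (t ^ 2 * v) * j5 v) - j1 * j2 * j5 (t * v) ^ 2"
      using three_term'[of "t * v"] v t unfolding e j5_reflections[OF v] by (simp add: mult_ac)
  next
    show "((\<lambda>v. t * j1 ^ 2 * (- (1 / t) * (v * (j5 (t ^ 2 * (1 / v)) * j5 (t * (1 / v)))))) has_field_derivative
      t * j1 ^ 2 * (- (1 / t) * (j2 * j1 - lam2 * j2 * j1 - lam1 * j1 * j2))) (at 1)"
      by (rule derivative_eq_intros j5_derivs refl)+ (simp add: algebra_simps)
    show "((\<lambda>v. j2 ^ 2 * (j5 (t ^ 2 * v) * j5 v) - j1 * j2 * j5 (t * v) ^ 2) has_field_derivative
      j2 ^ 2 * (j2 * - (J5 ^ 3)) - j1 * j2 * (2 * j1 * (lam1 * j1))) (at 1)"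
      by (rule derivative_eq_intros j5_derivs refl)+ (simp add: j51 algebra_simps)
  qed
  hence "j1 ^ 3 * j2 * (3 * lam1 + lam2 - 1) = - (j2 ^ 3 * J5 ^ 3)"
    using t by (simp add: algebra_simps power2_eq_square power3_eq_cube)
  moreover have "x = 1 - b ^ 2 * K / a ^ 3" if "a ^ 3 * b * (x - 1) = - (b ^ 3 * K)" "a \<noteq> 0" "b \<noteq> 0" for a b x K :: complex
  proof -
    have "b * (a ^ 3 * (x - 1) + b ^ 2 * K) = 0"
      using that(1) by (simp add: algebra_simps power2_eq_square power3_eq_cube)
    hence "a ^ 3 * (x - 1) = - (b ^ 2 * K)" using that(3) by (simp add: add_eq_0_iff)
    thus ?thesis using that(2) by (simp add: field_simps)
  qed
  ultimately show "3 * lam1 + lam2 = 1 - j2 ^ 2 * J5 ^ 3 / j1 ^ 3"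
    using nz by blast
  \<comment> \<open>The same at u = t^2 v; here the vanishing factor stands on the left.\<close>
  have "t * j1 ^ 2 * (j1 * - (J5 ^ 3)) =
    j2 ^ 2 * (j2 * (lam1 * j1) - (lam2 * j2) * j1) - j1 * j2 * (2 * j2 * (lam2 * j2))"
  proof (rule deriv_eqI)
    fix v :: complex assume v: "v \<noteq> 0"
    have e: "t ^ 2 * (t ^ 2 * v) = t ^ 4 * v" "t ^ 2 * v / t ^ 2 = v" "t * (t ^ 2 * v) = t ^ 3 * v" "t ^ 2 * v / t = t * v"
      using t by (simp_all add: eval_nat_numeral)
    show "t * j1 ^ 2 * (j5 (t * (1 / v)) * j5 v) =
        j2 ^ 2 * (j5 (t ^ 2 * (1 / v)) * j5 (t * v)) - j1 * j2 * j5 (t ^ 2 * v) ^ 2"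
      using three_term'[of "t ^ 2 * v"] v t unfolding e j5_reflections[OF v] by simp
  next
    show "((\<lambda>v. t * j1 ^ 2 * (j5 (t * (1 / v)) * j5 v)) has_field_derivative
      t * j1 ^ 2 * (j1 * - (J5 ^ 3))) (at 1)"
      by (rule derivative_eq_intros j5_derivs refl)+ (simp add: j51 algebra_simps)
    show "((\<lambda>v. j2 ^ 2 * (j5 (t ^ 2 * (1 / v)) * j5 (t * v)) - j1 * j2 * j5 (t ^ 2 * v) ^ 2) has_field_derivative
      j2 ^ 2 * (j2 * (lam1 * j1) - (lam2 * j2) * j1) - j1 * j2 * (2 * j2 * (lam2 * j2))) (at 1)"
      by (rule derivative_eq_intros j5_derivs refl)+ (simp add: algebra_simps)
  qed
  hence "j2 ^ 3 * j1 * (3 * lam2 - lam1) = t * j1 ^ 3 * J5 ^ 3"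
    by (simp add: algebra_simps power2_eq_square power3_eq_cube)
  moreover have "x = t * a ^ 2 * K / b ^ 3" if "b ^ 3 * a * x = t * a ^ 3 * K" "a \<noteq> 0" "b \<noteq> 0" for a b x K :: complex
  proof -
    have "a * (b ^ 3 * x - t * a ^ 2 * K) = 0"
      using that(1) by (simp add: algebra_simps power2_eq_square power3_eq_cube)
    hence "b ^ 3 * x = t * a ^ 2 * K" using that(2) by simp
    thus ?thesis using that(3) by (simp add: field_simps)
  qed
  ultimately show "3 * lam2 - lam1 = t * j1 ^ 2 * J5 ^ 3 / j2 ^ 3"
    using nz by blast
qed

end

section \<open>Dissection of the Lerch sum\<close>

context
  fixes q :: complex
  assumes q: "norm q < 1" "q \<noteq> 0"
begin

abbreviation (input) "tt \<equiv> q ^ 5"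
abbreviation (input) "jj x \<equiv> jfun x (tt ^ 5)"
abbreviation (input) "jj1 \<equiv> jfun tt (tt ^ 5)"
abbreviation (input) "jj2 \<equiv> jfun (tt ^ 2) (tt ^ 5)"
abbreviation (input) "XX \<equiv> qpoch_inf tt tt"
abbreviation (input) "qq \<equiv> qpoch_inf q q"

lemma q_powers: "norm tt < 1" "tt \<noteq> 0" "norm (q ^ 3) < 1" "q ^ 3 \<noteq> 0"
  using q by (auto simp: norm_power power_less_one_iff)

text \<open>The exponent e is made the parameter because all moves below act on it by integer steps:
  -3 for the shift u -> q^5 u, +5 for partial fractions.\<close>

definition ler :: "int \<Rightarrow> complex \<Rightarrow> complex" where
  "ler e u = lerch (q ^ 3) (q powi e) tt u"

lemma ler_rec:
  assumes "u \<in> off_powers tt"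
  shows "ler e (tt * u) = - (q powi (3 - e)) * ler (e - 3) u"
proof -
  have "q ^ 3 = q powi 3" by simp
  thus ?thesis
    using lerch_rec[OF q_powers(3,4) _ q_powers(1,2) assms, of "q powi e"] q
    unfolding ler_def by (simp add: power_int_diff)
qed

lemma ler_diff:
  assumes "u \<in> off_powers tt"
  shows "ler e u = u * ler (e + 5) u + jfun (q powi e) (q ^ 3)"
  using lerch_diff[OF q_powers(3,4) _ q_powers(1,2) assms, of "q powi e"] q
  unfolding ler_def by (simp add: power_int_add)

lemma jfun_q3_values:
  "jfun (q powi 1) (q ^ 3) = qq" "jfun (q powi (-1)) (q ^ 3) = - qq / q" "jfun (q powi (-2)) (q ^ 3) = - qq / q ^ 2"
  "jfun (q powi (-6)) (q ^ 3) = 0" "jfun (q powi (-11)) (q ^ 3) = qq / q ^ 26"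
proof -
  have P: "jfun q (q ^ 3) = qq" by (rule jfun_pentagonal[OF q])
  thus "jfun (q powi 1) (q ^ 3) = qq" by simp
  show "jfun (q powi (-1)) (q ^ 3) = - qq / q"
    using jfun_inverse[OF q_powers(3,4) q(2)] P by (simp add: power_int_minus_divide)
  have sh: "jfun (q powi (1 - 3 * int m)) (q ^ 3) = theta_term (q powi (1 - 3 * int m)) (q ^ 3) (int m) * qq" for m
  proof -
    have "(q ^ 3) powi int m * q powi (1 - 3 * int m) = q"
      using q power_int_mult[of q 3 "int m"] power_int_add[of q "3 * int m" "1 - 3 * int m"] by simp
    thus ?thesis using jfun_shift[OF q_powers(3,4), of "q powi (1 - 3 * int m)" "int m"] q P by simp
  qed
  show "jfun (q powi (-2)) (q ^ 3) = - qq / q ^ 2"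
    using sh[of 1] q unfolding theta_term_of_nat by (simp add: power_int_minus_divide)
  show "jfun (q powi (-11)) (q ^ 3) = qq / q ^ 26"
    using sh[of 4] q unfolding theta_term_of_nat
    by (simp add: power_int_minus_divide power_divide flip: power_mult) (simp add: field_simps flip: power_add)
  have "q powi (-6) = (q ^ 3) powi (-2)" by (simp add: power_int_minus flip: power_mult)
  thus "jfun (q powi (-6)) (q ^ 3) = 0"
    using jfun_eq_0_iff[OF q_powers(3,4), of "q powi (-6)"] q by auto
qed

text \<open>Five shifts lower e from 4 to -11 and three partial fraction steps raise it by 15 again.
  Being the least common multiple of 3 and 5, 15 is what makes q^25 the period.\<close>

lemma ler_period:
  assumes u: "u \<in> off_powers tt"
  shows "ler 4 (tt ^ 5 * u) = - (tt ^ 5) * u ^ 3 * ler 4 u - qq / q * (1 - tt ^ 5 * u ^ 2)"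
proof -
  have off: "tt * v \<in> off_powers tt" if "v \<in> off_powers tt" for v
    using off_powers_mult_iff[OF q_powers(2), of 1 v] that by simp
  have "ler 4 (tt ^ 5 * u) = ler 4 (tt * (tt * (tt * (tt * (tt * u)))))"
    by (simp add: eval_nat_numeral mult_ac)
  also have "\<dots> = - (q ^ 25) * ler (-11) u"
    unfolding ler_rec[OF u] ler_rec[OF off[OF u]] ler_rec[OF off[OF off[OF u]]]
      ler_rec[OF off[OF off[OF off[OF u]]]] ler_rec[OF off[OF off[OF off[OF off[OF u]]]]]
    using q power_Suc[of q 25] by (simp add: power_int_minus_divide)
  also have "ler (-11) u = u * (u * (u * ler 4 u - qq / q)) + qq / q ^ 26"
    using ler_diff[OF u, of "-11"] ler_diff[OF u, of "-6"] ler_diff[OF u, of "-1"] jfun_q3_values by simp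
  finally show ?thesis
    using q by (simp add: eval_nat_numeral) (simp add: field_simps)
qed

text \<open>Fitted to the residues of \<open>ler 4\<close>: at q^5 and q^(-5) the first product
  vanishes, at q^10 and q^(-10) the second, so the two coefficients can be read off independently.
  The factor 1/u gives \<open>Th u / jfun u tt\<close> the multiplier -(q^25) u^3 of the Lerch
  sum.\<close>

definition Th :: "complex \<Rightarrow> complex" where
  "Th u = q ^ 6 * XX ^ 3 / (jj1 * jj2) * (1 / u) *
     (jj (tt ^ 1 * u) * jj (u / tt ^ 1) - q ^ 3 * (jj (tt ^ 2 * u) * jj (u / tt ^ 2)))"

lemma Th_holomorphic: "Th holomorphic_on - {0}"
  unfolding Th_def using q_powers j5_nonzero[OF q_powers(1,2)] t5[OF q_powers(1,2)] by (intro holomorphic_intros) auto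

lemma Th_values:
  "Th tt = XX ^ 3 / q" "Th (1 / tt) = XX ^ 3 / q" "Th (tt ^ 2) = XX ^ 3 / q ^ 4" "Th (1 / tt ^ 2) = XX ^ 3 / q ^ 4"
  unfolding Th_def power_one_right j5_product_values[OF q_powers(1,2)]
  using j5_nonzero[OF q_powers(1,2)] q by (simp_all add: field_simps flip: power_mult power_add power_Suc)

text \<open>The difference of the two sides, multiplied by \<open>jfun u (q ^ 25)\<close>, is quasi-periodic of negative
  degree, and the theta function \<open>Th\<close> is chosen so that its poles at \<open>q\<^bsup>\<plusminus>5\<^esup>\<close> and \<open>q\<^bsup>\<plusminus>10\<^esup>\<close> cancel.\<close>

theorem lerch_dissection:
  assumes u: "u \<in> off_powers tt"
  shows "ler 4 u = - (qq / q) * rank_fun u (tt ^ 5) + Th u / jfun u tt"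
proof -
  note tq = q_powers(1,2)
  note p = t5[OF tq]
  define f where "f = (\<lambda>u. (ler 4 u + qq / q * rank_fun u (tt ^ 5) - Th u / jfun u tt) * jj u)"
  have "f u = 0"
  proof (rule quasiperiodic_remove_sings_eq_0[where f = f and t = tt and z = u and m = 5 and l = "-2" and C = "tt ^ 5" and d = 2])
    have sub: "off_powers tt \<subseteq> - {0}" "off_powers tt \<subseteq> off_powers (tt ^ 5)"
      using off_powers_5[OF tq] by (auto simp: off_powers_def)
    have "ler 4 holomorphic_on off_powers tt"
      unfolding ler_def[abs_def] by (rule lerch_holomorphic) (use q_powers q in auto)
    moreover have "(\<lambda>u. rank_fun u (tt ^ 5)) holomorphic_on off_powers tt"
      by (rule holomorphic_on_subset[OF rank_fun_holomorphic[OF p] sub(2)])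
    ultimately show "f holomorphic_on off_powers tt"
      unfolding f_def using tq p sub holomorphic_on_subset[OF Th_holomorphic sub(1)]
      by (intro holomorphic_intros) (auto simp: off_powers_conv_jfun)
  next
    fix z assume zoff: "z \<in> off_powers tt"
    hence z: "z \<noteq> 0" "jfun z tt \<noteq> 0" using tq by (auto simp: off_powers_conv_jfun)
    have 1: "ler 4 (tt ^ 5 * z) = - (tt ^ 5) * z ^ 3 * ler 4 z - qq / q * (1 - tt ^ 5 * z ^ 2)"
      by (rule ler_period[OF zoff])
    have 2: "rank_fun (tt ^ 5 * z) (tt ^ 5) = 1 - tt ^ 5 * z ^ 2 - tt ^ 5 * z ^ 3 * rank_fun z (tt ^ 5)"
      by (rule rank_fun_rec[OF p off_powers_5[OF tq zoff]])
    have 3: "Th (tt ^ 5 * z) = Th z / (tt ^ 5 * z ^ 2)"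
      unfolding Th_def j5_period[OF tq z(1)] using z tq by (simp add: field_simps)
    have 4: "jfun (tt ^ 5 * z) tt = - jfun z tt / (tt ^ 10 * z ^ 5)"
      by (rule jfun_period5[OF tq z(1)])
    have 5: "jj (tt ^ 5 * z) = - jj z / z" by (rule jfun_rec[OF p z(1)])
    have 6: "Th z / (tt ^ 5 * z ^ 2) / (- jfun z tt / (tt ^ 10 * z ^ 5)) = - (tt ^ 5) * z ^ 3 * (Th z / jfun z tt)"
      using z tq by (simp add: field_simps)
    show "f (tt ^ 5 * z) = tt ^ 5 * z ^ 2 * f z"
    proof -
      \<comment> \<open>The inhomogeneous terms of the Lerch sum and of the rank function cancel.
        The homogeneous multiplier -P z^3 is common to all three parts, and the factor -1/z of J
        turns it into P z^2.\<close>
      have "(- P * z ^ 3 * S - c * (1 - P * z ^ 2) + c * (1 - P * z ^ 2 - P * z ^ 3 * R) - - P * z ^ 3 * T) * (- J / z)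
          = P * z ^ 2 * ((S + c * R - T) * J)" for P S c R T J
        using z(1) by (simp add: divide_simps) (simp add: algebra_simps power2_eq_square power3_eq_cube)
      thus ?thesis unfolding f_def 1 2 3 4 5 6 .
    qed
  next
    fix k :: int assume "- 2 \<le> k" "k < - 2 + int 5"
    hence k: "k \<in> {-2, -1, 0, 1, 2}" by (rule int_between_2)
    let ?a = "tt powi k"
    have a: "?a \<noteq> 0" using tq by simp
    have hol: "jj holomorphic_on - {0}" "(\<lambda>u. rank_num u (tt ^ 5)) holomorphic_on - {0}"
      using p by (auto intro!: holomorphic_intros rank_num_holomorphic)
    have cont: "isCont jj ?a" "isCont (\<lambda>u. rank_num u (tt ^ 5)) ?a"
      using hol[THEN holomorphic_on_imp_continuous_on] a by (auto simp: continuous_on_eq_continuous_at open_Compl)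
    define L where "L = - ?a * theta_term (q powi 4) (q ^ 3) (- k) - (- ?a * theta_term 1 tt k / XX ^ 3 * Th ?a)"
    have L1: "((\<lambda>w. (w - ?a) * ler 4 w) \<longlongrightarrow> - ?a * theta_term (q powi 4) (q ^ 3) (- k)) (at ?a)"
      using lerch_residue[of "q ^ 3" "q powi 4" tt "- k"] q q_powers by (simp add: ler_def)
    have L2: "((\<lambda>w. (w - ?a) * (Th w / jfun w tt)) \<longlongrightarrow> - ?a * theta_term 1 tt k / XX ^ 3 * Th ?a) (at ?a)"
      by (rule theta_quotient_limit[OF tq Th_holomorphic])
    have "((\<lambda>w. ((w - ?a) * ler 4 w - (w - ?a) * (Th w / jfun w tt)) * jj w +
        (w - ?a) * (qq / q * (rank_num w (tt ^ 5) * qpoch_inf (tt ^ 5) (tt ^ 5)))) \<longlongrightarrow>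
        L * jj ?a + (?a - ?a) * (qq / q * (rank_num ?a (tt ^ 5) * qpoch_inf (tt ^ 5) (tt ^ 5)))) (at ?a)"
      unfolding L_def
      by (rule tendsto_add[OF tendsto_mult[OF tendsto_diff[OF L1 L2] isContD[OF cont(1)]]
            tendsto_mult[OF tendsto_diff[OF tendsto_ident_at tendsto_const]
              tendsto_mult[OF tendsto_const tendsto_mult[OF isContD[OF cont(2)] tendsto_const]]]])
    \<comment> \<open>At k = 0 the pole is removed by the zero of jj at 1; at the other four
      exponents L itself is 0, which is the choice of \<open>Th\<close>.\<close>
    moreover have "L * jj ?a = 0"
    proof (cases "k = 0")
      case True
      thus ?thesis using jfun_1[OF p(1)] by simp
    next
      case False
      have Th10: "Th (q ^ 10) = XX ^ 3 / q ^ 4" "Th (1 / q ^ 10) = XX ^ 3 / q ^ 4"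
        using Th_values(3,4) by (simp_all flip: power_mult)
      have "theta_term (q powi 4) (q ^ 3) (- k) = theta_term 1 tt k / XX ^ 3 * Th ?a"
        using k False qpoch_self_nonzero[OF tq(1)] q
        by (elim insertE emptyE)
          (simp_all add: theta_term_def power_int_minus_divide Th_values Th10 field_simps flip: power_mult power_add power_Suc)
      thus ?thesis by (simp add: L_def)
    qed
    moreover have "eventually (\<lambda>w. ((w - ?a) * ler 4 w - (w - ?a) * (Th w / jfun w tt)) * jj w +
        (w - ?a) * (qq / q * (rank_num w (tt ^ 5) * qpoch_inf (tt ^ 5) (tt ^ 5))) = (w - ?a) * f w) (at ?a)"
      using eventually_off_powers[OF tq a]
    proof eventually_elim
      case (elim w)
      have w: "w \<in> off_powers (tt ^ 5)" by (rule off_powers_5[OF tq elim])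
      have "(w - ?a) * f w = ((w - ?a) * ler 4 w - (w - ?a) * (Th w / jfun w tt)) * jj w +
        (w - ?a) * (qq / q * (rank_fun w (tt ^ 5) * jj w))"
        by (simp add: f_def algebra_simps)
      also have "rank_fun w (tt ^ 5) * jj w = rank_num w (tt ^ 5) * qpoch_inf (tt ^ 5) (tt ^ 5)"
        by (rule rank_fun_mult_jfun[OF p w])
      finally show ?case ..
    qed
    ultimately show "((\<lambda>w. (w - ?a) * f w) \<longlongrightarrow> 0) (at ?a)"
      by (auto intro: Lim_transform_eventually)
  qed (use tq u in auto)
  moreover have "jj u \<noteq> 0"
    using off_powers_5[OF tq u] p by (simp add: off_powers_conv_jfun)
  ultimately have "ler 4 u + qq / q * rank_fun u (tt ^ 5) - Th u / jfun u tt = 0"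
    unfolding f_def mult_eq_0_iff by blast
  thus ?thesis by (simp add: algebra_simps)
qed

section \<open>Evaluation of the two sums over nonzero n as limits at u = 1\<close>

definition reg :: "int \<Rightarrow> complex" where
  "reg e = lerch_reg (q ^ 3) (q powi e) tt 0 1"

text \<open>The pole of the theta part K/(1 - u) is compensated by 1/(1 - u), as K 1 = 1; the
  difference quotient leaves -D.\<close>

lemma limit_compare:
  fixes A R K :: "complex \<Rightarrow> complex"
  assumes "isCont A 1" "isCont R 1" "(K has_field_derivative D) (at 1)" "K 1 = 1"
    "eventually (\<lambda>u. A u = R u + (K u - 1) / (1 - u)) (at 1)"
  shows "A 1 = R 1 - D"
proof -
  have "((\<lambda>u. R u - (K u - K 1) / (u - 1)) \<longlongrightarrow> R 1 - D) (at 1)"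
    using assms(2,3) by (intro tendsto_diff) (auto simp: isCont_def has_field_derivative_iff)
  moreover have "eventually (\<lambda>u. R u - (K u - K 1) / (u - 1) = A u) (at 1)"
    using assms(5)
  proof eventually_elim
    case (elim u)
    have "x / (u - 1) = - (x / (1 - u))" for x by (metis minus_diff_eq minus_divide_right)
    thus ?case by (simp add: elim assms(4))
  qed
  ultimately have "(A \<longlongrightarrow> R 1 - D) (at 1)" by (rule Lim_transform_eventually)
  moreover have "(A \<longlongrightarrow> A 1) (at 1)" using assms(1) by (simp add: isCont_def)
  ultimately show ?thesis using tendsto_unique[of "at 1" A] by simp
qed

lemma ler_conv_reg:
  assumes "u \<in> off_powers tt"
  shows "ler e u = 1 / (1 - u) + lerch_reg (q ^ 3) (q powi e) tt 0 u"
  unfolding ler_def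
  by (subst lerch_conv_reg[where m = 0]) (use assms q q_powers in auto)

lemma lerch_reg_isCont_1: "isCont (lerch_reg (q ^ 3) (q powi e) tt 0) 1"
  using lerch_reg_isCont[of "q ^ 3" "q powi e" tt 0] q q_powers by simp

lemma rank_fun_isCont:
  assumes "\<not> 5 dvd k"
  shows "isCont (\<lambda>u. rank_fun (tt ^ k * u) (tt ^ 5)) 1"
proof -
  have "tt ^ k \<in> off_powers (tt ^ 5)"
  proof -
    have "tt ^ k \<noteq> (tt ^ 5) powi n" for n
    proof
      assume "tt ^ k = (tt ^ 5) powi n"
      also have "(tt ^ 5) powi n = tt powi (5 * n)" using power_int_mult[of tt 5 n] by simp
      finally have "tt powi (int k - 5 * n) = 1" using q_powers by (simp add: power_int_diff)
      hence "int k = 5 * n" using powi_neq_1[OF q_powers(1,2), of "int k - 5 * n"] by auto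
      hence "5 dvd int k" by simp
      thus False using assms by presburger
    qed
    thus ?thesis using q by (simp add: off_powers_def)
  qed
  moreover have "open (off_powers (tt ^ 5))" by (rule open_off_powers[OF t5[OF q_powers(1,2)]])
  ultimately have "isCont (\<lambda>u. rank_fun u (tt ^ 5)) (tt ^ k * 1)"
    using holomorphic_on_imp_continuous_on[OF rank_fun_holomorphic[OF t5[OF q_powers(1,2)]]]
    by (auto simp: continuous_on_eq_continuous_at)
  moreover have "isCont (\<lambda>u. tt ^ k * u) 1" by (intro continuous_intros)
  ultimately show ?thesis using isCont_o2[of 1 "\<lambda>u. tt ^ k * u" "\<lambda>u. rank_fun u (tt ^ 5)"] by blast
qed

abbreviation (input) "l1 \<equiv> lam1 tt"
abbreviation (input) "l2 \<equiv> lam2 tt"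
abbreviation (input) "JJ \<equiv> qpoch_inf (tt ^ 5) (tt ^ 5)"

text \<open>At 1 the function \<open>jred\<close> has value XX^3 and derivative 0, so dividing by it
  does not affect the first derivative after normalisation.\<close>

lemma jred_quotient_deriv:
  assumes "(G has_field_derivative D) (at 1)"
  shows "((\<lambda>u. XX ^ 3 * G u / jred u tt) has_field_derivative D) (at 1)"
proof -
  have "XX \<noteq> 0" by (rule qpoch_self_nonzero[OF q_powers(1)])
  thus ?thesis using assms deriv_jred_1[OF q_powers(1)]
    by (auto intro!: derivative_eq_intros simp: jred_1 field_simps power2_eq_square)
qed

text \<open>The dissection at q^5 u as u tends to 1: one shift and one partial fraction step lead
  from e = 4 through 1 to 6.\<close>

lemma reg_6_lam: "reg 6 = qq * (rank_fun tt (tt ^ 5) - 1) + q ^ 2 * JJ ^ 3 / jj1 + l1 + l2"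
proof -
  note tq = q_powers(1,2)
  note nz = j5_nonzero[OF tq]
  have jj1': "jj 1 = 0" "jfun 1 (q ^ 25) = 0" using jfun_1[OF t5(1)[OF tq]] by simp_all
  define c where "c = q ^ 2 / (jj1 * jj2)"
  define d where "d = 1 / q ^ 2"
  define G where "G = (\<lambda>u. c * (jj (tt ^ 2 * u) * jj u + d * u * (jj (tt ^ 2 * (1 / u)) * jj (tt * (1 / u)))))"
  define K where "K = (\<lambda>u. XX ^ 3 * G u / jred u tt)"
  have X: "XX \<noteq> 0" by (rule qpoch_self_nonzero[OF tq(1)])
  have "(G has_field_derivative c * (jj2 * - (JJ ^ 3) + d * (jj2 * jj1 - l2 * jj2 * jj1 - jj2 * (l1 * jj1)))) (at 1)"
    unfolding G_def by (rule derivative_eq_intros j5_derivs[OF tq] refl)+ (simp add: jj1' q algebra_simps)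
  hence K: "(K has_field_derivative c * (jj2 * - (JJ ^ 3) + d * (jj2 * jj1 - l2 * jj2 * jj1 - jj2 * (l1 * jj1)))) (at 1)"
    unfolding K_def by (rule jred_quotient_deriv)
  have R1: "1 * lerch_reg (q ^ 3) (q powi 6) tt 0 1 = (1 - qq + qq * rank_fun (tt ^ 1 * 1) (tt ^ 5))
     - c * (jj2 * - (JJ ^ 3) + d * (jj2 * jj1 - l2 * jj2 * jj1 - jj2 * (l1 * jj1)))"
  \<comment> \<open>R collects the terms regular at 1; its summand 1 comes from -u/(1 - u) = 1 -
    1/(1 - u).\<close>
  proof (rule limit_compare[where A = "\<lambda>u. u * lerch_reg (q ^ 3) (q powi 6) tt 0 u" and
        R = "\<lambda>u. 1 - qq + qq * rank_fun (tt ^ 1 * u) (tt ^ 5)", OF _ _ K])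
    show "isCont (\<lambda>u. u * lerch_reg (q ^ 3) (q powi 6) tt 0 u) 1"
      by (intro continuous_intros lerch_reg_isCont_1)
    show "isCont (\<lambda>u. 1 - qq + qq * rank_fun (tt ^ 1 * u) (tt ^ 5)) 1"
      by (intro continuous_intros rank_fun_isCont) simp
    show "K 1 = 1"
      \<comment> \<open>At u = 1 the first product in G vanishes with jj 1; c and d are the
        constants for which the second one then gives exactly 1.\<close>
      using X nz q by (simp add: K_def G_def jred_1 jj1' c_def d_def)
    show "eventually (\<lambda>u. u * lerch_reg (q ^ 3) (q powi 6) tt 0 u =
        1 - qq + qq * rank_fun (tt ^ 1 * u) (tt ^ 5) + (K u - 1) / (1 - u)) (at 1)"
      using eventually_off_powers[OF tq one_neq_zero] eventually_neq_at_within[of 1 1 UNIV]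
    proof eventually_elim
      case (elim u)
      have u: "u \<noteq> 0" "1 - u \<noteq> 0" "jred u tt \<noteq> 0"
        using elim jfun_conv_jred[OF tq(1), of u] tq by (auto simp: off_powers_conv_jfun)
      have tu: "tt * u \<in> off_powers tt" using off_powers_mult_iff[OF tq(2), of 1 u] elim by simp
      have e: "tt ^ 1 * (tt * u) = tt ^ 2 * u" "tt * u / tt ^ 1 = u" "tt ^ 2 * (tt * u) = tt ^ 3 * u" "tt * u / tt ^ 2 = u / tt"
        using tq by (simp_all add: eval_nat_numeral)
      have "ler 4 (tt * u) = - (1 / q) * (u * (1 / (1 - u) + lerch_reg (q ^ 3) (q powi 6) tt 0 u) + qq)"
        using ler_rec[OF elim(1), of 4] ler_diff[OF elim(1), of 1] ler_conv_reg[OF elim(1), of 6] jfun_q3_values(1)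
        by (simp add: power_int_minus_divide)
      moreover have "Th (tt * u) = q ^ 4 * XX ^ 3 / (tt * u) * G u"
      proof -
        have "r4 * r2 * X / D * (1 / w) * (P - r3 * (M * (- (u / (r3 * r2)) * N))) = r4 * X / w * (r2 / D * (P + 1 / r2 * u * (M * N)))"
          if "r2 \<noteq> 0" "r3 \<noteq> 0" for X D w P M N r2 r3 r4 :: complex
          using that by (simp add: field_simps)
        from this[of "q ^ 2" "q ^ 3" "q ^ 4"] have "q ^ 6 * X / D * (1 / w) * (P - q ^ 3 * (M * (- (u / q ^ 5) * N))) =
            q ^ 4 * X / w * (q ^ 2 / D * (P + 1 / q ^ 2 * u * (M * N)))" for X D w P M N
          using q(2) by (simp flip: power_add)
        thus ?thesis unfolding Th_def e j5_reflections[OF tq u(1)] G_def c_def d_def .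
      qed
      moreover have "jfun (tt * u) tt = - ((1 - u) * jred u tt) / u"
        using jfun_rec[OF tq u(1)] jfun_conv_jred[OF tq(1), of u] by simp
      moreover have "q ^ 4 * XX ^ 3 / (tt * u) * G u / (- ((1 - u) * jred u tt) / u) = - (1 / q) * (K u / (1 - u))"
      proof -
        have "q ^ 4 * X / (q ^ 5 * u) * g / (- (v * r) / u) = - (1 / q) * (X * g / r / v)" if "v \<noteq> 0" "r \<noteq> 0" for X g v r
          using q(2) u(1) that by (simp add: divide_simps) (simp add: eval_nat_numeral)
        thus ?thesis unfolding K_def using u by blast
      qed
      ultimately have "- (1 / q) * (u * (1 / (1 - u) + lerch_reg (q ^ 3) (q powi 6) tt 0 u) + qq) =
          - (qq / q) * rank_fun (tt * u) (tt ^ 5) + - (1 / q) * (K u / (1 - u))"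
        using lerch_dissection[OF tu] by argo
      also have "- (qq / q) * r + - (1 / q) * k = - (1 / q) * (qq * r + k)" for r k
        by (simp add: algebra_simps add_divide_distrib)
      finally have "u * (1 / (1 - u) + lerch_reg (q ^ 3) (q powi 6) tt 0 u) + qq =
          qq * rank_fun (tt * u) (tt ^ 5) + K u / (1 - u)"
        using q by simp
      thus ?case using u by (simp add: field_simps)
    qed
  qed
  have R2: "c * (jj2 * - (JJ ^ 3) + d * (jj2 * jj1 - l2 * jj2 * jj1 - jj2 * (l1 * jj1)))
     = 1 - l1 - l2 - q ^ 2 * JJ ^ 3 / jj1"
    unfolding c_def d_def using nz q by (simp add: divide_simps) (simp add: algebra_simps)
  show ?thesis using R1 unfolding R2 reg_def by (simp add: algebra_simps)
qed

text \<open>The dissection at q^10 u as u tends to 1: two shifts lead from e = 4 through 1 to -2,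
  one partial fraction step to 3.\<close>

lemma reg_3_lam: "reg 3 = qq / q ^ 2 * (1 - rank_fun (tt ^ 2) (tt ^ 5)) - q ^ 3 * JJ ^ 3 / jj2 - l1 + l2"
proof -
  note tq = q_powers(1,2)
  note nz = j5_nonzero[OF tq]
  have jj1': "jj 1 = 0" "jfun 1 (q ^ 25) = 0" using jfun_1[OF t5(1)[OF tq]] by simp_all
  define c where "c = 1 / (jj1 * jj2)"
  define G where "G = (\<lambda>u. c * (u * (jj (tt ^ 2 * (1 / u)) * jj (tt * u) - q ^ 3 * (jj (tt * (1 / u)) * jj u))))"
  define K where "K = (\<lambda>u. XX ^ 3 * G u / jred u tt)"
  have X: "XX \<noteq> 0" by (rule qpoch_self_nonzero[OF tq(1)])
  have "(G has_field_derivative c * (jj2 * jj1 + (jj2 * (l1 * jj1) - l2 * jj2 * jj1 + q ^ 3 * jj1 * JJ ^ 3))) (at 1)"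
    unfolding G_def by (rule derivative_eq_intros j5_derivs[OF tq] refl)+ (simp add: jj1' q algebra_simps)
  hence K: "(K has_field_derivative c * (jj2 * jj1 + (jj2 * (l1 * jj1) - l2 * jj2 * jj1 + q ^ 3 * jj1 * JJ ^ 3))) (at 1)"
    unfolding K_def by (rule jred_quotient_deriv)
  have R1: "1 * lerch_reg (q ^ 3) (q powi 3) tt 0 1 = (1 + qq / q ^ 2 * (1 - rank_fun (tt ^ 2 * 1) (tt ^ 5)))
     - c * (jj2 * jj1 + (jj2 * (l1 * jj1) - l2 * jj2 * jj1 + q ^ 3 * jj1 * JJ ^ 3))"
  proof (rule limit_compare[where A = "\<lambda>u. u * lerch_reg (q ^ 3) (q powi 3) tt 0 u" and
        R = "\<lambda>u. 1 + qq / q ^ 2 * (1 - rank_fun (tt ^ 2 * u) (tt ^ 5))", OF _ _ K])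
    show "isCont (\<lambda>u. u * lerch_reg (q ^ 3) (q powi 3) tt 0 u) 1"
      by (intro continuous_intros lerch_reg_isCont_1)
    show "isCont (\<lambda>u. 1 + qq / q ^ 2 * (1 - rank_fun (tt ^ 2 * u) (tt ^ 5))) 1"
      by (intro continuous_intros rank_fun_isCont) simp
    show "K 1 = 1"
      using X nz q by (simp add: K_def G_def jred_1 jj1' c_def)
    show "eventually (\<lambda>u. u * lerch_reg (q ^ 3) (q powi 3) tt 0 u =
        1 + qq / q ^ 2 * (1 - rank_fun (tt ^ 2 * u) (tt ^ 5)) + (K u - 1) / (1 - u)) (at 1)"
      using eventually_off_powers[OF tq one_neq_zero] eventually_neq_at_within[of 1 1 UNIV]
    proof eventually_elim
      case (elim u)
      have u: "u \<noteq> 0" "1 - u \<noteq> 0" "jred u tt \<noteq> 0"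
        using elim jfun_conv_jred[OF tq(1), of u] tq by (auto simp: off_powers_conv_jfun)
      have tu: "tt * u \<in> off_powers tt" using off_powers_mult_iff[OF tq(2), of 1 u] elim by simp
      have ttu: "tt ^ 2 * u \<in> off_powers tt" using off_powers_mult_iff[OF tq(2), of 2 u] elim by simp
      have tte: "tt ^ 2 * u = tt * (tt * u)" by (simp add: power2_eq_square mult_ac)
      have e: "tt ^ 1 * (tt ^ 2 * u) = tt ^ 3 * u" "tt ^ 2 * u / tt ^ 1 = tt * u" "tt ^ 2 * (tt ^ 2 * u) = tt ^ 4 * u" "tt ^ 2 * u / tt ^ 2 = u"
        using tq by (simp_all add: eval_nat_numeral)
      have "ler 4 (tt ^ 2 * u) = q * (u * (1 / (1 - u) + lerch_reg (q ^ 3) (q powi 3) tt 0 u) - qq / q ^ 2)"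
        using ler_rec[OF tu, of 4] ler_rec[OF elim(1), of 1] ler_diff[OF elim(1), of "-2"] ler_conv_reg[OF elim(1), of 3]
          jfun_q3_values(3) q unfolding tte
        by (simp add: power_int_minus_divide power2_eq_square)
      moreover have "Th (tt ^ 2 * u) = q ^ 6 * XX ^ 3 / (tt ^ 2 * u) * (G u / u)"
        unfolding Th_def e j5_reflections[OF tq u(1)] G_def c_def using u(1) by simp
      moreover have "jfun (tt ^ 2 * u) tt = (1 - u) * jred u tt / (tt * u ^ 2)"
        unfolding tte using jfun_rec[OF tq, of "tt * u"] jfun_rec[OF tq u(1)] jfun_conv_jred[OF tq(1), of u] u tq
        by (simp add: power2_eq_square)
      moreover have "q ^ 6 * XX ^ 3 / (tt ^ 2 * u) * (G u / u) / ((1 - u) * jred u tt / (tt * u ^ 2)) = q * (K u / (1 - u))"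
      proof -
        have "q ^ 6 * X / ((q ^ 5) ^ 2 * u) * (g / u) / (v * r / (q ^ 5 * u ^ 2)) = q * (X * g / r / v)" if "v \<noteq> 0" "r \<noteq> 0" for X g v r
          using q(2) u(1) that by (simp add: divide_simps) (simp add: eval_nat_numeral)
        thus ?thesis unfolding K_def using u by blast
      qed
      ultimately have "q * (u * (1 / (1 - u) + lerch_reg (q ^ 3) (q powi 3) tt 0 u) - qq / q ^ 2) =
          - (qq / q) * rank_fun (tt ^ 2 * u) (tt ^ 5) + q * (K u / (1 - u))"
        using lerch_dissection[OF ttu] by argo
      also have "- (qq / q) * r + q * k = q * (- (qq / q ^ 2) * r + k)" for r k
        using q(2) by (simp add: field_simps power2_eq_square)
      finally have "q * (u * (1 / (1 - u) + lerch_reg (q ^ 3) (q powi 3) tt 0 u) - qq / q ^ 2) =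
          q * (- (qq / q ^ 2) * rank_fun (tt ^ 2 * u) (tt ^ 5) + K u / (1 - u))" .
      hence "u * (1 / (1 - u) + lerch_reg (q ^ 3) (q powi 3) tt 0 u) - qq / q ^ 2 =
          - (qq / q ^ 2) * rank_fun (tt ^ 2 * u) (tt ^ 5) + K u / (1 - u)"
        using q by simp
      hence "u * lerch_reg (q ^ 3) (q powi 3) tt 0 u = qq / q ^ 2 * (1 - rank_fun (tt ^ 2 * u) (tt ^ 5)) + (K u / (1 - u) - u / (1 - u))"
        by (simp add: algebra_simps)
      also have "K u / (1 - u) - u / (1 - u) = 1 + (K u - 1) / (1 - u)"
        using u by (simp add: divide_simps)
      finally show ?case by simp
    qed
  qed
  have R2: "c * (jj2 * jj1 + (jj2 * (l1 * jj1) - l2 * jj2 * jj1 + q ^ 3 * jj1 * JJ ^ 3))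
     = 1 + l1 - l2 + q ^ 3 * JJ ^ 3 / jj2"
    unfolding c_def using nz q by (simp add: divide_simps) (simp add: algebra_simps)
  show ?thesis using R1 unfolding R2 reg_def by (simp add: algebra_simps)
qed

abbreviation (input) "AA \<equiv> jfun (q ^ 10) (q ^ 25)"
abbreviation (input) "BB \<equiv> q * jfun (q ^ 5) (q ^ 25)"

text \<open>The logarithmic derivatives are eliminated. The constants are 2/5 = 3/10 + 1/10 and -1/5
  = -3/10 + 1/10, the rational parts of l1 + l2 and l2 - l1.\<close>

lemma reg_values:
  "reg 6 = qq * (q ^ 5 * gmock (q ^ 5) (q ^ 25)) + (2 / 5 + (- 2 * AA ^ 5 + 5 * AA ^ 3 * BB ^ 2 + BB ^ 5) / (5 * XX ^ 3))"
  "reg 3 = - (qq * (q ^ 8 * gmock (q ^ 10) (q ^ 25))) + (- 1 / 5 + (AA ^ 5 - 5 * AA ^ 2 * BB ^ 3 + 2 * BB ^ 5) / (5 * XX ^ 3))"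
proof -
  note tq = q_powers(1,2)
  have e: "tt ^ 5 = q ^ 25" "tt ^ 2 = q ^ 10" by (simp_all flip: power_mult)
  note nz = j5_nonzero[OF tq, unfolded e]
  have X: "XX \<noteq> 0" by (rule qpoch_self_nonzero[OF tq(1)])
  define J where "J = qpoch_inf (q ^ 25) (q ^ 25)"
  define a where "a = jfun (q ^ 10) (q ^ 25)"
  define b where "b = jfun (q ^ 5) (q ^ 25)"
  have ab: "a \<noteq> 0" "b \<noteq> 0" using nz by (auto simp: a_def b_def)
  \<comment> \<open>The product formula removes the third theta constant, so that everything becomes
    a form in a and q b over XX^3.\<close>
  have J: "J = a * b / XX"
    using j5_prod[OF tq] X unfolding e a_def b_def J_def by (simp add: field_simps)
  have "3 * l1 + l2 = 1 - a ^ 2 * J ^ 3 / b ^ 3" "3 * l2 - l1 = tt * b ^ 2 * J ^ 3 / a ^ 3"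
    using lam_relations[OF tq] unfolding e a_def b_def J_def by simp_all
  hence 1: "3 * l1 + l2 = 1 - a ^ 5 / XX ^ 3" "3 * l2 - l1 = (q * b) ^ 5 / XX ^ 3"
    unfolding J using ab by (simp_all add: field_simps flip: power_add)
  have l: "l1 = (3 - 3 * (a ^ 5 / XX ^ 3) - (q * b) ^ 5 / XX ^ 3) / 10" "l2 = (1 - a ^ 5 / XX ^ 3 + 3 * ((q * b) ^ 5 / XX ^ 3)) / 10"
  proof -
    \<comment> \<open>The linear system with rows (3, 1) and (-1, 3) has determinant 10.\<close>
    have "10 * l1 = 3 - 3 * (a ^ 5 / XX ^ 3) - (q * b) ^ 5 / XX ^ 3" "10 * l2 = 1 - a ^ 5 / XX ^ 3 + 3 * ((q * b) ^ 5 / XX ^ 3)"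
      using 1 by algebra+
    thus "l1 = (3 - 3 * (a ^ 5 / XX ^ 3) - (q * b) ^ 5 / XX ^ 3) / 10" "l2 = (1 - a ^ 5 / XX ^ 3 + 3 * ((q * b) ^ 5 / XX ^ 3)) / 10"
      by (simp_all add: mult.commute[of _ 10])
  qed
  have rf: "rank_fun x q' - 1 = x * gmock x q'" if "x \<noteq> 0" for x q'
    using that by (simp add: gmock_conv_rank_fun)
  have "reg 6 = qq * (tt * gmock tt (q ^ 25)) + q ^ 2 * J ^ 3 / b + l1 + l2"
    using reg_6_lam rf[OF tq(2)] unfolding e J_def b_def by simp
  also have "q ^ 2 * J ^ 3 / b = a ^ 3 * (q * b) ^ 2 / XX ^ 3"
    unfolding J using ab by (simp add: field_simps) (simp add: eval_nat_numeral)
  finally have F6: "reg 6 = qq * (q ^ 5 * gmock (q ^ 5) (q ^ 25)) + a ^ 3 * (q * b) ^ 2 / XX ^ 3 + l1 + l2" .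
  show "reg 6 = qq * (q ^ 5 * gmock (q ^ 5) (q ^ 25)) + (2 / 5 + (- 2 * AA ^ 5 + 5 * AA ^ 3 * BB ^ 2 + BB ^ 5) / (5 * XX ^ 3))"
    proof -
    have "g + A * C / x + (3 - 3 * (A5 / x) - B5 / x) / 10 + (1 - A5 / x + 3 * (B5 / x)) / 10
      = g + (2 / 5 + (- 2 * A5 + 5 * A * C + B5) / (5 * x))" if "x \<noteq> 0" for g A C x A5 B5 :: complex
      using that by (simp add: field_simps)
    moreover have "XX ^ 3 \<noteq> 0" using X by simp
    moreover note F6
    ultimately show ?thesis unfolding l a_def[symmetric] b_def[symmetric] by presburger
  qed
  have "reg 3 = - (qq / q ^ 2 * (q ^ 10 * gmock (q ^ 10) (q ^ 25))) - q ^ 3 * J ^ 3 / a - l1 + l2"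
  proof -
    have "1 - rank_fun (q ^ 10) (q ^ 25) = - (q ^ 10 * gmock (q ^ 10) (q ^ 25))"
      using rf[of "q ^ 10" "q ^ 25"] q by (simp add: algebra_simps)
    thus ?thesis using reg_3_lam unfolding e J_def a_def by simp
  qed
  also have "qq / q ^ 2 * (q ^ 10 * gmock (q ^ 10) (q ^ 25)) = qq * (q ^ 8 * gmock (q ^ 10) (q ^ 25))"
    using q by (simp add: field_simps)
  also have "q ^ 3 * J ^ 3 / a = a ^ 2 * (q * b) ^ 3 / XX ^ 3"
    unfolding J using ab by (simp add: field_simps) (simp add: eval_nat_numeral)
  finally have F3: "reg 3 = - (qq * (q ^ 8 * gmock (q ^ 10) (q ^ 25))) - a ^ 2 * (q * b) ^ 3 / XX ^ 3 - l1 + l2" .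
  show "reg 3 = - (qq * (q ^ 8 * gmock (q ^ 10) (q ^ 25))) + (- 1 / 5 + (AA ^ 5 - 5 * AA ^ 2 * BB ^ 3 + 2 * BB ^ 5) / (5 * XX ^ 3))"
    proof -
    have "- g - A * C / x - (3 - 3 * (A5 / x) - B5 / x) / 10 + (1 - A5 / x + 3 * (B5 / x)) / 10
      = - g + (- 1 / 5 + (A5 - 5 * A * C + 2 * B5) / (5 * x))" if "x \<noteq> 0" for g A C x A5 B5 :: complex
      using that by (simp add: field_simps)
    moreover have "XX ^ 3 \<noteq> 0" using X by simp
    moreover note F3
    ultimately show ?thesis unfolding l a_def[symmetric] b_def[symmetric] by presburger
  qed
qed

end

section \<open>Generating functions of partition statistics\<close>

lemma bij_betw_insert_multiset:
  assumes "a \<notin> A"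
  shows "bij_betw (\<lambda>(n, p). p + replicate_mset n a) (UNIV \<times> {p. set_mset p \<subseteq> A}) {p. set_mset p \<subseteq> insert a A}"
proof (rule bij_betw_byWitness[where f' = "\<lambda>p. (count p a, filter_mset (\<lambda>x. x \<noteq> a) p)"])
  show "\<forall>np\<in>UNIV \<times> {p. set_mset p \<subseteq> A}. (\<lambda>p. (count p a, filter_mset (\<lambda>x. x \<noteq> a) p))
      (case np of (n, p) \<Rightarrow> p + replicate_mset n a) = np"
  proof (rule ballI)
    fix np assume "np \<in> (UNIV :: nat set) \<times> {p. set_mset p \<subseteq> A}"
    then obtain n p where np: "np = (n, p)" "set_mset p \<subseteq> A" by auto
    hence "a \<notin># p" using assms by auto
    hence "count p a = 0" "filter_mset (\<lambda>x. x \<noteq> a) p = p"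
      by (auto simp: not_in_iff multiset_eq_iff)
    thus "(\<lambda>p. (count p a, filter_mset (\<lambda>x. x \<noteq> a) p)) (case np of (n, p) \<Rightarrow> p + replicate_mset n a) = np"
      using np by (simp add: multiset_eq_iff)
  qed
  show "\<forall>p\<in>{p. set_mset p \<subseteq> insert a A}. (case (count p a, filter_mset (\<lambda>x. x \<noteq> a) p) of (n, p) \<Rightarrow> p + replicate_mset n a) = p"
    by (auto simp: multiset_eq_iff)
  show "(\<lambda>(n, p). p + replicate_mset n a) ` (UNIV \<times> {p. set_mset p \<subseteq> A}) \<subseteq> {p. set_mset p \<subseteq> insert a A}"
    by (auto simp: subset_iff split: if_splits)
  show "(\<lambda>p. (count p a, filter_mset (\<lambda>x. x \<noteq> a) p)) ` {p. set_mset p \<subseteq> insert a A} \<subseteq> UNIV \<times> {p. set_mset p \<subseteq> A}"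
    by auto
qed

lemma has_sum_multisets_insert:
  fixes x :: "'a \<Rightarrow> 'b :: {real_normed_field, banach}"
  assumes a: "a \<notin> A" and xa: "norm (x a) < 1"
    and g: "((\<lambda>p. \<Prod>i\<in>#p. x i) has_sum G) {p. set_mset p \<subseteq> A}"
    and s: "(\<lambda>(n, p). x a ^ n * (\<Prod>i\<in>#p. x i)) summable_on UNIV \<times> {p. set_mset p \<subseteq> A}"
  shows "((\<lambda>p. \<Prod>i\<in>#p. x i) has_sum 1 / (1 - x a) * G) {p. set_mset p \<subseteq> insert a A}"
proof -
  have geo: "((\<lambda>n. x a ^ n) has_sum 1 / (1 - x a)) UNIV"
    using xa by (intro norm_summable_imp_has_sum) (auto simp: norm_power intro!: summable_geometric geometric_sums)
  have "((\<lambda>(n, p). x a ^ n * (\<Prod>i\<in>#p. x i)) has_sum 1 / (1 - x a) * G) (UNIV \<times> {p. set_mset p \<subseteq> A})"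
    by (rule has_sum_SigmaI[OF _ has_sum_cmult_left[OF geo] s]) (auto intro: has_sum_cmult_right g)
  also have "(\<lambda>(n, p). x a ^ n * (\<Prod>i\<in>#p. x i)) = (\<lambda>np. \<Prod>i\<in>#(case np of (n, p) \<Rightarrow> p + replicate_mset n a). x i)"
    by (auto simp: fun_eq_iff mult.commute)
  finally show ?thesis
    using has_sum_reindex_bij_betw[OF bij_betw_insert_multiset[OF a], of "\<lambda>p. \<Prod>i\<in>#p. x i"] by simp
qed

text \<open>For nonnegative weights iterated convergence already gives summability over the product
  set. The complex case takes its absolute summability from this one.\<close>

lemma has_sum_multisets_real:
  fixes r :: "'a \<Rightarrow> real"
  assumes "finite A" "\<And>i. i \<in> A \<Longrightarrow> 0 \<le> r i" "\<And>i. i \<in> A \<Longrightarrow> r i < 1"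
  shows "((\<lambda>p. \<Prod>i\<in>#p. r i) has_sum (\<Prod>i\<in>A. 1 / (1 - r i))) {p. set_mset p \<subseteq> A}"
  using assms
proof (induction A rule: finite_induct)
  case (insert a A)
  have G: "((\<lambda>p. \<Prod>i\<in>#p. r i) has_sum (\<Prod>i\<in>A. 1 / (1 - r i))) {p. set_mset p \<subseteq> A}"
    by (rule insert.IH) (use insert in auto)
  have ra: "0 \<le> r a" "r a < 1" using insert by auto
  have nonneg: "0 \<le> (\<Prod>i\<in>#p. r i)" if "set_mset p \<subseteq> A" for p
    using that insert.prems(1) by (induction p) auto
  have "(\<lambda>(n, p). r a ^ n * (\<Prod>i\<in>#p. r i)) summable_on UNIV \<times> {p. set_mset p \<subseteq> A}"
  proof (rule summable_on_SigmaI)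
    show "((\<lambda>p. case (n, p) of (n, p) \<Rightarrow> r a ^ n * (\<Prod>i\<in>#p. r i)) has_sum r a ^ n * (\<Prod>i\<in>A. 1 / (1 - r i))) {p. set_mset p \<subseteq> A}" for n
      using has_sum_cmult_right[OF G] by simp
    show "(\<lambda>n. r a ^ n * (\<Prod>i\<in>A. 1 / (1 - r i))) summable_on UNIV"
      using ra by (intro summable_on_cmult_left norm_summable_imp_summable_on) (auto simp: norm_power intro!: summable_geometric)
  qed (use ra nonneg in auto)
  from has_sum_multisets_insert[OF insert.hyps(2) _ G this] ra insert.hyps show ?case by simp
qed (auto intro!: has_sum_finiteI)

lemma prod_mset_norm: "norm (\<Prod>i\<in>#p. x i) = (\<Prod>i\<in>#p. norm (x i :: 'b :: {real_normed_field}))"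
  by (induction p) (simp_all add: norm_mult)

lemma has_sum_multisets:
  fixes x :: "'a \<Rightarrow> complex"
  assumes "finite A" "\<And>i. i \<in> A \<Longrightarrow> norm (x i) < 1"
  shows "((\<lambda>p. \<Prod>i\<in>#p. x i) has_sum (\<Prod>i\<in>A. 1 / (1 - x i))) {p. set_mset p \<subseteq> A}"
  using assms
proof (induction A rule: finite_induct)
  case (insert a A)
  have G: "((\<lambda>p. \<Prod>i\<in>#p. x i) has_sum (\<Prod>i\<in>A. 1 / (1 - x i))) {p. set_mset p \<subseteq> A}"
    by (rule insert.IH) (use insert in auto)
  have "((\<lambda>p. \<Prod>i\<in>#p. norm (x i)) has_sum (\<Prod>i\<in>insert a A. 1 / (1 - norm (x i)))) {p. set_mset p \<subseteq> insert a A}"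
    by (rule has_sum_multisets_real) (use insert in auto)
  hence "(\<lambda>p. norm (\<Prod>i\<in>#p. x i)) summable_on {p. set_mset p \<subseteq> insert a A}"
    unfolding prod_mset_norm by (rule has_sum_imp_summable)
  hence "(\<lambda>p. \<Prod>i\<in>#p. x i) summable_on {p. set_mset p \<subseteq> insert a A}" by (rule abs_summable_summable)
  hence "(\<lambda>np. \<Prod>i\<in>#(case np of (n, p) \<Rightarrow> p + replicate_mset n a). x i) summable_on UNIV \<times> {p. set_mset p \<subseteq> A}"
    using summable_on_reindex_bij_betw[OF bij_betw_insert_multiset[OF insert.hyps(2)], of "\<lambda>p. \<Prod>i\<in>#p. x i"] by simp
  also have "(\<lambda>np. \<Prod>i\<in>#(case np of (n, p) \<Rightarrow> p + replicate_mset n a). x i) = (\<lambda>(n, p). x a ^ n * (\<Prod>i\<in>#p. x i))"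
    by (auto simp: fun_eq_iff mult.commute)
  finally show ?case
    using has_sum_multisets_insert[OF insert.hyps(2) _ G] insert by simp
qed (auto intro!: has_sum_finiteI)

definition parts_ge :: "nat \<Rightarrow> nat multiset set" where
  "parts_ge l = {p. \<forall>x\<in>#p. l \<le> x}"

text \<open>One copy of the largest part is removed; the remaining parts may still attain
  it.\<close>

lemma bij_betw_max_part:
  "bij_betw (\<lambda>(m, p). add_mset m p) (SIGMA m:{l..}. {p. set_mset p \<subseteq> {l..m}}) (parts_ge l - {{#}})"
proof (rule bij_betw_byWitness[where f' = "\<lambda>p. (Max (set_mset p), p - {#Max (set_mset p)#})"])
  show "\<forall>mp\<in>SIGMA m:{l..}. {p. set_mset p \<subseteq> {l..m}}.
      (\<lambda>p. (Max (set_mset p), p - {#Max (set_mset p)#})) (case mp of (m, p) \<Rightarrow> add_mset m p) = mp"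
  proof (rule ballI)
    fix mp assume "mp \<in> (SIGMA m:{l..}. {p. set_mset p \<subseteq> {l..m}})"
    then obtain m p where mp: "mp = (m, p)" "set_mset p \<subseteq> {l..m}" by auto
    hence "Max (set_mset (add_mset m p)) = m" by (intro Max_eqI) auto
    thus "(\<lambda>p. (Max (set_mset p), p - {#Max (set_mset p)#})) (case mp of (m, p) \<Rightarrow> add_mset m p) = mp"
      using mp by simp
  qed
  show "\<forall>p\<in>parts_ge l - {{#}}. (case (Max (set_mset p), p - {#Max (set_mset p)#}) of (m, p) \<Rightarrow> add_mset m p) = p"
    by (auto intro!: insert_DiffM Max_in)
  show "(\<lambda>(m, p). add_mset m p) ` (SIGMA m:{l..}. {p. set_mset p \<subseteq> {l..m}}) \<subseteq> parts_ge l - {{#}}"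
    by (auto simp: parts_ge_def)
  show "(\<lambda>p. (Max (set_mset p), p - {#Max (set_mset p)#})) ` (parts_ge l - {{#}}) \<subseteq> (SIGMA m:{l..}. {p. set_mset p \<subseteq> {l..m}})"
  proof safe
    fix p assume p: "p \<in> parts_ge l" "p \<noteq> {#}"
    hence "Max (set_mset p) \<in># p" by (intro Max_in) auto
    thus "l \<le> Max (set_mset p)" using p by (auto simp: parts_ge_def)
    fix x assume "x \<in># p - {#Max (set_mset p)#}"
    hence "x \<in># p" by (rule in_diffD)
    thus "x \<in> {l..Max (set_mset p)}" using p by (auto simp: parts_ge_def)
  qed
qed

lemma has_sum_by_max_part:
  fixes f :: "nat multiset \<Rightarrow> complex"
  assumes f: "\<And>m. l \<le> m \<Longrightarrow> ((\<lambda>p. f (add_mset m p)) has_sum g m) {p. set_mset p \<subseteq> {l..m}}"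
    and g: "(g has_sum S) {l..}" and s: "f summable_on parts_ge l"
  shows "(f has_sum f {#} + S) (parts_ge l)"
proof -
  have "f summable_on parts_ge l - {{#}}" using s summable_on_subset by blast
  hence "(\<lambda>mp. f (case mp of (m, p) \<Rightarrow> add_mset m p)) summable_on (SIGMA m:{l..}. {p. set_mset p \<subseteq> {l..m}})"
    using summable_on_reindex_bij_betw[OF bij_betw_max_part] by blast
  hence "((\<lambda>mp. f (case mp of (m, p) \<Rightarrow> add_mset m p)) has_sum S) (SIGMA m:{l..}. {p. set_mset p \<subseteq> {l..m}})"
    using f by (intro has_sum_SigmaI[OF _ g]) auto
  hence "(f has_sum S) (parts_ge l - {{#}})"
    using has_sum_reindex_bij_betw[OF bij_betw_max_part] by blast
  moreover have "(f has_sum f {#}) {{#}}" by (rule has_sum_finiteI) auto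
  ultimately have "(f has_sum f {#} + S) ({{#}} \<union> (parts_ge l - {{#}}))"
    by (intro has_sum_Un_disjoint) auto
  moreover have "{{#}} \<union> (parts_ge l - {{#}}) = parts_ge l" by (auto simp: parts_ge_def)
  ultimately show ?thesis by simp
qed

lemma power_sum_mset: "(\<Prod>i\<in>#p. x ^ i) = (x :: 'b :: comm_monoid_mult) ^ sum_mset p"
  by (induction p) (auto simp: power_add)

lemma qpoch_bounds:
  assumes "norm q < 1" "norm x < 1"
  shows "qpoch x q n \<noteq> 0" "qpoch_inf x q \<noteq> 0" "\<exists>C>0. \<forall>n. norm (1 / qpoch x q n) \<le> C"
proof -
  have *: "q ^ i * x \<noteq> 1" for i
  proof
    assume "q ^ i * x = 1"
    hence "norm q ^ i * norm x = 1" by (metis norm_mult norm_one norm_power)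
    moreover have "norm q ^ i * norm x \<le> 1 * norm x"
      using assms by (intro mult_right_mono power_le_one) auto
    ultimately show False using assms by simp
  qed
  show "qpoch x q n \<noteq> 0" using * by (auto simp: qpoch_eq_0_iff)
  show nz: "qpoch_inf x q \<noteq> 0" using * assms by (auto simp: qpoch_inf_eq_0_iff)
  have "(\<lambda>n. 1 / qpoch x q n) \<longlonglongrightarrow> 1 / qpoch_inf x q"
    using nz by (intro tendsto_intros qpoch_LIMSEQ assms)
  hence "Bseq (\<lambda>n. 1 / qpoch x q n)" by (metis convergentI convergent_imp_Bseq)
  thus "\<exists>C>0. \<forall>n. norm (1 / qpoch x q n) \<le> C" by (auto simp: Bseq_def)
qed

lemma prod_qpoch: "(\<Prod>i\<in>{1..m}. 1 / (1 - x * q ^ i)) = 1 / qpoch (x * q) q m"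
  by (induction m) (auto simp: qpoch_Suc mult_ac)

text \<open>Sorted by largest part m, the inner sums are r^m times finite Euler products, which are
  bounded uniformly in m, so a geometric series dominates.\<close>

lemma parts_summable:
  fixes r :: real
  assumes "0 \<le> r" "r < 1"
  shows "(\<lambda>p. r ^ sum_mset p) summable_on parts_ge 1"
proof -
  have rc: "norm (complex_of_real r) < 1" using assms by simp
  obtain C where C: "C > 0" "\<And>n. norm (1 / qpoch (complex_of_real r) (complex_of_real r) n) \<le> C"
    using qpoch_bounds(3)[OF rc rc] by blast
  have prod: "(\<Prod>i\<in>{1..m}. 1 / (1 - r ^ i)) \<le> C" for m
  proof -
    have "complex_of_real (\<Prod>i\<in>{1..m}. 1 / (1 - r ^ i)) = 1 / qpoch (complex_of_real r) (complex_of_real r) m"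
      using prod_qpoch[of 1 "complex_of_real r" m] by simp
    hence "norm (complex_of_real (\<Prod>i\<in>{1..m}. 1 / (1 - r ^ i))) \<le> C" using C(2) by presburger
    thus ?thesis unfolding norm_of_real by linarith
  qed
  have sum: "((\<lambda>p. r ^ sum_mset (add_mset m p)) has_sum r ^ m * (\<Prod>i\<in>{1..m}. 1 / (1 - r ^ i))) {p. set_mset p \<subseteq> {1..m}}" for m
  proof -
    have "((\<lambda>p. \<Prod>i\<in>#p. r ^ i) has_sum (\<Prod>i\<in>{1..m}. 1 / (1 - r ^ i))) {p. set_mset p \<subseteq> {1..m}}"
      by (rule has_sum_multisets_real) (use assms in \<open>auto simp: power_less_one_iff\<close>)
    from has_sum_cmult_right[OF this, of "r ^ m"] show ?thesis by (simp add: power_sum_mset power_add)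
  qed
  have "(\<lambda>mp. r ^ sum_mset (case mp of (m, p) \<Rightarrow> add_mset m p)) summable_on (SIGMA m:{1..}. {p. set_mset p \<subseteq> {1..m}})"
  proof (rule summable_on_SigmaI)
    show "((\<lambda>p. r ^ sum_mset (case (m, p) of (m, p) \<Rightarrow> add_mset m p)) has_sum r ^ m * (\<Prod>i\<in>{1..m}. 1 / (1 - r ^ i))) {p. set_mset p \<subseteq> {1..m}}" for m
      using sum by simp
    have "(\<lambda>m. r ^ m * C) summable_on UNIV"
      using assms by (intro summable_on_cmult_left norm_summable_imp_summable_on) (auto simp: norm_power intro!: summable_geometric)
    hence "(\<lambda>m. r ^ m * C) summable_on {1..}" by (rule summable_on_subset) auto
    thus "(\<lambda>m. r ^ m * (\<Prod>i\<in>{1..m}. 1 / (1 - r ^ i))) summable_on {1..}"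
    proof (rule summable_on_comparison_test)
      show "0 \<le> r ^ m * (\<Prod>i\<in>{1..m}. 1 / (1 - r ^ i))" for m
        using assms by (intro mult_nonneg_nonneg prod_nonneg) (auto simp: power_le_one)
      show "r ^ m * (\<Prod>i\<in>{1..m}. 1 / (1 - r ^ i)) \<le> r ^ m * C" for m
        using assms by (intro mult_left_mono prod) auto
    qed
  qed (use assms in auto)
  hence "(\<lambda>p. r ^ sum_mset p) summable_on parts_ge 1 - {{#}}"
    using summable_on_reindex_bij_betw[OF bij_betw_max_part] by blast
  hence "(\<lambda>p. r ^ sum_mset p) summable_on insert {#} (parts_ge 1 - {{#}})"
    by (simp only: summable_on_insert_iff)
  moreover have "insert {#} (parts_ge 1 - {{#}}) = parts_ge 1" by (auto simp: parts_ge_def)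
  ultimately show ?thesis by simp
qed

text \<open>Any statistic in the exponent of a z with norm 1 leaves the norm of the weight
  unchanged; this is why only such z are considered.\<close>

lemma weights_summable:
  fixes q :: complex and f :: "nat multiset \<Rightarrow> complex"
  assumes "norm q < 1" "1 \<le> l" "\<And>p. p \<in> parts_ge l \<Longrightarrow> norm (f p) \<le> norm q ^ sum_mset p"
  shows "f summable_on parts_ge l"
proof -
  have "(\<lambda>p. norm q ^ sum_mset p) summable_on parts_ge l"
    by (rule summable_on_subset[OF parts_summable]) (use assms(1,2) in \<open>auto simp: parts_ge_def intro: order_trans\<close>)
  hence "(\<lambda>p. norm (f p)) summable_on parts_ge l"
    using assms(3) by (intro summable_on_comparison_test[of _ _ "\<lambda>p. norm (f p)"]) auto
  thus ?thesis by (rule abs_summable_summable)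
qed

section \<open>The rank generating function\<close>

text \<open>Iterating \<open>(1 - t q\<^sup>N) G\<^sub>N = 1 / (b)\<^sub>N + b t q\<^bsup>2 N\<^esup> G\<^sub>N\<^sub>+\<^sub>1\<close> for \<open>G\<^sub>N = \<Sum>\<^sub>n (t q\<^sup>N)\<^sup>n / (b)\<^bsub>N+n\<^esub>\<close> turns the series
  by largest part into the series by Durfee squares.\<close>

lemma fine_series:
  assumes q: "norm q < 1" and b: "norm b < 1" and t: "norm t < 1"
  shows "(\<lambda>n. b ^ n * t ^ n * q ^ (n * (n - 1)) / (qpoch b q n * qpoch t q (Suc n))) sums (\<Sum>n. t ^ n / qpoch b q n)"
proof -
  obtain C where C: "C > 0" "\<And>n. norm (1 / qpoch b q n) \<le> C" using qpoch_bounds(3)[OF q b] by blast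
  obtain D where D: "D > 0" "\<And>n. norm (1 / qpoch t q n) \<le> D" using qpoch_bounds(3)[OF q t] by blast
  note bn = qpoch_bounds(1)[OF q b] and tn = qpoch_bounds(1)[OF q t]
  define G where "G = (\<lambda>N. \<Sum>n. (t * q ^ N) ^ n / qpoch b q (N + n))"
  have tq: "norm (t * q ^ N) \<le> norm t" for N
    using q by (simp add: norm_mult norm_power mult_left_le power_le_one)
  have bound: "norm ((t * q ^ N) ^ n / qpoch b q (N + n)) \<le> norm t ^ n * C" for N n
  proof -
    have "norm ((t * q ^ N) ^ n / qpoch b q (N + n)) = norm (t * q ^ N) ^ n * norm (1 / qpoch b q (N + n))"
      by (simp add: norm_divide norm_power)
    also have "\<dots> \<le> norm t ^ n * C" using C tq by (intro mult_mono power_mono) auto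
    finally show ?thesis .
  qed
  have geo: "summable (\<lambda>n. norm t ^ n * C)" using t by (intro summable_mult2 summable_geometric) simp
  have sm: "summable (\<lambda>n. (t * q ^ N) ^ n / qpoch b q (N + n))" for N
    using bound by (intro summable_comparison_test'[OF geo, of 0]) auto
  have Gb: "norm (G N) \<le> (\<Sum>n. norm t ^ n * C)" for N
    unfolding G_def using bound by (intro norm_suminf_le geo) auto
  have rec: "(1 - t * q ^ N) * G N = 1 / qpoch b q N + b * t * q ^ (2 * N) * G (Suc N)" for N
  proof -
    define f where "f = (\<lambda>n. (t * q ^ N) ^ n / qpoch b q (N + n))"
    have f: "summable f" unfolding f_def by (rule sm)
    have fS: "f (Suc n) - t * q ^ N * f n = b * t * q ^ (2 * N) * ((t * q ^ Suc N) ^ n / qpoch b q (Suc N + n))" for n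
    proof -
      have nz: "1 - q ^ (N + n) * b \<noteq> 0" using bn[of "Suc (N + n)"] by (simp add: qpoch_Suc)
      have e: "(t * q ^ Suc N) ^ n = (t * q ^ N) ^ n * q ^ n" by (simp add: power_mult_distrib mult_ac)
      have "f (Suc n) - t * q ^ N * f n = (t * q ^ N) ^ n * (t * q ^ N) * (1 - (1 - q ^ (N + n) * b)) / (qpoch b q (N + n) * (1 - q ^ (N + n) * b))"
        unfolding f_def using nz bn[of "N + n"] by (simp add: qpoch_Suc divide_simps) (simp add: algebra_simps)
      moreover have "q ^ (2 * N) = q ^ N * q ^ N" by (simp add: mult_2 power_add)
      ultimately show ?thesis unfolding e by (simp add: qpoch_Suc power_add mult_ac)
    qed
    have "(\<lambda>n. f (Suc n) - t * q ^ N * f n) sums (suminf f - f 0 - t * q ^ N * suminf f)"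
      using f by (intro sums_diff sums_mult summable_sums) (simp_all add: sums_Suc_iff summable_sums)
    hence "(\<lambda>n. b * t * q ^ (2 * N) * ((t * q ^ Suc N) ^ n / qpoch b q (Suc N + n))) sums ((1 - t * q ^ N) * G N - 1 / qpoch b q N)"
      unfolding fS by (simp add: G_def f_def algebra_simps)
    moreover have "(\<lambda>n. b * t * q ^ (2 * N) * ((t * q ^ Suc N) ^ n / qpoch b q (Suc N + n))) sums (b * t * q ^ (2 * N) * G (Suc N))"
      unfolding G_def by (intro sums_mult summable_sums sm)
    ultimately show ?thesis using sums_unique2 by (fastforce simp: algebra_simps)
  qed
  \<comment> \<open>The product of the coefficients met when the recursion for G is iterated N
    times; with it the recursion telescopes.\<close>
  define c where "c = (\<lambda>N. b ^ N * t ^ N * q ^ (N * (N - 1)) / qpoch t q N)"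
  have step: "c N * G N - c (Suc N) * G (Suc N) = b ^ N * t ^ N * q ^ (N * (N - 1)) / (qpoch b q N * qpoch t q (Suc N))" for N
  proof -
    have nz: "1 - q ^ N * t \<noteq> 0" using tn[of "Suc N"] by (simp add: qpoch_Suc)
    have "Suc N * (Suc N - 1) = N * (N - 1) + 2 * N" by (cases N) (auto simp: algebra_simps)
    hence cS: "c (Suc N) = c N * (b * t * q ^ (2 * N)) / (1 - q ^ N * t)"
      by (simp add: c_def qpoch_Suc power_add del: mult_Suc)
    have "G N = (1 / qpoch b q N + b * t * q ^ (2 * N) * G (Suc N)) / (1 - q ^ N * t)"
      using rec[of N] nz by (simp add: eq_divide_eq mult.commute)
    hence "c N * G N - c (Suc N) * G (Suc N) = c N * (1 / qpoch b q N) / (1 - q ^ N * t)"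
    proof -
      have "x * g - x * k / v * g' = x * h / v" if "g = (h + k * g') / v" for x g k v g' h :: complex
        unfolding that by (simp add: add_divide_distrib algebra_simps)
      thus ?thesis unfolding cS using \<open>G N = _\<close> by blast
    qed
    thus ?thesis by (simp add: c_def qpoch_Suc mult_ac)
  qed
  have "(\<lambda>N. c N * G N) \<longlonglongrightarrow> 0"
  proof (rule Lim_null_comparison)
    let ?M = "D * (\<Sum>n. norm t ^ n * C)"
    have M0: "0 \<le> (\<Sum>n. norm t ^ n * C)" using order_trans[OF norm_ge_zero Gb] .
    show "eventually (\<lambda>N. norm (c N * G N) \<le> norm t ^ N * ?M) sequentially"
    proof (intro always_eventually allI)
      fix N
      have "norm (b ^ N * t ^ N * q ^ (N * (N - 1))) \<le> 1 * norm t ^ N * 1"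
        unfolding norm_mult norm_power using q b by (intro mult_mono power_le_one) auto
      hence "norm (b ^ N * t ^ N * q ^ (N * (N - 1))) * norm (1 / qpoch t q N) * norm (G N) \<le> norm t ^ N * D * (\<Sum>n. norm t ^ n * C)"
        using D Gb[of N] M0 by (intro mult_mono) auto
      thus "norm (c N * G N) \<le> norm t ^ N * ?M" by (simp add: c_def norm_mult norm_divide mult_ac)
    qed
    have "(\<lambda>N. norm t ^ N * ?M) \<longlonglongrightarrow> 0 * ?M" using t by (intro tendsto_intros LIMSEQ_power_zero) simp
    thus "(\<lambda>N. norm t ^ N * ?M) \<longlonglongrightarrow> 0" by simp
  qed
  hence "(\<lambda>N. c N * G N - c (Suc N) * G (Suc N)) sums (c 0 * G 0 - 0)" by (rule telescope_sums')
  thus ?thesis unfolding step by (simp add: c_def G_def)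
qed


text \<open>The series identity with b = q^2/z and t = z q. Index n on one side is largest part m =
  n + 1, on the other Durfee square of side n + 1; the factor q/(1 - q/z) completes (q^2/z)_n to
  (q/z)_(n+1).\<close>

theorem rank_series:
  assumes q: "norm q < 1" "q \<noteq> 0" and z: "norm z = 1" "z \<in> off_powers q"
  shows "((\<lambda>m. z ^ (m - 1) * q ^ m / qpoch (q / z) q m) has_sum ((1 - z) * rank_fun z q - 1)) {1..}"
proof -
  have z0: "z \<noteq> 0" using z by auto
  have b: "norm (q ^ 2 / z) < 1" using q z by (simp add: norm_divide norm_power power_less_one_iff)
  have t: "norm (z * q) < 1" using q z by (simp add: norm_mult)
  have qz: "norm (q / z) < 1" using q z by (simp add: norm_divide)
  have qz1: "1 - q / z \<noteq> 0" using qpoch_bounds(1)[OF q(1) qz, of 1] by (simp add: qpoch_def)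
  have z1: "1 - z \<noteq> 0" using off_powersD(2)[OF q(2) z(2), of 0] by auto
  define H where "H = (\<Sum>n. (z * q) ^ n / qpoch (q ^ 2 / z) q n)"
  define f where "f = (\<lambda>n. q ^ (n ^ 2) / (qpoch z q (n + 1) * qpoch (q / z) q n))"
  have f: "f sums rank_fun z q"
    unfolding f_def rank_fun_def by (rule summable_sums[OF rank_fun_summable[OF q z(2)]])
  have t1: "q / (1 - q / z) * ((q ^ 2 / z) ^ n * (z * q) ^ n * q ^ (n * (n - 1)) / (qpoch (q ^ 2 / z) q n * qpoch (z * q) q (Suc n))) = (1 - z) * f (Suc n)" for n
  proof -
    have e1: "qpoch (q / z) q (Suc n) = (1 - q / z) * qpoch (q ^ 2 / z) q n"
      by (simp add: qpoch_rec power2_eq_square)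
    have e2: "qpoch z q (Suc n + 1) = (1 - z) * qpoch (z * q) q (Suc n)"
      using qpoch_rec[of z q "Suc n"] by (simp add: mult.commute)
    have e3: "q * ((q ^ 2 / z) ^ n * (z * q) ^ n * q ^ (n * (n - 1))) = q ^ ((Suc n)^2)"
    proof -
      have "(q ^ 2 / z) ^ n * (z * q) ^ n = (q ^ 3) ^ n"
        using z0 by (simp add: eval_nat_numeral flip: power_mult_distrib)
      moreover have sq: "1 + 3 * n + n * (n - 1) = (Suc n)^2" by (cases n) (auto simp: power2_eq_square algebra_simps)
      have "q ^ ((Suc n)^2) = q * (q ^ 3) ^ n * q ^ (n * (n - 1))"
        unfolding sq[symmetric] by (simp only: power_add power_mult power_one_right)
      ultimately show ?thesis by simp
    qed
    have "q / w * (x / (b * t)) = v * (Q / (v * t * (w * b)))" if "q * x = Q" "v \<noteq> 0" for w x b t v Q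
      using that by (simp flip: that(1))
    from this[OF e3 z1] show ?thesis unfolding f_def e1 e2 .
  qed
  have "(\<lambda>n. (1 - z) * f (Suc n)) sums (q / (1 - q / z) * H)"
    unfolding t1[symmetric] H_def by (intro sums_mult fine_series q b t)
  moreover have "(\<lambda>n. (1 - z) * f (Suc n)) sums ((1 - z) * (rank_fun z q - f 0))"
    using f by (intro sums_mult) (simp add: sums_Suc_iff)
  ultimately have e: "q / (1 - q / z) * H = (1 - z) * (rank_fun z q - f 0)"
    using sums_unique2 by blast
  \<comment> \<open>The Durfee square of side 0: after multiplication by 1 - z this is the 1 that
    belongs to the empty partition.\<close>
  have "f 0 = 1 / (1 - z)" by (simp add: f_def qpoch_def)
  hence e: "q / (1 - q / z) * H = (1 - z) * rank_fun z q - 1"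
    unfolding e using z1 by (simp add: field_simps)
  obtain C where C: "C > 0" "\<And>n. norm (1 / qpoch (q ^ 2 / z) q n) \<le> C" using qpoch_bounds(3)[OF q(1) b] by blast
  have nb: "norm ((z * q) ^ n / qpoch (q ^ 2 / z) q n) \<le> norm q ^ n * C" for n
  proof -
    have "norm ((z * q) ^ n / qpoch (q ^ 2 / z) q n) = norm q ^ n * norm (1 / qpoch (q ^ 2 / z) q n)"
      using z by (simp add: norm_divide norm_power norm_mult)
    also have "\<dots> \<le> norm q ^ n * C" using C by (intro mult_left_mono) auto
    finally show ?thesis .
  qed
  have geo: "summable (\<lambda>n. norm q ^ n * C)" using q by (intro summable_mult2 summable_geometric) simp
  have sn: "summable (\<lambda>n. norm ((z * q) ^ n / qpoch (q ^ 2 / z) q n))"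
    by (rule summable_comparison_test'[OF geo, of 0]) (use nb in simp)
  have "((\<lambda>n. (z * q) ^ n / qpoch (q ^ 2 / z) q n) has_sum H) UNIV"
    unfolding H_def by (rule norm_summable_imp_has_sum[OF sn summable_sums[OF summable_norm_cancel[OF sn]]])
  hence "((\<lambda>n. q / (1 - q / z) * ((z * q) ^ n / qpoch (q ^ 2 / z) q n)) has_sum (q / (1 - q / z) * H)) UNIV"
    by (rule has_sum_cmult_right)
  also have "(\<lambda>n. q / (1 - q / z) * ((z * q) ^ n / qpoch (q ^ 2 / z) q n)) = (\<lambda>n. z ^ (Suc n - 1) * q ^ Suc n / qpoch (q / z) q (Suc n))"
    using qz1 by (simp add: fun_eq_iff qpoch_rec power2_eq_square power_mult_distrib mult_ac)
  also have "(\<dots> has_sum (q / (1 - q / z) * H)) UNIV \<longleftrightarrow>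
      ((\<lambda>m. z ^ (m - 1) * q ^ m / qpoch (q / z) q m) has_sum (q / (1 - q / z) * H)) {1..}"
    by (rule has_sum_reindex_bij_betw) (rule bij_betw_byWitness[where f' = "\<lambda>m. m - 1"], auto)
  finally show ?thesis unfolding e .
qed

text \<open>On the empty multiset \<open>rank\<close> and \<open>crank\<close> have junk values, since \<open>Max {}\<close> is unspecified.\<close>

definition rank0 :: "nat multiset \<Rightarrow> int" where
  "rank0 p = (if p = {#} then 0 else rank p)"

lemma norm_powi_1: "norm (z :: complex) = 1 \<Longrightarrow> norm (z powi n) = 1"
  by (simp add: norm_power_int)

text \<open>With largest part m, that part contributes z^(m - 1) to the rank weight, as it also
  counts as one part, and every further part i contributes q^i / z.\<close>

theorem rank_has_sum:
  assumes q: "norm q < 1" "q \<noteq> 0" and z: "norm z = 1" "z \<in> off_powers q"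
  shows "((\<lambda>p. z powi rank0 p * q ^ sum_mset p) has_sum (1 - z) * rank_fun z q) (parts_ge 1)"
proof -
  have z0: "z \<noteq> 0" using z by auto
  let ?f = "\<lambda>p. z powi rank0 p * q ^ sum_mset p"
  have "(?f has_sum ?f {#} + ((1 - z) * rank_fun z q - 1)) (parts_ge 1)"
  proof (rule has_sum_by_max_part[OF _ rank_series[OF q z]])
    show "?f summable_on parts_ge 1"
      by (rule weights_summable[OF q(1)]) (use z in \<open>auto simp: norm_mult norm_power norm_powi_1\<close>)
    fix m :: nat assume m: "1 \<le> m"
    have qz: "norm (q ^ i / z) < 1" if "i \<in> {1..m}" for i
      using that q z by (simp add: norm_divide norm_power power_less_one_iff)
    have "((\<lambda>p. \<Prod>i\<in>#p. q ^ i / z) has_sum (\<Prod>i\<in>{1..m}. 1 / (1 - q ^ i / z))) {p. set_mset p \<subseteq> {1..m}}"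
      by (rule has_sum_multisets) (use qz in auto)
    from has_sum_cmult_right[OF this, of "z ^ (m - 1) * q ^ m"]
    have 1: "((\<lambda>p. z ^ (m - 1) * q ^ m * (\<Prod>i\<in>#p. q ^ i / z)) has_sum (z ^ (m - 1) * q ^ m * (\<Prod>i\<in>{1..m}. 1 / (1 - q ^ i / z)))) {p. set_mset p \<subseteq> {1..m}}" .
    have 2: "(\<Prod>i\<in>{1..m}. 1 / (1 - q ^ i / z)) = 1 / qpoch (q / z) q m"
      using prod_qpoch[of "1 / z" q m] by simp
    have 3: "(\<Prod>i\<in>#p. q ^ i / z) = q ^ sum_mset p / z ^ size p" for p
      by (induction p) (auto simp: power_add)
    have 4: "?f (add_mset m p) = z ^ (m - 1) * q ^ m * (\<Prod>i\<in>#p. q ^ i / z)" if "p \<in> {p. set_mset p \<subseteq> {1..m}}" for p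
    proof -
      have "Max (set_mset (add_mset m p)) = m" using that by (intro Max_eqI) auto
      hence "rank0 (add_mset m p) = int (m - 1) - int (size p)" using m by (simp add: rank0_def rank_def)
      thus ?thesis using z0 unfolding 3 by (simp add: power_int_diff power_add)
    qed
    show "((\<lambda>p. ?f (add_mset m p)) has_sum z ^ (m - 1) * q ^ m / qpoch (q / z) q m) {p. set_mset p \<subseteq> {1..m}}"
      using 1 unfolding 2 by (subst has_sum_cong[OF 4]) auto
  qed
  thus ?thesis by (simp add: rank0_def)
qed

section \<open>The crank generating function\<close>

text \<open>The ratio of consecutive coefficients gives (1 - x) f(x) = (1 - a x) f(q x). Iterating
  drives the argument to 0, where f is continuous with value 1.\<close>

theorem q_binomial:
  assumes q: "norm q < 1" and \<tau>: "norm \<tau> < 1"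
  shows "summable (\<lambda>k. norm (qpoch a q k / qpoch q q k * \<tau> ^ k))"
    and "(\<lambda>k. qpoch a q k / qpoch q q k * \<tau> ^ k) sums (qpoch_inf (a * \<tau>) q / qpoch_inf \<tau> q)"
proof -
  define c where "c = (\<lambda>k. qpoch a q k / qpoch q q k)"
  note qn = qpoch_bounds(1)[OF q q]
  have "(\<lambda>k. c k) \<longlonglongrightarrow> qpoch_inf a q / qpoch_inf q q"
    unfolding c_def using qpoch_bounds(2)[OF q q] by (intro tendsto_intros qpoch_LIMSEQ q)
  hence "Bseq c" by (metis convergentI convergent_imp_Bseq)
  then obtain C where C: "C > 0" "\<And>k. norm (c k) \<le> C" by (auto simp: Bseq_def)
  have sn: "summable (\<lambda>k. norm (c k * x ^ k))" if "norm x < 1" for x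
  proof (rule summable_comparison_test')
    show "summable (\<lambda>k. C * norm x ^ k)" using that by (intro summable_mult summable_geometric) simp
    show "norm (norm (c k * x ^ k)) \<le> C * norm x ^ k" for k
      using C by (auto simp: norm_mult norm_power intro!: mult_right_mono)
  qed
  note s = summable_norm_cancel[OF sn]
  show "summable (\<lambda>k. norm (qpoch a q k / qpoch q q k * \<tau> ^ k))" using sn[OF \<tau>] by (simp add: c_def)
  define f where "f = (\<lambda>x. \<Sum>k. c k * x ^ k)"
  have qx: "norm (q * x) < 1" if "norm x < 1" for x
    using that q by (metis mult_strict_mono' norm_ge_zero norm_mult mult_1)
  have rec: "(1 - x) * f x = (1 - a * x) * f (q * x)" if x: "norm x < 1" for x
  proof -
    have cS: "c (Suc k) * (1 - q ^ Suc k) = c k * (1 - q ^ k * a)" for k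
      using qn[of k] qn[of "Suc k"] by (simp add: c_def qpoch_Suc field_simps)
    have 1: "(\<lambda>k. c k * x ^ k - c k * (q * x) ^ k) sums (f x - f (q * x))"
      unfolding f_def by (intro sums_diff summable_sums s x qx)
    hence "(\<lambda>k. c (Suc k) * x ^ Suc k - c (Suc k) * (q * x) ^ Suc k) sums (f x - f (q * x))"
      by (subst sums_Suc_iff) simp
    moreover have "c (Suc k) * x ^ Suc k - c (Suc k) * (q * x) ^ Suc k = x * (c k * x ^ k - a * (c k * (q * x) ^ k))" for k
    proof -
      have "c (Suc k) * x ^ Suc k - c (Suc k) * (q * x) ^ Suc k = (c (Suc k) * (1 - q ^ Suc k)) * x ^ Suc k"
        by (simp add: power_mult_distrib algebra_simps)
      thus ?thesis unfolding cS by (simp add: power_mult_distrib algebra_simps)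
    qed
    ultimately have "(\<lambda>k. x * (c k * x ^ k - a * (c k * (q * x) ^ k))) sums (f x - f (q * x))" by simp
    moreover have "(\<lambda>k. x * (c k * x ^ k - a * (c k * (q * x) ^ k))) sums (x * (f x - a * f (q * x)))"
      unfolding f_def by (intro sums_mult sums_diff summable_sums s x qx)
    ultimately have "f x - f (q * x) = x * (f x - a * f (q * x))" using sums_unique2 by blast
    thus ?thesis by (simp add: algebra_simps)
  qed
  have small: "norm (q ^ n * \<tau>) < 1" for n
  proof -
    have "norm q ^ n * norm \<tau> \<le> 1 * norm \<tau>" using q by (intro mult_right_mono power_le_one) auto
    thus ?thesis using \<tau> by (simp add: norm_mult norm_power)
  qed
  have iter: "f \<tau> * qpoch \<tau> q n = qpoch (a * \<tau>) q n * f (q ^ n * \<tau>)" for n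
  proof (induction n)
    case (Suc n)
    have "f \<tau> * qpoch \<tau> q (Suc n) = qpoch (a * \<tau>) q n * ((1 - q ^ n * \<tau>) * f (q ^ n * \<tau>))"
      using Suc by (simp add: qpoch_Suc mult_ac)
    also have "\<dots> = qpoch (a * \<tau>) q n * ((1 - a * (q ^ n * \<tau>)) * f (q * (q ^ n * \<tau>)))"
      unfolding rec[OF small] ..
    finally show ?case by (simp add: qpoch_Suc mult_ac)
  qed simp
  have "isCont f 0"
    unfolding f_def by (rule isCont_powser[where K = "1 / 2"]) (auto intro!: s simp: norm_divide)
  moreover have "(\<lambda>n. q ^ n * \<tau>) \<longlonglongrightarrow> 0 * \<tau>" using q by (intro tendsto_intros LIMSEQ_power_zero)
  hence "(\<lambda>n. q ^ n * \<tau>) \<longlonglongrightarrow> 0" by simp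
  ultimately have "(\<lambda>n. f (q ^ n * \<tau>)) \<longlonglongrightarrow> f 0" by (rule isCont_tendsto_compose)
  hence "(\<lambda>n. qpoch (a * \<tau>) q n * f (q ^ n * \<tau>)) \<longlonglongrightarrow> qpoch_inf (a * \<tau>) q * f 0"
    by (intro tendsto_mult qpoch_LIMSEQ q)
  moreover have "(\<lambda>n. qpoch (a * \<tau>) q n * f (q ^ n * \<tau>)) \<longlonglongrightarrow> f \<tau> * qpoch_inf \<tau> q"
    unfolding iter[symmetric] by (intro tendsto_intros qpoch_LIMSEQ q)
  ultimately have "f \<tau> * qpoch_inf \<tau> q = qpoch_inf (a * \<tau>) q * f 0" using LIMSEQ_unique by blast
  moreover have "f 0 = 1" unfolding f_def using powser_zero[of c] by (simp add: c_def)
  ultimately have "f \<tau> = qpoch_inf (a * \<tau>) q / qpoch_inf \<tau> q"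
    using qpoch_bounds(2)[OF q \<tau>] by (simp add: field_simps)
  thus "(\<lambda>k. qpoch a q k / qpoch q q k * \<tau> ^ k) sums (qpoch_inf (a * \<tau>) q / qpoch_inf \<tau> q)"
    using summable_sums[OF s[OF \<tau>]] by (simp add: f_def c_def)
qed

lemma q_binomial_has_sum:
  assumes "norm q < 1" "norm \<tau> < 1"
  shows "((\<lambda>k. qpoch a q k / qpoch q q k * \<tau> ^ k) has_sum (qpoch_inf (a * \<tau>) q / qpoch_inf \<tau> q)) UNIV"
  by (rule norm_summable_imp_has_sum[OF q_binomial[OF assms]])

lemma has_sum_finite_approx:
  fixes f :: "'a \<Rightarrow> complex"
  assumes "(f has_sum S) A" "e > 0"
  obtains X where "finite X" "X \<subseteq> A" "\<And>Y. finite Y \<Longrightarrow> X \<subseteq> Y \<Longrightarrow> Y \<subseteq> A \<Longrightarrow> dist (sum f Y) S < e"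
  using assms unfolding has_sum_def tendsto_iff eventually_finite_subsets_at_top by meson

lemma has_sum_incseq_limit:
  fixes f :: "'a \<Rightarrow> complex"
  assumes f: "(f has_sum S) (\<Union>n. A n)" and A: "incseq A" and s: "\<And>n. (f has_sum s n) (A n)"
  shows "s \<longlonglongrightarrow> S"
proof (rule tendstoI)
  fix e :: real assume "e > 0"
  hence e: "e / 2 > 0" by simp
  obtain X where X: "finite X" "X \<subseteq> (\<Union>n. A n)"
    "\<And>Y. finite Y \<Longrightarrow> X \<subseteq> Y \<Longrightarrow> Y \<subseteq> (\<Union>n. A n) \<Longrightarrow> dist (sum f Y) S < e / 2"
    using has_sum_finite_approx[OF f e] by blast
  have "\<exists>N. X \<subseteq> A N"
    using X(1,2)
  proof (induction X rule: finite_induct)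
    case (insert x X)
    then obtain N M where "X \<subseteq> A N" "x \<in> A M" by auto
    moreover have "A N \<subseteq> A (max N M)" "A M \<subseteq> A (max N M)" by (rule incseqD[OF A], simp)+
    ultimately have "insert x X \<subseteq> A (max N M)" by blast
    thus ?case by blast
  qed auto
  then obtain N where N: "X \<subseteq> A N" by blast
  have "dist (s n) S < e" if "n \<ge> N" for n
  proof -
    have XA: "X \<subseteq> A n" using N incseqD[OF A that] by (rule order_trans)
    obtain Z where Z: "finite Z" "Z \<subseteq> A n" "\<And>Y. finite Y \<Longrightarrow> Z \<subseteq> Y \<Longrightarrow> Y \<subseteq> A n \<Longrightarrow> dist (sum f Y) (s n) < e / 2"
      using has_sum_finite_approx[OF s[of n] e] by blast
    have "dist (sum f (X \<union> Z)) (s n) < e / 2" using XA X(1) Z by (intro Z(3)) auto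
    moreover have "dist (sum f (X \<union> Z)) S < e / 2" using X Z by (intro X(3)) auto
    ultimately show ?thesis by (rule dist_triangle_half_r)
  qed
  thus "eventually (\<lambda>n. dist (s n) S < e) sequentially" by (auto simp: eventually_sequentially)
qed

text \<open>Summability comes from the size majorant; the value is then found by exhausting the
  multisets through an upper bound N on the parts.\<close>

lemma has_sum_parts_limit:
  fixes q :: complex and x :: "nat \<Rightarrow> complex"
  assumes q: "norm q < 1" and l: "1 \<le> l" and x: "\<And>i. l \<le> i \<Longrightarrow> norm (x i) \<le> norm q ^ i"
    and P: "(\<lambda>N. \<Prod>i\<in>{l..N}. 1 / (1 - x i)) \<longlonglongrightarrow> P"
  shows "((\<lambda>p. \<Prod>i\<in>#p. x i) has_sum P) (parts_ge l)"
proof -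
  have x1: "norm (x i) < 1" if "l \<le> i" for i
  proof -
    have "norm q ^ i < 1" using q l that by (auto simp: power_less_one_iff)
    thus ?thesis using x[OF that] by linarith
  qed
  have "norm (\<Prod>i\<in>#p. x i) \<le> norm q ^ sum_mset p" if "p \<in> parts_ge l" for p
    using that
  proof (induction p)
    case (add i p)
    thus ?case unfolding image_mset_add_mset prod_mset.add_mset norm_mult sum_mset.add_mset power_add
      using x[of i] by (intro mult_mono) (auto simp: parts_ge_def)
  qed simp
  hence "(\<lambda>p. \<Prod>i\<in>#p. x i) summable_on parts_ge l" by (rule weights_summable[OF q l])
  then obtain S where S: "((\<lambda>p. \<Prod>i\<in>#p. x i) has_sum S) (parts_ge l)" by (auto simp: summable_on_def)
  have U: "parts_ge l = (\<Union>N. {p. set_mset p \<subseteq> {l..N}})"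
  proof (intro set_eqI iffI)
    fix p assume "p \<in> parts_ge l"
    hence "set_mset p \<subseteq> {l..Max (insert 0 (set_mset p))}" by (auto simp: parts_ge_def)
    thus "p \<in> (\<Union>N. {p. set_mset p \<subseteq> {l..N}})" by blast
  qed (auto simp: parts_ge_def)
  have "(\<lambda>N. \<Prod>i\<in>{l..N}. 1 / (1 - x i)) \<longlonglongrightarrow> S"
  proof (rule has_sum_incseq_limit)
    show "((\<lambda>p. \<Prod>i\<in>#p. x i) has_sum S) (\<Union>N. {p. set_mset p \<subseteq> {l..N}})" using S U by simp
    show "incseq (\<lambda>N. {p. set_mset p \<subseteq> {l..N}})" by (auto simp: incseq_def subset_iff)
    show "((\<lambda>p. \<Prod>i\<in>#p. x i) has_sum (\<Prod>i\<in>{l..N}. 1 / (1 - x i))) {p. set_mset p \<subseteq> {l..N}}" for N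
      by (rule has_sum_multisets) (use x1 in auto)
  qed
  hence "S = P" using P LIMSEQ_unique by blast
  thus ?thesis using S by simp
qed

definition crank0 :: "nat multiset \<Rightarrow> int" where
  "crank0 p = (if p = {#} then 0 else crank p)"

lemma prod_qpoch_2:
  assumes "norm q < 1" "1 \<le> m"
  shows "(\<Prod>i\<in>{2..m}. 1 / (1 - q ^ i)) = (1 - q) / qpoch q q m"
proof -
  have q1: "1 - q \<noteq> 0" using assms(1) by auto
  have "{1..m} = insert 1 {2..m}" using assms(2) by auto
  hence "(\<Prod>i\<in>{1..m}. 1 / (1 - q ^ i)) = 1 / (1 - q) * (\<Prod>i\<in>{2..m}. 1 / (1 - q ^ i))" by simp
  thus ?thesis using prod_qpoch[of 1 q m] q1 by (simp add: field_simps)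
qed

text \<open>With k ones set aside, the parts from 2 to k weigh q^i and give (1 - q)/(q)_k, while
  parts above k weigh z q^i and give (zq)_k/(zq)_inf.\<close>

lemma crank_ones:
  assumes q: "norm q < 1" "q \<noteq> 0" and z: "norm z = 1" and k: "1 \<le> k"
  shows "((\<lambda>p. z ^ size (filter_mset (\<lambda>x. k < x) p) * q ^ sum_mset p) has_sum
    (1 - q) / qpoch_inf (z * q) q * (qpoch (z * q) q k / qpoch q q k)) (parts_ge 2)"
proof -
  define x where "x = (\<lambda>i. if k < i then z * q ^ i else q ^ i)"
  have zq: "norm (z * q) < 1" using q z by (simp add: norm_mult)
  note nz = qpoch_bounds(1,2)[OF q(1) zq]
  have "((\<lambda>p. \<Prod>i\<in>#p. x i) has_sum (1 - q) / qpoch q q k * (qpoch (z * q) q k / qpoch_inf (z * q) q)) (parts_ge 2)"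
  proof (rule has_sum_parts_limit[OF q(1)])
    show "norm (x i) \<le> norm q ^ i" for i using z by (simp add: x_def norm_mult norm_power)
    have "(\<lambda>N. (1 - q) / qpoch q q k * (qpoch (z * q) q k / qpoch (z * q) q N)) \<longlonglongrightarrow>
       (1 - q) / qpoch q q k * (qpoch (z * q) q k / qpoch_inf (z * q) q)"
      using nz by (intro tendsto_intros qpoch_LIMSEQ q)
    moreover have "eventually (\<lambda>N. (1 - q) / qpoch q q k * (qpoch (z * q) q k / qpoch (z * q) q N) = (\<Prod>i\<in>{2..N}. 1 / (1 - x i))) sequentially"
      using eventually_ge_at_top[of k]
    proof eventually_elim
      case (elim N)
      have zk: "(\<Prod>i\<in>{1..n}. 1 / (1 - z * q ^ i)) = 1 / qpoch (z * q) q n" for n by (rule prod_qpoch)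
      have "(\<Prod>i\<in>{1..N}. 1 / (1 - z * q ^ i)) = (\<Prod>i\<in>{1..k}. 1 / (1 - z * q ^ i)) * (\<Prod>i\<in>{k<..N}. 1 / (1 - z * q ^ i))"
        using elim k by (subst prod.union_disjoint[symmetric]) (auto intro!: prod.cong)
      hence 1: "(\<Prod>i\<in>{k<..N}. 1 / (1 - z * q ^ i)) = qpoch (z * q) q k / qpoch (z * q) q N"
        unfolding zk using nz(1)[of k] nz(1)[of N] by (simp add: field_simps)
      have "{2..N} = {2..k} \<union> {k<..N}" using elim k by auto
      hence "(\<Prod>i\<in>{2..N}. 1 / (1 - x i)) = (\<Prod>i\<in>{2..k} \<union> {k<..N}. 1 / (1 - x i))" by (rule arg_cong)
      also have "\<dots> = (\<Prod>i\<in>{2..k}. 1 / (1 - x i)) * (\<Prod>i\<in>{k<..N}. 1 / (1 - x i))"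
        by (rule prod.union_disjoint) auto
      also have "(\<Prod>i\<in>{2..k}. 1 / (1 - x i)) = (\<Prod>i\<in>{2..k}. 1 / (1 - q ^ i))"
        by (rule prod.cong) (auto simp: x_def)
      also have "(\<Prod>i\<in>{k<..N}. 1 / (1 - x i)) = (\<Prod>i\<in>{k<..N}. 1 / (1 - z * q ^ i))"
        by (rule prod.cong) (auto simp: x_def)
      finally show ?case unfolding 1 prod_qpoch_2[OF q(1) k] by simp
    qed
    ultimately show "(\<lambda>N. \<Prod>i\<in>{2..N}. 1 / (1 - x i)) \<longlonglongrightarrow> (1 - q) / qpoch q q k * (qpoch (z * q) q k / qpoch_inf (z * q) q)"
      by (rule Lim_transform_eventually)
  qed simp
  also have "(\<lambda>p. \<Prod>i\<in>#p. x i) = (\<lambda>p. z ^ size (filter_mset (\<lambda>x. k < x) p) * q ^ sum_mset p)"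
  proof
    fix p
    show "(\<Prod>i\<in>#p. x i) = z ^ size (filter_mset (\<lambda>x. k < x) p) * q ^ sum_mset p"
      by (induction p) (auto simp: x_def power_add mult_ac)
  qed
  finally show ?thesis by (simp add: mult_ac)
qed

text \<open>Summation over the largest part m \<ge> 2 is Euler's case a = 0 of the q-binomial
  theorem without its terms 0 and 1. Those two amount to 1 - q + z q; the empty multiset restores
  the 1, and q - z q remains.\<close>

lemma crank_no_ones:
  assumes q: "norm q < 1" "q \<noteq> 0" and z: "norm z = 1"
  shows "((\<lambda>p. z ^ (if p = {#} then 0 else Max (set_mset p)) * q ^ sum_mset p) has_sum
    ((1 - q) / qpoch_inf (z * q) q + q - z * q)) (parts_ge 2)"
proof -
  have zq: "norm (z * q) < 1" using q z by (simp add: norm_mult)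
  have q1: "1 - q \<noteq> 0" using q(1) by auto
  let ?f = "\<lambda>p. z ^ (if p = {#} then 0 else Max (set_mset p)) * q ^ sum_mset p"
  let ?g = "\<lambda>m. (1 - q) * (qpoch 0 q m / qpoch q q m * (z * q) ^ m)"
  have q0: "qpoch 0 q m = 1" "qpoch_inf 0 q = 1" for m
  proof -
    show 1: "qpoch 0 q m = 1" for m by (simp add: qpoch_def)
    show "qpoch_inf 0 q = 1" using qpoch_LIMSEQ[OF q(1), of 0] unfolding 1 by (simp add: LIMSEQ_const_iff)
  qed
  have "(?g has_sum (1 - q) * (qpoch_inf (0 * (z * q)) q / qpoch_inf (z * q) q)) UNIV"
    by (intro has_sum_cmult_right q_binomial_has_sum q zq)
  hence "(?g has_sum (1 - q) * (qpoch_inf (0 * (z * q)) q / qpoch_inf (z * q) q) - (?g 0 + ?g 1)) (UNIV - {0, 1})"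
    by (intro has_sum_Diff) (auto intro!: has_sum_finiteI)
  also have "UNIV - {0, 1} = {2::nat..}" by auto
  also have "?g 0 + ?g 1 = 1 - q + z * q" using q1 by (simp add: qpoch_def)
  finally have g: "(?g has_sum (1 - q) / qpoch_inf (z * q) q - (1 - q + z * q)) {2..}" by (simp add: q0)
  have "(?f has_sum ?f {#} + ((1 - q) / qpoch_inf (z * q) q - (1 - q + z * q))) (parts_ge 2)"
  proof (rule has_sum_by_max_part[OF _ g])
    show "?f summable_on parts_ge 2"
      by (rule weights_summable[OF q(1)]) (use z in \<open>auto simp: norm_mult norm_power\<close>)
    fix m :: nat assume m: "2 \<le> m"
    have "((\<lambda>p. \<Prod>i\<in>#p. q ^ i) has_sum (\<Prod>i\<in>{2..m}. 1 / (1 - q ^ i))) {p. set_mset p \<subseteq> {2..m}}"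
      by (rule has_sum_multisets) (use q in \<open>auto simp: norm_power power_less_one_iff\<close>)
    from has_sum_cmult_right[OF this, of "z ^ m * q ^ m"]
    have 1: "((\<lambda>p. z ^ m * q ^ m * (\<Prod>i\<in>#p. q ^ i)) has_sum ?g m) {p. set_mset p \<subseteq> {2..m}}"
      using m prod_qpoch_2[OF q(1), of m] by (simp add: q0 power_mult_distrib mult_ac)
    have 4: "?f (add_mset m p) = z ^ m * q ^ m * (\<Prod>i\<in>#p. q ^ i)" if "p \<in> {p. set_mset p \<subseteq> {2..m}}" for p
    proof -
      have "Max (set_mset (add_mset m p)) = m" using that by (intro Max_eqI) auto
      thus ?thesis by (simp add: power_sum_mset power_add)
    qed
    show "((\<lambda>p. ?f (add_mset m p)) has_sum ?g m) {p. set_mset p \<subseteq> {2..m}}"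
      using 1 by (subst has_sum_cong[OF 4]) auto
  qed
  thus ?thesis by (simp add: algebra_simps)
qed

text \<open>Sorting by the number of ones and summing with the \<open>q\<close>-binomial theorem.\<close>

theorem crank_has_sum:
  assumes q: "norm q < 1" "q \<noteq> 0" and z: "norm z = 1"
  shows "((\<lambda>p. z powi crank0 p * q ^ sum_mset p) has_sum
    (qpoch_inf q q / (qpoch_inf (z * q) q * qpoch_inf (q / z) q) + q - z * q)) (parts_ge 1)"
proof -
  have z0: "z \<noteq> 0" using z by auto
  have qz: "norm (q / z) < 1" using q z by (simp add: norm_divide)
  let ?f = "\<lambda>p. z powi crank0 p * q ^ sum_mset p"
  define c where "c = (1 - q) / qpoch_inf (z * q) q"
  define h where "h = (\<lambda>k. c * (qpoch (z * q) q k / qpoch q q k * (q / z) ^ k))"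
  \<comment> \<open>Partitions without ones follow the pattern of h only up to the excess q - z
    q.\<close>
  define g where "g = (\<lambda>k. h k + (if k = 0 then q - z * q else 0))"
  have sets: "{p. set_mset p \<subseteq> {2..}} = parts_ge 2" "{p. set_mset p \<subseteq> insert 1 {2..}} = parts_ge 1"
  proof -
    have "insert 1 {2..} = {1::nat..}" by auto
    thus "{p. set_mset p \<subseteq> {2..}} = parts_ge 2" "{p. set_mset p \<subseteq> insert 1 {2..}} = parts_ge 1"
      by (auto simp: parts_ge_def)
  qed
  have bij: "bij_betw (\<lambda>(n, p). p + replicate_mset n 1) (UNIV \<times> parts_ge 2) (parts_ge 1)"
    using bij_betw_insert_multiset[of 1 "{2::nat..}"] unfolding sets by simp
  have "(h has_sum c * (qpoch_inf (z * q * (q / z)) q / qpoch_inf (q / z) q)) UNIV"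
    unfolding h_def by (intro has_sum_cmult_right q_binomial_has_sum q qz)
  moreover have "((\<lambda>k. if k = 0 then q - z * q else 0) has_sum (q - z * q)) (UNIV :: nat set)"
    by (rule has_sum_finite_neutralI[of "{0}"]) auto
  ultimately have "(g has_sum c * (qpoch_inf (z * q * (q / z)) q / qpoch_inf (q / z) q) + (q - z * q)) UNIV"
    unfolding g_def by (rule has_sum_add)
  \<comment> \<open>Here z q (q/z) = q^2, and (1 - q)(q^2)_inf = (q)_inf.\<close>
  also have "c * (qpoch_inf (z * q * (q / z)) q / qpoch_inf (q / z) q) = qpoch_inf q q / (qpoch_inf (z * q) q * qpoch_inf (q / z) q)"
    using z0 qpoch_inf_rec[OF q(1), of q] by (simp add: c_def)
  finally have g: "(g has_sum (qpoch_inf q q / (qpoch_inf (z * q) q * qpoch_inf (q / z) q) + (q - z * q))) UNIV" .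
  have inner: "((\<lambda>p. ?f (p + replicate_mset k 1)) has_sum g k) (parts_ge 2)" for k
  proof (cases "k = 0")
    case True
    have "crank0 p = int (if p = {#} then 0 else Max (set_mset p))" if "p \<in> parts_ge 2" for p
      using that by (auto simp: crank0_def crank_def parts_ge_def count_eq_zero_iff)
    hence "?f (p + replicate_mset k 1) = z ^ (if p = {#} then 0 else Max (set_mset p)) * q ^ sum_mset p" if "p \<in> parts_ge 2" for p
      using that True by (simp del: of_nat_eq_0_iff)
    hence "((\<lambda>p. ?f (p + replicate_mset k 1)) has_sum ((1 - q) / qpoch_inf (z * q) q + q - z * q)) (parts_ge 2)"
      using crank_no_ones[OF q z] by (subst has_sum_cong) auto
    thus ?thesis using True by (simp add: g_def h_def c_def add_diff_eq)
  next
    case False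
    have "?f (p + replicate_mset k 1) = (q / z) ^ k * (z ^ size (filter_mset (\<lambda>x. k < x) p) * q ^ sum_mset p)" if "p \<in> parts_ge 2" for p
    proof -
      have "count p 1 = 0" using that by (auto simp: parts_ge_def count_eq_zero_iff)
      hence "count (p + replicate_mset k 1) 1 = k" by simp
      \<comment> \<open>As k is at least 1, the ones are not among the parts larger than k.\<close>
      moreover have "filter_mset (\<lambda>x. k < x) (replicate_mset k 1) = {#}" using False by (simp add: filter_mset_eq_conv multiset_eq_iff)
      ultimately have "crank0 (p + replicate_mset k 1) = int (size (filter_mset (\<lambda>x. k < x) p)) - int k"
        using False unfolding crank0_def crank_def by simp
      thus ?thesis using z0 by (simp add: power_int_diff power_add power_divide)
    qed
    hence "((\<lambda>p. ?f (p + replicate_mset k 1)) has_sum ((q / z) ^ k * ((1 - q) / qpoch_inf (z * q) q * (qpoch (z * q) q k / qpoch q q k)))) (parts_ge 2)"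
      using has_sum_cmult_right[OF crank_ones[OF q z, of k], of "(q / z) ^ k"] False by (subst has_sum_cong) auto
    thus ?thesis using False by (simp add: g_def h_def c_def mult_ac)
  qed
  have "?f summable_on parts_ge 1"
    by (rule weights_summable[OF q(1)]) (use z in \<open>auto simp: norm_mult norm_power norm_powi_1\<close>)
  hence "(\<lambda>np. ?f (case np of (n, p) \<Rightarrow> p + replicate_mset n 1)) summable_on UNIV \<times> parts_ge 2"
    using summable_on_reindex_bij_betw[OF bij, of ?f] by simp
  hence "((\<lambda>np. ?f (case np of (n, p) \<Rightarrow> p + replicate_mset n 1)) has_sum
      (qpoch_inf q q / (qpoch_inf (z * q) q * qpoch_inf (q / z) q) + (q - z * q))) (UNIV \<times> parts_ge 2)"
    by (intro has_sum_SigmaI[OF _ g]) (use inner in auto)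
  hence "(?f has_sum (qpoch_inf q q / (qpoch_inf (z * q) q * qpoch_inf (q / z) q) + (q - z * q))) (parts_ge 1)"
    using has_sum_reindex_bij_betw[OF bij, of ?f] by simp
  thus ?thesis by (simp add: algebra_simps)
qed

section \<open>Values at fifth roots of unity\<close>

text \<open>As z^5 = 1, the dependence on z sits in the residue r alone; the part depending on k is
  a theta term of base q^25.\<close>

lemma theta_term_5:
  assumes "q \<noteq> 0" "z ^ 5 = 1"
  shows "theta_term z q (5 * k + r) = theta_term z q r * theta_term (q powi (10 + 5 * r)) (q ^ 25) k"
proof -
  have z: "z \<noteq> 0" using assms by auto
  have "(5 * k + r) * (5 * k + r - 1) = 25 * (k * (k - 1)) + r * (r - 1) + ((10 + 5 * r) * k) * 2"
    by (simp add: algebra_simps)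
  hence "(5 * k + r) * (5 * k + r - 1) div 2 = (25 * (k * (k - 1)) + r * (r - 1)) div 2 + (10 + 5 * r) * k"
    by simp
  also have "(25 * (k * (k - 1)) + r * (r - 1)) div 2 = 25 * (k * (k - 1)) div 2 + r * (r - 1) div 2"
    by (rule div_plus_div_distrib_dvd_left) simp
  also have "25 * (k * (k - 1)) div 2 = 25 * (k * (k - 1) div 2)"
    by (rule div_mult_swap[symmetric]) simp
  finally have e: "(5 * k + r) * (5 * k + r - 1) div 2 = 25 * (k * (k - 1) div 2) + r * (r - 1) div 2 + (10 + 5 * r) * k" .
  have m1: "(-1 :: complex) powi (5 * k + r) = (-1) powi k * (-1) powi r"
    using power_int_mult[of "-1 :: complex" 5 k] by (simp add: power_int_add)
  have m2: "z powi (5 * k + r) = z powi r"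
    using power_int_mult[of z 5 k] assms z by (simp add: power_int_add)
  have m3: "q powi (25 * (k * (k - 1) div 2)) = (q ^ 25) powi (k * (k - 1) div 2)"
    using power_int_mult[of q 25 "k * (k - 1) div 2"] by simp
  have m4: "q powi ((10 + 5 * r) * k) = (q powi (10 + 5 * r)) powi k" by (rule power_int_mult)
  show ?thesis
    unfolding theta_term_def e power_int_add[OF disjI1[OF assms(1)]] m1 m2 m3 m4
    by (simp only: mult_ac)
qed

context
  fixes q z :: complex
  assumes q: "norm q < 1" "q \<noteq> 0" and z: "z ^ 5 = 1" "z \<noteq> 1"
begin

abbreviation (input) "A \<equiv> jfun (q ^ 10) (q ^ 25)"
abbreviation (input) "B \<equiv> q * jfun (q ^ 5) (q ^ 25)"
abbreviation (input) "X \<equiv> qpoch_inf (q ^ 5) (q ^ 5)"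

lemma z0: "z \<noteq> 0" using z(1) by auto

lemma sum_powers: "1 + z + z ^ 2 + z ^ 3 + z ^ 4 = 0"
proof -
  have "(1 - z) * (1 + z + z ^ 2 + z ^ 3 + z ^ 4) = 1 - z ^ 5" by algebra
  thus ?thesis using z by simp
qed

text \<open>Jacobi's series split by n modulo 5. Of the five theta functions of base q^25 one
  vanishes, and reflection pairs the other four.\<close>

lemma jfun_fifth_root: "jfun z q = (1 - z) * A + (z ^ 2 - z ^ 4) * B"
proof -
  have Q: "norm (q ^ 25) < 1" "q ^ 25 \<noteq> 0" using q by (auto simp: norm_power power_less_one_iff)
  have "(theta_term z q has_sum (\<Sum>r\<in>{0..<5}. theta_term z q r * jfun (q powi (10 + 5 * r)) (q ^ 25)))
      (\<Union>r\<in>{0..<5}. range (\<lambda>k. 5 * k + r))"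
  proof (rule sum_has_sum)
    fix r :: int
    have "((\<lambda>k. theta_term z q (5 * k + r)) has_sum theta_term z q r * jfun (q powi (10 + 5 * r)) (q ^ 25)) UNIV"
      unfolding theta_term_5[OF q(2) z(1)]
      by (intro has_sum_cmult_right jacobi_triple_product Q) (use q in auto)
    thus "(theta_term z q has_sum theta_term z q r * jfun (q powi (10 + 5 * r)) (q ^ 25)) (range (\<lambda>k. 5 * k + r))"
      by (subst has_sum_reindex) (auto simp: inj_on_def o_def)
  next
    fix r r' :: int assume "r \<in> {0..<5}" "r' \<in> {0..<5}" "r \<noteq> r'"
    thus "range (\<lambda>k. 5 * k + r) \<inter> range (\<lambda>k. 5 * k + r') = {}"
      by auto presburger
  qed simp
  also have "(\<Union>r\<in>{0..<5}. range (\<lambda>k. 5 * k + r)) = (UNIV :: int set)"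
  proof (intro set_eqI iffI UNIV_I)
    fix n :: int
    have "n = 5 * (n div 5) + n mod 5" "n mod 5 \<in> {0..<5}" by auto
    thus "n \<in> (\<Union>r\<in>{0..<5}. range (\<lambda>k. 5 * k + r))" by blast
  qed
  finally have "jfun z q = (\<Sum>r\<in>{0..<5}. theta_term z q r * jfun (q powi (10 + 5 * r)) (q ^ 25))"
    using jacobi_triple_product[OF q z0] has_sum_unique by blast
  also have "{0..<5} = {0, 1, 2, 3, 4 :: int}" by auto
  also have "(\<Sum>r\<in>\<dots>. theta_term z q r * jfun (q powi (10 + 5 * r)) (q ^ 25)) =
      jfun (q ^ 10) (q ^ 25) - z * jfun (q ^ 15) (q ^ 25) + z ^ 2 * q * jfun (q ^ 20) (q ^ 25)
      - z ^ 3 * q ^ 3 * jfun (q ^ 25) (q ^ 25) + z ^ 4 * q ^ 6 * jfun (q ^ 30) (q ^ 25)"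
    by (simp add: theta_term_def)
  also have "jfun (q ^ 15) (q ^ 25) = A"
    using jfun_reflect[OF Q(2), of "q ^ 10"] q by (simp add: power_diff[symmetric])
  also have "jfun (q ^ 20) (q ^ 25) = jfun (q ^ 5) (q ^ 25)"
    using jfun_reflect[OF Q(2), of "q ^ 5"] q by (simp add: power_diff[symmetric])
  also have "jfun (q ^ 25) (q ^ 25) = 0"
    using jfun_reflect[OF Q(2), of 1] Q by simp
  also have "jfun (q ^ 30) (q ^ 25) = - jfun (q ^ 5) (q ^ 25) / q ^ 5"
    using jfun_rec[OF Q, of "q ^ 5"] q by (simp flip: power_add)
  also have "z ^ 4 * q ^ 6 * (- jfun (q ^ 5) (q ^ 25) / q ^ 5) = - (z ^ 4 * B)"
    using q(2) by (simp add: eval_nat_numeral)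
  finally show ?thesis by (simp add: algebra_simps)
qed

text \<open>Division by 1 - z, using z^2 - z^4 = (1 - z)(z^2 + z^3).\<close>

lemma jred_fifth_root: "jred z q = A + (z ^ 2 + z ^ 3) * B"
proof -
  have "(1 - z) * jred z q = (1 - z) * (A + (z ^ 2 + z ^ 3) * B)"
    unfolding jfun_conv_jred[OF q(1), symmetric] jfun_fifth_root by (simp add: algebra_simps eval_nat_numeral)
  thus ?thesis using z by simp
qed

lemma prod_fifth_roots:
  "(1 - x) * (1 - x * z) * (1 - x * z ^ 2) * (1 - x * z ^ 3) * (1 - x * z ^ 4) = 1 - x ^ 5"
  using sum_powers z by algebra

lemma qpoch_inf_fifth_roots:
  "qpoch_inf q q * qpoch_inf (q * z) q * qpoch_inf (q * z ^ 2) q * qpoch_inf (q * z ^ 3) q * qpoch_inf (q * z ^ 4) q = X"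
proof -
  have Q: "norm (q ^ 5) < 1" using q by (auto simp: norm_power power_less_one_iff)
  have "qpoch q q n * qpoch (q * z) q n * qpoch (q * z ^ 2) q n * qpoch (q * z ^ 3) q n * qpoch (q * z ^ 4) q n =
      qpoch (q ^ 5) (q ^ 5) n" for n
  proof (induction n)
    case (Suc n)
    have "(1 - q ^ n * q) * (1 - q ^ n * (q * z)) * (1 - q ^ n * (q * z ^ 2)) * (1 - q ^ n * (q * z ^ 3)) * (1 - q ^ n * (q * z ^ 4)) = 1 - (q ^ 5) ^ n * q ^ 5"
      using prod_fifth_roots[of "q ^ n * q"] by (simp add: power_mult_distrib mult_ac flip: power_mult)
    moreover have "(P0 * f0) * (P1 * f1) * (P2 * f2) * (P3 * f3) * (P4 * f4) =
        (P0 * P1 * P2 * P3 * P4) * (f0 * f1 * f2 * f3 * f4)" for P0 P1 P2 P3 P4 f0 f1 f2 f3 f4 :: complex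
      by (simp only: mult_ac)
    ultimately show ?case unfolding qpoch_Suc Suc[symmetric] by presburger
  qed simp
  moreover have "(\<lambda>n. qpoch q q n * qpoch (q * z) q n * qpoch (q * z ^ 2) q n * qpoch (q * z ^ 3) q n * qpoch (q * z ^ 4) q n) \<longlonglongrightarrow>
      qpoch_inf q q * qpoch_inf (q * z) q * qpoch_inf (q * z ^ 2) q * qpoch_inf (q * z ^ 3) q * qpoch_inf (q * z ^ 4) q"
    by (intro tendsto_intros qpoch_LIMSEQ q)
  ultimately show ?thesis using qpoch_LIMSEQ[OF Q, of "q ^ 5"] LIMSEQ_unique by simp
qed

lemma z_inverse: "q / z = q * z ^ 4" "q / z ^ 2 = q * z ^ 3"
proof -
  have "z ^ 4 * z = 1" "z ^ 3 * z ^ 2 = 1" using z(1) by (simp_all flip: power_add power_Suc2)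
  thus "q / z = q * z ^ 4" "q / z ^ 2 = q * z ^ 3" using z0 by (simp_all add: divide_eq_eq mult.assoc)
qed

text \<open>The roots z, 1/z, z^2, 1/z^2 are all the nontrivial ones, so the two products fill up
  the product over all fifth roots, with one factor (q)_inf to spare.\<close>

lemma jred_prod: "jred z q * jred (z ^ 2) q = qpoch_inf q q * X"
  unfolding qpoch_inf_fifth_roots[symmetric] jred_def z_inverse by (simp add: mult_ac)

end

lemma fifth_root_sq:
  assumes "z ^ 5 = 1" "z \<noteq> (1 :: complex)"
  shows "(z ^ 2) ^ 5 = 1" "z ^ 2 \<noteq> 1"
proof -
  show "(z ^ 2) ^ 5 = 1" by (metis assms(1) mult.commute power_mult power_one)
  show "z ^ 2 \<noteq> 1"
  proof
    assume "z ^ 2 = 1"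
    hence "z ^ 5 = z" by (simp add: eval_nat_numeral)
    thus False using assms by simp
  qed
qed

context
  fixes q z :: complex
  assumes q: "norm q < 1" "q \<noteq> 0" and z: "z ^ 5 = 1" "z \<noteq> 1"
begin

abbreviation (input) "A' \<equiv> jfun (q ^ 10) (q ^ 25)"
abbreviation (input) "B' \<equiv> q * jfun (q ^ 5) (q ^ 25)"
abbreviation (input) "X' \<equiv> qpoch_inf (q ^ 5) (q ^ 5)"
abbreviation (input) "qq' \<equiv> qpoch_inf q q"

lemma jred_fifth_root_sq: "jred (z ^ 2) q = A' + (z + z ^ 4) * B'"
proof -
  have "(z ^ 2) ^ 2 + (z ^ 2) ^ 3 = z + z ^ 4"
    using z(1) by algebra
  thus ?thesis using jred_fifth_root[OF q fifth_root_sq[OF z]] by simp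
qed

text \<open>A norm form: z + z^4 and z^2 + z^3 have sum -1 and product -1, so z drops out of the
  product of the two conjugate factors.\<close>

lemma qpoch_inf_dissection: "qq' * X' = A' ^ 2 - A' * B' - B' ^ 2"
proof -
  have "qq' * X' = (A' + (z ^ 2 + z ^ 3) * B') * (A' + (z + z ^ 4) * B')"
    unfolding jred_prod[OF q z, symmetric] jred_fifth_root[OF q z] jred_fifth_root_sq ..
  also have "\<dots> = A' ^ 2 - A' * B' - B' ^ 2"
    using sum_powers[OF q z] z(1) by algebra
  finally show ?thesis .
qed

text \<open>Rationalising the denominator: 1/jred z is expressed by its conjugate jred (z^2), their
  product being known.\<close>

lemma crank_fifth_root:
  "qq' / (qpoch_inf (z * q) q * qpoch_inf (q / z) q) = (A' ^ 2 - A' * B' - B' ^ 2) * (A' + (z + z ^ 4) * B') / X' ^ 2"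
proof -
  have Q: "norm (q ^ 5) < 1" using q by (auto simp: norm_power power_less_one_iff)
  have nz: "qq' \<noteq> 0" "X' \<noteq> 0" using qpoch_self_nonzero(2)[OF q(1)] qpoch_self_nonzero(2)[OF Q] by auto
  define P where "P = qpoch_inf (z * q) q * qpoch_inf (q / z) q"
  have P: "jred z q = P * qq'" by (simp add: jred_def P_def mult_ac)
  hence e: "P * jred (z ^ 2) q = X'" using jred_prod[OF q z] nz by simp
  have "P \<noteq> 0" using e nz by auto
  hence "qq' / P = qq' * (P * jred (z ^ 2) q) * jred (z ^ 2) q / (X' * (P * jred (z ^ 2) q))"
    using e nz by (simp add: field_simps)
  also have "\<dots> = (qq' * X') * jred (z ^ 2) q / X' ^ 2"
    unfolding e by (simp add: power2_eq_square)
  finally show ?thesis unfolding P_def qpoch_inf_dissection jred_fifth_root_sq .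
qed

lemma off_powers_root: "z \<in> off_powers q"
proof -
  have "norm z ^ 5 = 1 ^ 5" using z by (simp flip: norm_power)
  hence nz: "norm z = 1" by (rule power_eq_imp_eq_base) auto
  have "z \<noteq> q powi n" for n
  proof
    assume n: "z = q powi n"
    show False
    proof (cases "n = 0")
      case False
      have "norm q powi n = 1" using n nz by (simp add: norm_power_int)
      moreover have "norm (complex_of_real (norm q)) < 1" "complex_of_real (norm q) \<noteq> 0" using q by auto
      ultimately show False using powi_neq_1[of "complex_of_real (norm q)" n] False
        by (metis of_real_1 of_real_power_int)
    qed (use n z in auto)
  qed
  moreover have "z \<noteq> 0" using z by auto
  ultimately show ?thesis by (simp add: off_powers_def)
qed

text \<open>Substituting n -> -n reflects the theta argument, and with w = q^(5n) one has (1/w)/(1 -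
  1/w) = -1/(1 - w).\<close>

lemma reg_symmetric: "reg q (8 - e) = - reg q e"
proof -
  have q3: "q ^ 3 \<noteq> 0" using q by simp
  have q5: "norm (q ^ 5) < 1" "q ^ 5 \<noteq> 0" using q by (auto simp: norm_power power_less_one_iff)
  have "reg q (8 - e) = (\<Sum>\<^sub>\<infinity>n\<in>-{0}. theta_term (q powi (8 - e)) (q ^ 3) (- n) / (1 - 1 * (q ^ 5) powi (- n)))"
    unfolding reg_def[OF q] lerch_reg_def
    by (rule infsum_reindex_bij_betw[symmetric]) (rule bij_betw_byWitness[where f' = uminus], auto)
  also have "\<dots> = (\<Sum>\<^sub>\<infinity>n\<in>-{0}. - (theta_term (q powi e) (q ^ 3) n / (1 - 1 * (q ^ 5) powi n)))"
  proof (rule infsum_cong)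
    fix n :: int assume "n \<in> - {0}"
    hence n: "(q ^ 5) powi n \<noteq> 1" using powi_neq_1[OF q5, of n] by auto
    have q5n: "(q ^ 5) powi n \<noteq> 0" using q by simp
    have "theta_term (q powi (8 - e)) (q ^ 3) (- n) = theta_term (q ^ 3 / q powi (8 - e)) (q ^ 3) n"
      by (rule theta_term_uminus[OF q3]) (use q in auto)
    also have "q ^ 3 / q powi (8 - e) = q powi e / q ^ 5"
      using q by (simp add: power_int_diff divide_simps flip: power_add)
    also have "\<dots> = q powi e * (1 / q ^ 5)" by simp
    also have "theta_term \<dots> (q ^ 3) n = theta_term (q powi e) (q ^ 3) n / (q ^ 5) powi n"
      unfolding theta_term_mult by (simp add: power_int_divide_distrib)
    finally have 1: "theta_term (q powi (8 - e)) (q ^ 3) (- n) = theta_term (q powi e) (q ^ 3) n / (q ^ 5) powi n" .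
    have "T / w / (1 - 1 * inverse w) = - (T / (1 - 1 * w))" if "w \<noteq> 0" "w \<noteq> 1" for T w :: complex
      using that by (simp add: divide_simps) (simp add: algebra_simps)
    thus "theta_term (q powi (8 - e)) (q ^ 3) (- n) / (1 - 1 * (q ^ 5) powi (- n)) =
        - (theta_term (q powi e) (q ^ 3) n / (1 - 1 * (q ^ 5) powi n))"
      unfolding 1 power_int_minus using n q5n by blast
  qed
  also have "\<dots> = - reg q e" unfolding reg_def[OF q] lerch_reg_def by (rule infsum_uminus)
  finally show ?thesis .
qed

lemma reg_summable:
  "(\<lambda>n. theta_term (q powi e) (q ^ 3) n / (1 - 1 * (q ^ 5) powi n)) summable_on - {0}"
proof (rule partial_fractions_summable)
  show q5: "norm (q ^ 5) < 1" "q ^ 5 \<noteq> 0" using q by (auto simp: norm_power power_less_one_iff)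
  have "(\<lambda>n. norm (theta_term (q powi e) (q ^ 3) n)) summable_on UNIV"
    by (rule theta_term_abs_summable) (use q in \<open>auto simp: norm_power power_less_one_iff\<close>)
  thus "(\<lambda>n. norm (theta_term (q powi e) (q ^ 3) n)) summable_on - {0}"
    using summable_on_subset by blast
  show "1 * (q ^ 5) powi n \<noteq> 1" if "n \<in> - {0}" for n
    using powi_neq_1[OF q5, of n] that by auto
qed simp

text \<open>With w = q^n, the quotient (1 - w^5)/(1 - z w) is the geometric sum of the powers (z
  w)^b, b = 0,...,4, and w^b raises the exponent from 2 to 2 + b. The isolated 1 is the term n =
  0.\<close>

lemma rank_fun_reg:
  "qq' * ((1 - z) * rank_fun z q) = 1 + (z + z ^ 4 - 2) * reg q 6 + (2 * (z + z ^ 4) + 1) * reg q 3"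
proof -
  have z0: "z \<noteq> 0" using z by auto
  have q5: "norm (q ^ 5) < 1" "q ^ 5 \<noteq> 0" using q by (auto simp: norm_power power_less_one_iff)
  have Q: "norm (q ^ 3) < 1" "q ^ 3 \<noteq> 0" "q ^ 2 \<noteq> 0" using q by (auto simp: norm_power power_less_one_iff)
  define S where "S = (\<lambda>e n. theta_term (q powi e) (q ^ 3) n / (1 - 1 * (q ^ 5) powi n))"
  have Ssum: "(S e has_sum reg q e) (- {0})" for e
    unfolding S_def reg_def[OF q] lerch_reg_def by (rule has_sum_infsum[OF reg_summable])
  have "lerch_reg (q ^ 3) (q ^ 2) q 0 z = (\<Sum>\<^sub>\<infinity>n\<in>-{0}. S 2 n + z * S 3 n + z ^ 2 * S 4 n + z ^ 3 * S 5 n + z ^ 4 * S 6 n)"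
    unfolding lerch_reg_def
  proof (rule infsum_cong)
    fix n :: int assume "n \<in> - {0}"
    hence n: "(q ^ 5) powi n \<noteq> 1" using powi_neq_1[OF q5, of n] by auto
    define w where "w = q powi n"
    have w5: "(q ^ 5) powi n = w ^ 5" unfolding w_def by (metis power_int_mult power_int_mult mult.commute power_int_of_nat)
    have zw: "1 - z * w \<noteq> 0"
      using off_powersD(2)[OF q(2) off_powers_root, of n] by (simp add: w_def)
    have S: "S (2 + int b) n = theta_term (q ^ 2) (q ^ 3) n * w ^ b / (1 - w ^ 5)" for b
    proof -
      have "q powi (2 + int b) = q ^ 2 * q ^ b" using q by (simp add: power_int_add)
      moreover have "(q ^ b) powi n = w ^ b" unfolding w_def by (metis power_int_mult mult.commute power_int_of_nat)
      ultimately show ?thesis by (simp add: S_def theta_term_mult w5)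
    qed
    define P where "P = 1 + z * w + z ^ 2 * w ^ 2 + z ^ 3 * w ^ 3 + z ^ 4 * w ^ 4"
    have P: "1 - w ^ 5 = (1 - z * w) * P"
      unfolding P_def using z(1) by algebra
    have "1 - w ^ 5 \<noteq> 0" using n w5 by simp
    hence "T / (1 - z * w) = T * P / (1 - w ^ 5)" for T
      unfolding P using zw by simp
    thus "theta_term (q ^ 2) (q ^ 3) n / (1 - z * q powi n) = S 2 n + z * S 3 n + z ^ 2 * S 4 n + z ^ 3 * S 5 n + z ^ 4 * S 6 n"
      using S[of 0] S[of 1] S[of 2] S[of 3] S[of 4] unfolding w_def[symmetric]
      by (simp add: P_def add_divide_distrib distrib_left mult_ac)
  qed
  also have "\<dots> = reg q 2 + z * reg q 3 + z ^ 2 * reg q 4 + z ^ 3 * reg q 5 + z ^ 4 * reg q 6"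
    by (intro infsumI has_sum_add has_sum_cmult_right Ssum)
  also have "reg q 2 = - reg q 6" using reg_symmetric[of 6] by simp
  also have "reg q 5 = - reg q 3" using reg_symmetric[of 3] by simp
  also have "reg q 4 = 0" using reg_symmetric[of 4] by simp
  finally have R: "lerch_reg (q ^ 3) (q ^ 2) q 0 z = (z ^ 4 - 1) * reg q 6 + (z - z ^ 3) * reg q 3"
    by (simp add: algebra_simps)
  have "qq' * rank_fun z q = 1 / (1 - z) + lerch_reg (q ^ 3) (q ^ 2) q 0 z"
    unfolding rank_fun_lerch[OF q off_powers_root]
    by (subst lerch_conv_reg[where m = 0, OF Q(1,2,3) q off_powers_root]) simp
  hence "qq' * rank_fun z q * (1 - z) = (1 / (1 - z) + ((z ^ 4 - 1) * reg q 6 + (z - z ^ 3) * reg q 3)) * (1 - z)"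
    unfolding R by simp
  also have "\<dots> = 1 + ((1 - z) * (z ^ 4 - 1)) * reg q 6 + ((1 - z) * (z - z ^ 3)) * reg q 3"
  proof -
    have "(1 / v + (a * x + b * y)) * v = 1 + (v * a) * x + (v * b) * y" if "v \<noteq> 0" for v a b x y :: complex
      using that by (simp add: field_simps)
    thus ?thesis using z by simp
  qed
  also have "(1 - z) * (z ^ 4 - 1) = z + z ^ 4 - 2" using z(1) by algebra
  also have "(1 - z) * (z - z ^ 3) = 2 * (z + z ^ 4) + 1" using sum_powers[OF q z] z(1) by algebra
  finally show ?thesis by (simp add: mult_ac)
qed

text \<open>Dividing by (q)_inf is possible because (q)_inf X is a factor of the quintic numerator;
  this lowers the denominator X^3 to X^2.\<close>

theorem rank_fifth_root:
  "(1 - z) * rank_fun z q = (A' ^ 2 * (A' + B') + (z + z ^ 4) * B' ^ 2 * (A' - B')) / X' ^ 2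
     + (z + z ^ 4 - 2) * (q ^ 5 * gmock (q ^ 5) (q ^ 25)) - (2 * (z + z ^ 4) + 1) * (q ^ 8 * gmock (q ^ 10) (q ^ 25))"
proof -
  define s where "s = z + z ^ 4"
  have Q: "norm (q ^ 5) < 1" using q by (auto simp: norm_power power_less_one_iff)
  have nz: "qq' \<noteq> 0" "X' \<noteq> 0" using qpoch_self_nonzero(2)[OF q(1)] qpoch_self_nonzero(2)[OF Q] by auto
  define r where "r = (- 2 * A' ^ 5 + 5 * A' ^ 3 * B' ^ 2 + B' ^ 5) / (5 * X' ^ 3)"
  define r' where "r' = (A' ^ 5 - 5 * A' ^ 2 * B' ^ 3 + 2 * B' ^ 5) / (5 * X' ^ 3)"
  \<comment> \<open>The constants cancel identically in s: 1 + 2(s - 2)/5 - (2s + 1)/5 = 0.\<close>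
  have "1 + (s - 2) * (2 / 5 + r) + (2 * s + 1) * (- 1 / 5 + r') = (s - 2) * r + (2 * s + 1) * r'"
    by (simp add: algebra_simps diff_divide_distrib)
  also have "\<dots> = ((s - 2) * (- 2 * A' ^ 5 + 5 * A' ^ 3 * B' ^ 2 + B' ^ 5) + (2 * s + 1) * (A' ^ 5 - 5 * A' ^ 2 * B' ^ 3 + 2 * B' ^ 5)) / (5 * X' ^ 3)"
    unfolding r_def r'_def by (simp only: add_divide_distrib[symmetric] times_divide_eq_right)
  also have "\<dots> = (5 * ((A' ^ 2 - A' * B' - B' ^ 2) * (A' ^ 2 * (A' + B') + s * B' ^ 2 * (A' - B')))) / (5 * X' ^ 3)"
    \<comment> \<open>A polynomial identity in A', B' and s, valid without any relation among
      them.\<close>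
    by (rule arg_cong[of _ _ "\<lambda>x. x / (5 * X' ^ 3)"]) algebra
  also have "\<dots> = qq' * ((A' ^ 2 * (A' + B') + s * B' ^ 2 * (A' - B')) / X' ^ 2)"
    unfolding qpoch_inf_dissection[symmetric] using nz by (simp add: power2_eq_square power3_eq_cube)
  finally have e: "1 + (s - 2) * (2 / 5 + r) + (2 * s + 1) * (- 1 / 5 + r') = qq' * ((A' ^ 2 * (A' + B') + s * B' ^ 2 * (A' - B')) / X' ^ 2)" .
  have "qq' * ((1 - z) * rank_fun z q) = qq' * ((s - 2) * (q ^ 5 * gmock (q ^ 5) (q ^ 25)) - (2 * s + 1) * (q ^ 8 * gmock (q ^ 10) (q ^ 25)))
     + (1 + (s - 2) * (2 / 5 + r) + (2 * s + 1) * (- 1 / 5 + r'))"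
    unfolding rank_fun_reg s_def[symmetric] reg_values[OF q] r_def[symmetric] r'_def[symmetric] by (simp add: algebra_simps)
  also have "\<dots> = qq' * ((A' ^ 2 * (A' + B') + s * B' ^ 2 * (A' - B')) / X' ^ 2
     + (s - 2) * (q ^ 5 * gmock (q ^ 5) (q ^ 25)) - (2 * s + 1) * (q ^ 8 * gmock (q ^ 10) (q ^ 25)))"
    unfolding e by (simp add: algebra_simps)
  finally show ?thesis using nz unfolding s_def[symmetric] by simp
qed

end

section \<open>Extracting the residue classes modulo 5\<close>

lemma partitions_eq: "partitions n = {p \<in> parts_ge 1. sum_mset p = n}"
  by (auto simp: partitions_def parts_ge_def Suc_le_eq)

lemma finite_partitions: "finite (partitions n)"
proof -
  have size: "size p \<le> sum_mset p" if "\<forall>x\<in>#p. 0 < x" for p :: "nat multiset"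
    using that by (induction p) auto
  have "partitions n \<subseteq> mset ` {xs. set xs \<subseteq> {..n} \<and> length xs \<le> n}"
  proof
    fix p assume p: "p \<in> partitions n"
    obtain xs where xs: "p = mset xs" by (metis ex_mset)
    have "x \<le> n" if "x \<in># p" for x
      using p multi_member_split[OF that] by (auto simp: partitions_def)
    moreover have "size p \<le> n" using p size[of p] by (auto simp: partitions_def)
    ultimately show "p \<in> mset ` {xs. set xs \<subseteq> {..n} \<and> length xs \<le> n}" using xs by auto
  qed
  thus ?thesis by (rule finite_subset) (simp add: finite_lists_length_le)
qed

lemma partitions_0: "partitions 0 = {{#}}"
proof -
  have "p = {#}" if "p \<in> partitions 0" for p
    using that by (cases p) (auto simp: partitions_def)
  moreover have "{#} \<in> partitions 0" by (simp add: partitions_def)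
  ultimately show ?thesis by blast
qed

lemma partitions_1: "partitions 1 = {{#1#}}"
proof -
  have "p = {#1#}" if "p \<in> partitions 1" for p
  proof (cases p)
    case (add x p')
    with that have "x = 1" "p' \<in> partitions 0" by (auto simp: partitions_def add_is_1)
    thus ?thesis using add by (simp add: partitions_0)
  qed (use that in \<open>auto simp: partitions_def\<close>)
  moreover have "{#1#} \<in> partitions 1" by (simp add: partitions_def)
  ultimately show ?thesis by blast
qed

lemma sums_by_size:
  fixes c :: "nat multiset \<Rightarrow> complex"
  assumes "((\<lambda>p. c p * q ^ sum_mset p) has_sum S) (parts_ge 1)"
  shows "(\<lambda>n. (\<Sum>p\<in>partitions n. c p) * q ^ n) sums S"
proof -
  have bij: "bij_betw snd (Sigma UNIV partitions) (parts_ge 1)"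
    by (rule bij_betw_byWitness[where f' = "\<lambda>p. (sum_mset p, p)"]) (auto simp: partitions_eq)
  have "((\<lambda>np. c (snd np) * q ^ sum_mset (snd np)) has_sum S) (Sigma UNIV partitions)"
    using assms has_sum_reindex_bij_betw[OF bij, of "\<lambda>p. c p * q ^ sum_mset p"] by simp
  moreover have "((\<lambda>p. c (snd (n, p)) * q ^ sum_mset (snd (n, p))) has_sum ((\<Sum>p\<in>partitions n. c p) * q ^ n)) (partitions n)" for n
  proof (rule has_sum_finiteI[OF finite_partitions])
    have "(\<Sum>p\<in>partitions n. c p * q ^ sum_mset p) = (\<Sum>p\<in>partitions n. c p * q ^ n)"
      by (rule sum.cong) (auto simp: partitions_def)
    thus "(\<Sum>p\<in>partitions n. c p) * q ^ n = (\<Sum>p\<in>partitions n. c (snd (n, p)) * q ^ sum_mset (snd (n, p)))"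
      by (simp add: sum_distrib_right)
  qed
  ultimately have "((\<lambda>n. (\<Sum>p\<in>partitions n. c p) * q ^ n) has_sum S) UNIV"
    by (rule has_sum_SigmaD)
  thus ?thesis by (rule has_sum_imp_sums)
qed

section \<open>Rank and crank counts as sums over partitions\<close>

lemma sum_statistic:
  fixes h :: "int \<Rightarrow> complex"
  assumes "finite R" "r ` partitions n \<subseteq> R"
  shows "(\<Sum>m\<in>R. of_nat (card {p \<in> partitions n. r p = m}) * h m) = (\<Sum>p\<in>partitions n. h (r p))"
  using sum_fun_comp[OF finite_partitions assms, of h] by simp

lemma Nrank_eq: "Nrank m n = int (card {p \<in> partitions n. rank0 p = m})"
proof (cases "n = 0")
  case True
  have "{p \<in> {{#}}. rank0 p = m} = (if m = 0 then {{#}} else {})" by (auto simp: rank0_def)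
  thus ?thesis using True by (simp add: Nrank_def partitions_0)
next
  case False
  hence "{p \<in> partitions n. rank p = m} = {p \<in> partitions n. rank0 p = m}"
    by (auto simp: rank0_def partitions_def)
  thus ?thesis using False by (simp add: Nrank_def)
qed

text \<open>The only partition of 1 has crank -1, whereas the convention adds 1 at m = 1 and -1 at m
  = 0. The correction has total 0, so the counts still add up to p(n).\<close>

lemma Ccrank_eq: "Ccrank m n = int (card {p \<in> partitions n. crank0 p = m})
  + (if n = 1 then of_bool (m = 1) - of_bool (m = 0) else 0)"
proof -
  consider "n = 0" | "n = 1" | "n > 1" by linarith
  thus ?thesis
  proof cases
    case 1
    have "{p \<in> {{#}}. crank0 p = m} = (if m = 0 then {{#}} else {})" by (auto simp: crank0_def)
    thus ?thesis using 1 by (simp add: Ccrank_def partitions_0)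
  next
    case 2
    have "{p \<in> {{#1#}}. crank0 p = m} = (if m = -1 then {{#1#}} else {})" by (auto simp: crank0_def crank_def)
    thus ?thesis using 2 partitions_1 by (simp add: Ccrank_def)
  next
    case 3
    hence "{p \<in> partitions n. crank p = m} = {p \<in> partitions n. crank0 p = m}"
      by (auto simp: crank0_def partitions_def)
    thus ?thesis using 3 by (simp add: Ccrank_def)
  qed
qed

lemma support_Nrank: "{m. Nrank m n \<noteq> 0} \<subseteq> rank0 ` partitions n"
  by (auto simp: Nrank_eq card_eq_0_iff)

lemma support_Ccrank: "{m. Ccrank m n \<noteq> 0} \<subseteq> crank0 ` partitions n \<union> {0, 1}"
proof
  fix m assume m: "m \<in> {m. Ccrank m n \<noteq> 0}"
  show "m \<in> crank0 ` partitions n \<union> {0, 1}"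
  proof (rule ccontr)
    assume n: "m \<notin> crank0 ` partitions n \<union> {0, 1}"
    hence "{p \<in> partitions n. crank0 p = m} = {}" by blast
    hence "card {p \<in> partitions n. crank0 p = m} = 0" by (simp only: card.empty)
    thus False using m n by (simp add: Ccrank_eq split: if_splits)
  qed
qed

lemma sum_Nrank:
  "(\<Sum>m | Nrank m n \<noteq> 0. of_int (Nrank m n) * w powi m) = (\<Sum>p\<in>partitions n. (w::complex) powi rank0 p)"
proof -
  have "(\<Sum>m | Nrank m n \<noteq> 0. of_int (Nrank m n) * w powi m) = (\<Sum>m\<in>rank0 ` partitions n. of_int (Nrank m n) * w powi m)"
    by (rule sum.mono_neutral_left) (use finite_partitions support_Nrank in auto)
  also have "\<dots> = (\<Sum>p\<in>partitions n. w powi rank0 p)"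
    using sum_statistic[of "rank0 ` partitions n" rank0 n "\<lambda>m. w powi m"] finite_partitions by (simp add: Nrank_eq)
  finally show ?thesis .
qed

lemma sum_Ccrank:
  "(\<Sum>m | Ccrank m n \<noteq> 0. of_int (Ccrank m n) * w powi m)
    = (\<Sum>p\<in>partitions n. (w::complex) powi crank0 p) + (if n = 1 then w - 1 else 0)"
proof -
  let ?R = "crank0 ` partitions n \<union> {0, 1}"
  have fin: "finite ?R" using finite_partitions by simp
  have delta: "(\<Sum>m\<in>?R. (of_bool (m = a) :: complex) * w powi m) = w powi a" if "a \<in> ?R" for a
  proof -
    have "(\<Sum>m\<in>?R. (of_bool (m = a) :: complex) * w powi m) = (\<Sum>m\<in>?R. if m = a then w powi m else 0)"
      by (rule sum.cong) auto
    thus ?thesis using fin that by simp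
  qed
  have "(\<Sum>m | Ccrank m n \<noteq> 0. of_int (Ccrank m n) * w powi m) = (\<Sum>m\<in>?R. of_int (Ccrank m n) * w powi m)"
    by (rule sum.mono_neutral_left) (use fin support_Ccrank in auto)
  also have "\<dots> = (\<Sum>m\<in>?R. of_nat (card {p \<in> partitions n. crank0 p = m}) * w powi m
      + (if n = 1 then of_bool (m = 1) * w powi m - of_bool (m = 0) * w powi m else 0))"
    by (rule sum.cong) (auto simp: Ccrank_eq algebra_simps)
  also have "\<dots> = (\<Sum>m\<in>?R. of_nat (card {p \<in> partitions n. crank0 p = m}) * w powi m)
      + (if n = 1 then w powi 1 - w powi 0 else 0)"
    unfolding sum.distrib using delta[of 1] delta[of 0] by (cases "n = 1") (simp_all add: sum_subtractf)
  also have "(\<Sum>m\<in>?R. of_nat (card {p \<in> partitions n. crank0 p = m}) * w powi m) = (\<Sum>p\<in>partitions n. w powi crank0 p)"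
    by (rule sum_statistic[OF fin]) auto
  finally show ?thesis by simp
qed

section \<open>Orthogonality of the fifth roots of unity\<close>

lemma fifth_root_power_mod:
  fixes \<zeta> :: complex
  assumes "\<zeta> ^ 5 = 1"
  shows "\<zeta> ^ (5 * k + r) = \<zeta> ^ r"
  using assms by (simp add: power_add power_mult)

lemma fifth_root_primitive:
  fixes \<zeta> :: complex
  assumes "\<zeta> ^ 5 = 1" "\<zeta> ^ r = 1" "0 < r" "r < 5"
  shows "\<zeta> = 1"
proof -
  have e: "\<zeta> ^ 5 = (\<zeta> ^ 2) ^ 2 * \<zeta>" "(\<zeta> ^ 3) ^ 2 = \<zeta> ^ 5 * \<zeta>" "\<zeta> ^ 5 = \<zeta> ^ 4 * \<zeta>" by algebra+
  consider "r = 1" | "r = 2" | "r = 3" | "r = 4" using assms(3,4) by linarith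
  thus ?thesis by cases (use assms(1,2) e in auto)
qed

lemma fifth_root_sum:
  fixes v :: complex
  assumes "v ^ 5 = 1" "v \<noteq> 1"
  shows "1 + v + v ^ 2 + v ^ 3 + v ^ 4 = 0"
proof -
  have "(v - 1) * (1 + v + v ^ 2 + v ^ 3 + v ^ 4) = v ^ 5 - 1" by algebra
  thus ?thesis using assms by simp
qed

text \<open>Discrete Fourier inversion; \<zeta>^(4b) stands for the inverse of \<zeta>^b, which
  keeps the exponent a natural number.\<close>

lemma fifth_root_filter:
  fixes \<zeta> :: complex and c :: "int \<Rightarrow> int"
  assumes z: "\<zeta> ^ 5 = 1" "\<zeta> \<noteq> 1" and fin: "finite {m. c m \<noteq> 0}"
  shows "of_int (\<Sum>m | m mod 5 = int b mod 5 \<and> c m \<noteq> 0. c m) =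
    (\<Sum>j<5. (\<zeta> ^ (4 * b)) ^ j * (\<Sum>m | c m \<noteq> 0. of_int (c m) * (\<zeta> ^ j) powi m)) / 5"
proof -
  have z0: "\<zeta> \<noteq> 0" using z(1) by auto
  have char: "(\<Sum>j<5. (\<zeta> ^ (4 * b)) ^ j * (\<zeta> ^ j) powi m) = (if m mod 5 = int b mod 5 then 5 else 0)" for m
  proof -
    define r where "r = nat ((m + 4 * int b) mod 5)"
    define v where "v = \<zeta> ^ r"
    have r: "int r = (m + 4 * int b) mod 5" "r < 5" by (auto simp: r_def nat_less_iff)
    have "\<zeta> powi (m + 4 * int b) = \<zeta> powi (5 * ((m + 4 * int b) div 5) + int r)" using r by simp
    also have "\<dots> = v" using z0 z(1) unfolding v_def power_int_add[OF disjI1[OF z0]] power_int_mult by simp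
    finally have "\<zeta> ^ (4 * b) * \<zeta> powi m = v"
      using z0 by (simp add: power_int_add mult.commute flip: power_int_of_nat)
    hence "(\<zeta> ^ (4 * b)) ^ j * (\<zeta> ^ j) powi m = v ^ j" for j
      by (metis power_int_of_nat power_int_power power_int_power' power_mult_distrib mult.commute)
    hence S: "(\<Sum>j<5. (\<zeta> ^ (4 * b)) ^ j * (\<zeta> ^ j) powi m) = 1 + v + v ^ 2 + v ^ 3 + v ^ 4"
      by (simp add: eval_nat_numeral)
    have "m mod 5 = int b mod 5 \<longleftrightarrow> 5 dvd (m - int b)" by (rule mod_eq_dvd_iff)
    also have "\<dots> \<longleftrightarrow> 5 dvd (m - int b + 5 * int b)" by (rule dvd_add_left_iff[symmetric]) simp
    also have "m - int b + 5 * int b = m + 4 * int b" by simp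
    finally have iff: "m mod 5 = int b mod 5 \<longleftrightarrow> r = 0" unfolding dvd_eq_mod_eq_0 r(1)[symmetric] by simp
    show ?thesis
    proof (cases "r = 0")
      case True
      thus ?thesis using iff S by (simp add: v_def)
    next
      case False
      have "v \<noteq> 1"
      proof
        assume v: "v = 1"
        thus False using z fifth_root_primitive[OF z(1), of r] False r(2) by (simp add: v_def)
      qed
      moreover have "v ^ 5 = 1" using z(1) unfolding v_def by (metis power_commutes power_mult mult.commute power_one)
      ultimately show ?thesis using fifth_root_sum iff S False by simp
    qed
  qed
  have "(\<Sum>j<5. (\<zeta> ^ (4 * b)) ^ j * (\<Sum>m | c m \<noteq> 0. of_int (c m) * (\<zeta> ^ j) powi m))
      = (\<Sum>m | c m \<noteq> 0. of_int (c m) * (\<Sum>j<5. (\<zeta> ^ (4 * b)) ^ j * (\<zeta> ^ j) powi m))"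
    unfolding sum_distrib_left by (subst sum.swap) (simp add: mult_ac)
  also have "\<dots> = (\<Sum>m | c m \<noteq> 0. if m mod 5 = int b mod 5 then 5 * of_int (c m) else 0)"
    unfolding char by (rule sum.cong) auto
  also have "\<dots> = (\<Sum>m \<in> {m \<in> {m. c m \<noteq> 0}. m mod 5 = int b mod 5}. 5 * of_int (c m))"
    by (rule sum.inter_filter[OF fin, symmetric])
  also have "\<dots> = 5 * of_int (\<Sum>m | m mod 5 = int b mod 5 \<and> c m \<noteq> 0. c m)"
    by (simp add: sum_distrib_left conj_commute)
  finally show ?thesis by simp
qed

text \<open>The root 1 contributes p(n)/5, exactly what the deviation subtracts. The form P + (w +
  w^4) Q is invariant under w -> 1/w, whence equal values at 1, 4 and at 2, 3.\<close>

theorem deviation_from_fifth_roots: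
  fixes c :: "nat \<Rightarrow> int \<Rightarrow> int" and d :: "int \<Rightarrow> complex" and q P Q :: complex
  assumes fin: "\<And>n. finite {m. c n m \<noteq> 0}"
    and c1: "\<And>n. (\<Sum>m | c n m \<noteq> 0. of_int (c n m) * 1 powi m) = (of_nat (npart n) :: complex)"
    and cw: "\<forall>w. w ^ 5 = 1 \<longrightarrow> w \<noteq> 1 \<longrightarrow>
      (\<lambda>n. (\<Sum>m | c n m \<noteq> 0. of_int (c n m) * w powi m) * q ^ n) sums (P + (w + w ^ 4) * Q)"
    and d_def: "\<And>b. d b = (\<Sum>n. (of_int (\<Sum>m | m mod 5 = b mod 5 \<and> c n m \<noteq> 0. c n m) - of_nat (npart n) / 5) * q ^ n)"
  shows "d 0 = (4 * P - 2 * Q) / 5" "d 1 = (- P + 3 * Q) / 5" "d 2 = (- P - 2 * Q) / 5"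
    "d 3 = (- P - 2 * Q) / 5" "d 4 = (- P + 3 * Q) / 5"
proof -
  define \<zeta> where "\<zeta> = cis (2 * pi / 5)"
  have "\<zeta> ^ 5 = cis (real 5 * (2 * pi / 5))" unfolding \<zeta>_def by (rule Complex.DeMoivre)
  hence z5: "\<zeta> ^ 5 = 1" by simp
  have "cos (2 * pi / 5) < cos 0" by (rule cos_monotone_0_pi) auto
  hence z1: "\<zeta> \<noteq> 1" by (auto simp: \<zeta>_def complex_eq_iff)
  have z2: "\<zeta> ^ 2 \<noteq> 1" and z3: "\<zeta> ^ 3 \<noteq> 1" and z4: "\<zeta> ^ 4 \<noteq> 1"
    using fifth_root_primitive[OF z5, of 2] fifth_root_primitive[OF z5, of 3] fifth_root_primitive[OF z5, of 4] z1
    by auto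
  note zs = fifth_root_sum[OF z5 z1]
  have zp: "(\<zeta> ^ j) ^ 5 = 1" for j using z5 by (metis power_commutes power_mult mult.commute power_one)
  define F where "F = (\<lambda>w n. \<Sum>m | c n m \<noteq> 0. of_int (c n m) * (w::complex) powi m)"
  have d: "5 * d (int b) = (\<zeta> ^ (4 * b)) * (P + (\<zeta> + \<zeta> ^ 4) * Q) + (\<zeta> ^ (4 * b)) ^ 2 * (P + (\<zeta> ^ 2 + (\<zeta> ^ 2) ^ 4) * Q)
    + (\<zeta> ^ (4 * b)) ^ 3 * (P + (\<zeta> ^ 3 + (\<zeta> ^ 3) ^ 4) * Q) + (\<zeta> ^ (4 * b)) ^ 4 * (P + (\<zeta> ^ 4 + (\<zeta> ^ 4) ^ 4) * Q)"
    (is "_ = ?S") for b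
  proof -
    have eq: "(of_int (\<Sum>m | m mod 5 = int b mod 5 \<and> c n m \<noteq> 0. c n m) - of_nat (npart n) / 5) * q ^ n
       = (\<zeta> ^ (4 * b) * (F \<zeta> n * q ^ n) + (\<zeta> ^ (4 * b)) ^ 2 * (F (\<zeta> ^ 2) n * q ^ n)
        + (\<zeta> ^ (4 * b)) ^ 3 * (F (\<zeta> ^ 3) n * q ^ n) + (\<zeta> ^ (4 * b)) ^ 4 * (F (\<zeta> ^ 4) n * q ^ n)) / 5" for n
    proof -
      have five: "(\<Sum>j<5. g j) = g 0 + g 1 + g 2 + g 3 + g 4" for g :: "nat \<Rightarrow> complex"
        by (simp add: eval_nat_numeral)
      have "of_int (\<Sum>m | m mod 5 = int b mod 5 \<and> c n m \<noteq> 0. c n m)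
          = (\<Sum>j<5. (\<zeta> ^ (4 * b)) ^ j * F (\<zeta> ^ j) n) / 5"
        unfolding F_def by (rule fifth_root_filter[OF z5 z1 fin])
      moreover have "F (\<zeta> ^ 0) n = of_nat (npart n)" using c1 by (simp add: F_def)
      ultimately show ?thesis unfolding five by (simp add: field_simps)
    qed
    have sums: "(\<lambda>n. (\<zeta> ^ (4 * b) * (F \<zeta> n * q ^ n) + (\<zeta> ^ (4 * b)) ^ 2 * (F (\<zeta> ^ 2) n * q ^ n)
        + (\<zeta> ^ (4 * b)) ^ 3 * (F (\<zeta> ^ 3) n * q ^ n) + (\<zeta> ^ (4 * b)) ^ 4 * (F (\<zeta> ^ 4) n * q ^ n)) / 5) sums (?S / 5)"
      unfolding F_def by (intro sums_divide sums_add sums_mult cw[rule_format] z5 z1 z2 z3 z4 zp)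
    have "d (int b) = ?S / 5" unfolding d_def eq by (rule sums_unique[OF sums, symmetric])
    thus ?thesis by (simp add: mult.commute)
  qed
  have e: "\<zeta> ^ (5 * k + r) = \<zeta> ^ r" for k r by (rule fifth_root_power_mod[OF z5])
  have pw: "\<zeta> ^ 8 = \<zeta> ^ 3" "\<zeta> ^ 12 = \<zeta> ^ 2" "\<zeta> ^ 16 = \<zeta>" "\<zeta> ^ 24 = \<zeta> ^ 4" "\<zeta> ^ 32 = \<zeta> ^ 2"
    "\<zeta> ^ 36 = \<zeta>" "\<zeta> ^ 48 = \<zeta> ^ 3" "\<zeta> ^ 64 = \<zeta> ^ 4"
    using e[of 1 3] e[of 2 2] e[of 3 1] e[of 4 4] e[of 6 2] e[of 7 1] e[of 9 3] e[of 12 4] by simp_all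
  have "5 * d 0 = 4 * P - 2 * Q" using d[of 0] zs z5 by (simp add: pw flip: power_mult) algebra
  thus "d 0 = (4 * P - 2 * Q) / 5" by (simp add: mult.commute)
  have "5 * d 1 = - P + 3 * Q" using d[of 1] zs z5 by (simp add: pw flip: power_mult) algebra
  thus "d 1 = (- P + 3 * Q) / 5" by (simp add: mult.commute)
  have "5 * d 2 = - P - 2 * Q" using d[of 2] zs z5 by (simp add: pw flip: power_mult) algebra
  thus "d 2 = (- P - 2 * Q) / 5" by (simp add: mult.commute)
  have "5 * d 3 = - P - 2 * Q" using d[of 3] zs z5 by (simp add: pw flip: power_mult) algebra
  thus "d 3 = (- P - 2 * Q) / 5" by (simp add: mult.commute)
  have "5 * d 4 = - P + 3 * Q" using d[of 4] zs z5 by (simp add: pw flip: power_mult) algebra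
  thus "d 4 = (- P + 3 * Q) / 5" by (simp add: mult.commute)
qed

theorem theorem8p1:
  fixes q :: complex
  assumes "0 < norm q" and "norm q < 1"
  shows "Dev 0 5 q = 2 * theta5 q 2 2 (-1) 1 + 2 * G5 q (-1) 0
    \<and> Dev 1 5 q = Dev 4 5 q \<and> Dev 4 5 q = theta5 q (-1) (-1) 3 (-3) + G5 q 1 (-1)
    \<and> Dev 2 5 q = Dev 3 5 q \<and> Dev 3 5 q = theta5 q (-1) (-1) (-2) 2 + G5 q 0 1
    \<and> DevC 0 5 q = 2 * theta5 q 2 (-3) (-1) 1
    \<and> DevC 1 5 q = DevC 4 5 q \<and> DevC 4 5 q = theta5 q (-1) 4 (-2) (-3)
    \<and> DevC 2 5 q = DevC 3 5 q \<and> DevC 3 5 q = theta5 q (-1) (-1) 3 2"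
proof -
  have q: "norm q < 1" and q0: "q \<noteq> 0" using assms by auto
  define x where "x = jfun (q ^ 10) (q ^ 25)"
  define y where "y = q * jfun (q ^ 5) (q ^ 25)"
  define u where "u = qpoch_inf (q ^ 5) (q ^ 5)"
  define a where "a = q ^ 5 * gmock (q ^ 5) (q ^ 25)"
  define b where "b = q ^ 8 * gmock (q ^ 10) (q ^ 25)"
  have npart: "(\<Sum>p\<in>partitions n. 1 powi r p) = (of_nat (npart n) :: complex)" for n and r :: "nat multiset \<Rightarrow> int"
    by (simp add: npart_def)
  have nw: "norm w = 1" if "w ^ 5 = 1" for w :: complex
    by (rule power_eq_imp_eq_base[of _ 5]) (use that in \<open>auto simp flip: norm_power\<close>)
  have rank: "\<forall>w. w ^ 5 = 1 \<longrightarrow> w \<noteq> 1 \<longrightarrow>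
    (\<lambda>n. (\<Sum>m | Nrank m n \<noteq> 0. of_int (Nrank m n) * w powi m) * q ^ n) sums
      ((x ^ 2 * (x + y) / u ^ 2 - 2 * a - b) + (w + w ^ 4) * (y ^ 2 * (x - y) / u ^ 2 + a - 2 * b))"
  proof (intro allI impI)
    fix w :: complex assume w: "w ^ 5 = 1" "w \<noteq> 1"
    have "(\<lambda>n. (\<Sum>p\<in>partitions n. w powi rank0 p) * q ^ n) sums ((1 - w) * rank_fun w q)"
      by (rule sums_by_size[OF rank_has_sum[OF q q0 nw[OF w(1)] off_powers_root[OF q q0 w]]])
    also have "(1 - w) * rank_fun w q = (x ^ 2 * (x + y) / u ^ 2 - 2 * a - b) + (w + w ^ 4) * (y ^ 2 * (x - y) / u ^ 2 + a - 2 * b)"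
      unfolding rank_fifth_root[OF q q0 w, folded x_def y_def u_def a_def b_def]
      by (simp add: add_divide_distrib diff_divide_distrib algebra_simps)
    finally show "(\<lambda>n. (\<Sum>m | Nrank m n \<noteq> 0. of_int (Nrank m n) * w powi m) * q ^ n) sums
      ((x ^ 2 * (x + y) / u ^ 2 - 2 * a - b) + (w + w ^ 4) * (y ^ 2 * (x - y) / u ^ 2 + a - 2 * b))"
      unfolding sum_Nrank .
  qed
  have crank: "\<forall>w. w ^ 5 = 1 \<longrightarrow> w \<noteq> 1 \<longrightarrow>
    (\<lambda>n. (\<Sum>m | Ccrank m n \<noteq> 0. of_int (Ccrank m n) * w powi m) * q ^ n) sums
      ((x ^ 2 - x * y - y ^ 2) * x / u ^ 2 + (w + w ^ 4) * ((x ^ 2 - x * y - y ^ 2) * y / u ^ 2))"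
  proof (intro allI impI)
    fix w :: complex assume w: "w ^ 5 = 1" "w \<noteq> 1"
    have split: "M * (x + t * y) / v = M * x / v + t * (M * y / v)" for M t v
      by (simp add: add_divide_distrib distrib_left mult_ac)
    let ?K = "qpoch_inf q q / (qpoch_inf (w * q) q * qpoch_inf (q / w) q)"
    have "(\<lambda>n. (\<Sum>p\<in>partitions n. w powi crank0 p) * q ^ n) sums (?K + q - w * q)"
      by (rule sums_by_size[OF crank_has_sum[OF q q0 nw[OF w(1)]]])
    \<comment> \<open>The correction prescribed at n = 1; it cancels the excess q - w q and leaves
      the pure product.\<close>
    moreover have "(\<lambda>n. if n = 1 then (w - 1) * q ^ n else 0) sums ((w - 1) * q ^ 1)" by (rule sums_single)
    ultimately have "(\<lambda>n. (\<Sum>p\<in>partitions n. w powi crank0 p) * q ^ n + (if n = 1 then (w - 1) * q ^ n else 0)) sums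
      ((?K + q - w * q) + (w - 1) * q ^ 1)" by (rule sums_add)
    also have "(?K + q - w * q) + (w - 1) * q ^ 1 = ?K" by (simp add: algebra_simps)
    also have "?K = (x ^ 2 - x * y - y ^ 2) * x / u ^ 2 + (w + w ^ 4) * ((x ^ 2 - x * y - y ^ 2) * y / u ^ 2)"
      unfolding crank_fifth_root[OF q q0 w, folded x_def y_def u_def] by (rule split)
    also have "(\<lambda>n. (\<Sum>p\<in>partitions n. w powi crank0 p) * q ^ n + (if n = 1 then (w - 1) * q ^ n else 0))
        = (\<lambda>n. (\<Sum>m | Ccrank m n \<noteq> 0. of_int (Ccrank m n) * w powi m) * q ^ n)"
      unfolding sum_Ccrank by (auto simp: algebra_simps)
    finally show "(\<lambda>n. (\<Sum>m | Ccrank m n \<noteq> 0. of_int (Ccrank m n) * w powi m) * q ^ n) sums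
      ((x ^ 2 - x * y - y ^ 2) * x / u ^ 2 + (w + w ^ 4) * ((x ^ 2 - x * y - y ^ 2) * y / u ^ 2))" .
  qed
  have fR: "finite {m. Nrank m n \<noteq> 0}" "finite {m. Ccrank m n \<noteq> 0}" for n
    by (rule finite_subset[OF support_Nrank] finite_subset[OF support_Ccrank], simp add: finite_partitions)+
  have c1: "(\<Sum>m | Nrank m n \<noteq> 0. of_int (Nrank m n) * 1 powi m) = (of_nat (npart n) :: complex)"
    "(\<Sum>m | Ccrank m n \<noteq> 0. of_int (Ccrank m n) * 1 powi m) = (of_nat (npart n) :: complex)" for n
    unfolding sum_Nrank sum_Ccrank npart by simp_all
  have dev: "Dev k 5 q = (\<Sum>n. (of_int (\<Sum>m | m mod 5 = k mod 5 \<and> Nrank m n \<noteq> 0. Nrank m n) - of_nat (npart n) / 5) * q ^ n)"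
    "DevC k 5 q = (\<Sum>n. (of_int (\<Sum>m | m mod 5 = k mod 5 \<and> Ccrank m n \<noteq> 0. Ccrank m n) - of_nat (npart n) / 5) * q ^ n)" for k
    by (simp_all add: Dev_def DevC_def Nmod_def Cmod_def)
  note R = deviation_from_fifth_roots[where c = "\<lambda>n m. Nrank m n" and d = "\<lambda>k. Dev k 5 q", OF fR(1) c1(1) rank dev(1)]
  note C = deviation_from_fifth_roots[where c = "\<lambda>n m. Ccrank m n" and d = "\<lambda>k. DevC k 5 q", OF fR(2) c1(2) crank dev(2)]
  have "norm (q ^ 5) < 1" using q by (simp add: norm_power power_less_one_iff)
  hence u: "Jm q 5 = u"
    using jfun_pentagonal[of "q ^ 5"] q0 by (simp add: Jm_def Jam_def u_def flip: power_mult)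
  have th: "theta5 q a0 a1 a2 a3 = (a0 * x ^ 3 + a1 * (y * x ^ 2) + a2 * (y ^ 2 * x) + a3 * y ^ 3) / (5 * u ^ 2)" for a0 a1 a2 a3
    unfolding theta5_def u by (simp add: Jam_def x_def y_def power_mult_distrib mult_ac)
  have G: "G5 q b0 b3 = b0 * a + b3 * b" for b0 b3
    by (simp add: G5_def a_def b_def mult.assoc)
  have u0: "u \<noteq> 0"
    using qpoch_bounds(2)[OF \<open>norm (q ^ 5) < 1\<close> \<open>norm (q ^ 5) < 1\<close>] by (simp add: u_def)
  \<comment> \<open>For instance (4 P - 2 Q)/5 for the rank has theta numerator 4 x^2 (x + y) - 2
    y^2 (x - y) over 5 u^2, while its terms in a and b collapse to -2 a.\<close>
  show ?thesis
    unfolding R C th G using u0 by (intro conjI) (simp_all add: field_simps power2_eq_square power3_eq_cube)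
qed

end
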